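(* Let $n\in\mathbb N$, $n\ge 2$, and $\lambda=\frac{n-1}{2}$. 1) Let $a\in\mathbb R\setminus\{l(n+l-1):\ l\in\mathbb N_0\}$ and suppose that $f\in\mathcal C(\mathcal S^n)$ and $u\in\mathcal C^2(\mathcal S^n)$ satisfy $$\Delta^{*}u+au=f .$$ Then $u=f\ast G$, where $G$ is the zonal function with Gegenbauer expansion $$G=\sum_{l=0}^\infty\frac{1}{a-l(n+l-1)}\,\frac{\lambda+l}{\lambda}\,\mathcal C_l^\lambda .$$ 2) Suppose that $f\in\mathcal C(\mathcal S^n)$ and $u\in\mathcal C^2(\mathcal S^n)$ are such that $\int_{\mathcal S^n} f\,d\sigma=\int_{\mathcal S^n} u\,d\sigma=0$ and $$\Delta^{*}u=f .$$ Then $u=f\ast G$, where $G$ is the zonal function with Gegenbauer expansion $$G=\sum_{l=1}^\infty\frac{-1}{l(n+l-1)}\,\frac{\lambda+l}{\lambda}\,\mathcal C_l^\lambda .$$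
   Context: $\mathcal S^n\subset\mathbb R^{n+1}$ is the $n$-dimensional unit sphere with rotation-invariant surface measure $d\sigma$ of total mass $\Sigma_n=\int_{\mathcal S^n}d\sigma=\frac{2\pi^{(n+1)/2}}{\Gamma((n+1)/2)}$. $\Delta^{*}$ is the Laplace–Beltrami operator on $\mathcal S^n$, with the sign convention that spherical harmonics $Y_l$ of degree $l$ satisfy $\Delta^{*}Y_l=-l(n+l-1)Y_l$. $\mathbb N_0=\{0,1,2,\dots\}$. $\mathcal C_l^\lambda$ is the Gegenbauer polynomial of degree $l$ and order $\lambda$, defined by $\sum_{l\ge0}\mathcal C_l^\lambda(t)\,r^l=(1-2tr+r^2)^{-\lambda}$. A zonal function on $\mathcal S^n$ is one that depends only on the first coordinate $t=x_1=\cos\vartheta$ of $x\in\mathcal S^n$, and is identified with a function of $t\in[-1,1]$. A zonal $\mathcal L^1(\mathcal S^n)$ function $g$ is represented by its Gegenbauer expansion $g=\sum_{l=0}^\infty\widehat g(l)\,\mathcal C_l^\lambda$, with Gegenbauer coefficients $$\widehat g(l)=\frac{\int_{-1}^1 g(t)\,\mathcal C_l^\lambda(t)(1-t^2)^{\lambda-1/2}dt}{\int_{-1}^1 \mathcal C_l^\lambda(t)^2(1-t^2)^{\lambda-1/2}dt}.$$ Accordingly, writing $G$ as a series of the $\mathcal C_l^\lambda$ means that $G$ is the zonal $\mathcal L^1(\mathcal S^n)$ function with the indicated Gegenbauer coefficients (coefficients not appearing in the series are $0$); pointwise convergence of the series is not meant. For $f,g\in\mathcal L^1(\mathcal S^n)$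 with $g$ zonal, the convolution is $$(f\ast g)(x)=\frac{1}{\Sigma_n}\int_{\mathcal S^n}f(y)\,g(x\cdot y)\,d\sigma(y),$$ where $x\cdot y$ is the Euclidean inner product in $\mathbb R^{n+1}$. *)

theory Defs
  imports "HOL-Analysis.Analysis"
begin

section \<open>The surface measure on the unit sphere\<close>

text \<open>
  The library has no surface measure, so it is given here as the cone measure: the mass of a Borel
  set \<open>A\<close> of the unit sphere is the dimension of the ambient space times the volume of the part
  \<open>{x. 0 < norm x \<le> 1 \<and> x / norm x \<in> A}\<close> of the unit ball lying over it.  The lemmas below show
  that it is the rotation-invariant measure with the total mass
  \<open>2 * pi powr (N / 2) / Gamma (N / 2)\<close>, where \<open>N\<close> is the dimension of the ambient space.
\<close>

definition sphere_measure :: "'a::euclidean_space measure" where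
  "sphere_measure =
     scale_measure (of_nat DIM('a))
       (distr (restrict_space lborel (cball 0 1 - {0})) (restrict_space borel (sphere 0 1)) sgn)"

lemma space_sphere_measure [simp]: "space (sphere_measure :: 'a::euclidean_space measure) = sphere 0 1"
  by (simp add: sphere_measure_def space_scale_measure space_restrict_space)

lemma sets_sphere_measure [simp, measurable_cong]:
  "sets (sphere_measure :: 'a::euclidean_space measure) = sets (restrict_space borel (sphere 0 1))"
  by (simp add: sphere_measure_def)

lemma sgn_measurable_punctured_cball:
  "sgn \<in> measurable (restrict_space lborel (cball 0 1 - {0::'a::euclidean_space}))
                    (restrict_space borel (sphere 0 1))"
proof (rule measurable_restrict_space2)
  show "sgn \<in> space (restrict_space lborel (cball 0 1 - {0::'a})) \<rightarrow> sphere 0 1"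
    by (auto simp: space_restrict_space norm_sgn)
  have "(\<lambda>x::'a. x /\<^sub>R norm x) \<in> borel_measurable borel" by measurable
  then have "sgn \<in> borel_measurable (borel :: 'a measure)"
    by (simp add: sgn_div_norm[abs_def])
  then show "sgn \<in> borel_measurable (restrict_space lborel (cball 0 1 - {0::'a}))"
    by (intro measurable_restrict_space1) simp
qed

lemma emeasure_sphere_measure:
  assumes "A \<in> sets borel" "A \<subseteq> sphere 0 1"
  shows "emeasure (sphere_measure :: 'a::euclidean_space measure) A =
           of_nat DIM('a) * emeasure lborel {x \<in> cball 0 1 - {0}. sgn x \<in> A}"
proof -
  have A: "A \<in> sets (restrict_space borel (sphere 0 1))"
    using assms by (auto simp: sets_restrict_space_iff)
  have "emeasure (sphere_measure :: 'a measure) A = of_nat DIM('a) *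
          emeasure (restrict_space lborel (cball 0 1 - {0::'a})) (sgn -` A \<inter> (cball 0 1 - {0}))"
    unfolding sphere_measure_def emeasure_scale_measure
    by (subst emeasure_distr[OF sgn_measurable_punctured_cball A]) (simp add: space_restrict_space)
  also have "\<dots> = of_nat DIM('a) * emeasure lborel (sgn -` A \<inter> (cball 0 1 - {0::'a}))"
    by (subst emeasure_restrict_space) auto
  also have "sgn -` A \<inter> (cball 0 1 - {0::'a}) = {x \<in> cball 0 1 - {0}. sgn x \<in> A}" by auto
  finally show ?thesis .
qed

lemma emeasure_sphere_measure_total:
  "emeasure (sphere_measure :: 'a::euclidean_space measure) (sphere 0 1) =
     ennreal (2 * pi powr (DIM('a) / 2) / Gamma (DIM('a) / 2))"
proof -
  let ?N = "real DIM('a)"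
  have "{x \<in> cball 0 1 - {0}. sgn x \<in> sphere 0 1} = cball (0::'a) 1 - {0}"
    by (auto simp: norm_sgn)
  then have "emeasure (sphere_measure :: 'a measure) (sphere 0 1) =
      of_nat DIM('a) * emeasure lborel (cball (0::'a) 1 - {0})"
    by (simp add: emeasure_sphere_measure)
  also have "emeasure lborel (cball (0::'a) 1 - {0}) = emeasure lborel (cball (0::'a) 1)"
    by (subst emeasure_Diff) auto
  also have "of_nat DIM('a) * \<dots> = ennreal (?N * unit_ball_vol ?N)"
    by (simp add: emeasure_cball ennreal_mult ennreal_of_nat_eq_real_of_nat)
  also have "?N * unit_ball_vol ?N = 2 * pi powr (?N / 2) / Gamma (?N / 2)"
  proof -
    have pos: "?N / 2 > 0" by simp
    then have "?N / 2 \<notin> \<int>\<^sub>\<le>\<^sub>0" by (meson nonpos_Ints_nonpos not_le)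
    then have *: "Gamma (?N / 2 + 1) = ?N / 2 * Gamma (?N / 2)" by (rule Gamma_plus1)
    have "Gamma (?N / 2) > 0" by (rule Gamma_real_pos[OF pos])
    then show ?thesis unfolding unit_ball_vol_def * by simp
  qed
  finally show ?thesis .
qed

lemma measure_sphere_measure_total:
  "measure (sphere_measure :: 'a::euclidean_space measure) (sphere 0 1) =
     2 * pi powr (DIM('a) / 2) / Gamma (DIM('a) / 2)"
  by (simp add: measure_def emeasure_sphere_measure_total Gamma_real_pos less_imp_le)

lemma sphere_measure_rotation_invariant:
  fixes T :: "real^'n::{finite,wellorder} \<Rightarrow> real^'n::_"
  assumes T: "orthogonal_transformation T"
    and A: "A \<in> sets borel" "A \<subseteq> sphere 0 1"
  shows "emeasure sphere_measure (T ` A) = emeasure sphere_measure A"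
proof -
  have lin: "linear T" and bij: "bij T" and nT: "\<And>x. norm (T x) = norm x"
    using T by (auto simp: orthogonal_transformation orthogonal_transformation_bij)
  obtain T' where T': "orthogonal_transformation T'" "\<And>x. T' (T x) = x" "\<And>x. T (T' x) = x"
    using that[of "inv T"] orthogonal_transformation_inv[OF T] bij
    by (simp add: bij_is_inj bij_is_surj surj_f_inv_f)
  have cT: "continuous_on UNIV T'"
    using T' by (simp add: orthogonal_transformation linear_continuous_on linear_conv_bounded_linear)
  have im: "T ` S = T' -` S" for S
  proof (intro set_eqI iffI)
    fix y assume "y \<in> T' -` S"
    then show "y \<in> T ` S" using T'(3)[of y] by (metis imageI vimageD)
  qed (auto simp: T'(2))
  have TA: "T ` A \<in> sets borel"
    using measurable_sets[OF borel_measurable_continuous_onI[OF cT] A(1)] by (simp add: im)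
  have TA': "T ` A \<subseteq> sphere 0 1" using A nT by auto
  have sgnT: "sgn (T x) = T (sgn x)" for x
    by (simp add: sgn_div_norm nT linear_cmul[OF lin])
  let ?C = "\<lambda>A. {x \<in> cball 0 1 - {0}. sgn x \<in> A}"
  have C: "?C B \<in> sets borel" if "B \<in> sets borel" "B \<subseteq> sphere 0 1" for B :: "(real^'n::_) set"
  proof -
    have B: "B \<in> sets (restrict_space borel (sphere 0 1))"
      using that by (auto simp: sets_restrict_space_iff)
    have "sgn -` B \<inter> (cball 0 1 - {0}) \<in> sets (restrict_space lborel (cball 0 1 - {0::real^'n::_}))"
      using measurable_sets[OF sgn_measurable_punctured_cball B] by (simp add: space_restrict_space)
    then have "sgn -` B \<inter> (cball 0 1 - {0}) \<in> sets borel"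
      by (subst (asm) sets_restrict_space_iff) auto
    moreover have "sgn -` B \<inter> (cball 0 1 - {0}) = ?C B" by auto
    ultimately show ?thesis by simp
  qed
  have "?C (T ` A) = T ` ?C A"
  proof (intro set_eqI iffI)
    fix x assume x: "x \<in> ?C (T ` A)"
    then have "sgn (T (T' x)) \<in> T ` A" by (simp add: T')
    then have "sgn (T' x) \<in> A"
      using bij by (simp add: sgnT bij_is_inj inj_image_mem_iff)
    moreover have "norm (T' x) = norm x" using nT[of "T' x"] by (simp add: T')
    moreover have "norm x \<le> 1" "norm x \<noteq> 0" using x by simp_all
    ultimately have "T' x \<in> ?C A"
      by (metis (mono_tags, lifting) DiffI mem_Collect_eq mem_cball_0 norm_zero singletonD)
    then show "x \<in> T ` ?C A" by (rule image_eqI[rotated]) (simp add: T'(3))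
  next
    fix x assume "x \<in> T ` ?C A"
    then obtain y where y: "y \<in> ?C A" "x = T y" by blast
    then have "norm y \<le> 1" "norm y \<noteq> 0" "sgn y \<in> A" by simp_all
    then have "norm x \<le> 1" "norm x \<noteq> 0" "sgn x \<in> T ` A" using y nT[of y] by (simp_all add: sgnT)
    then show "x \<in> ?C (T ` A)" by simp
  qed
  moreover have "?C A \<in> lmeasurable"
  proof (rule bounded_set_imp_lmeasurable)
    show "bounded (?C A)" by (rule bounded_subset[OF bounded_cball[of 0 1]]) auto
    have "?C A \<in> sets lborel" using C[OF A] by simp
    then show "?C A \<in> sets lebesgue" by (rule sets_completionI_sets)
  qed
  ultimately have eq: "measure lebesgue (?C (T ` A)) = measure lebesgue (?C A)"
    by (simp only: measure_orthogonal_image[OF T])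
  have fin: "emeasure lborel (?C B) = ennreal (measure lebesgue (?C B))"
    if "B \<in> sets borel" "B \<subseteq> sphere 0 1" for B :: "(real^'n::_) set"
  proof -
    have "emeasure lborel (?C B) \<le> emeasure lborel (cball (0::real^'n::_) 1)"
      by (rule emeasure_mono) auto
    also have "\<dots> < \<infinity>" by (simp add: emeasure_cball)
    finally have "emeasure lborel (?C B) \<noteq> \<infinity>" by simp
    then have "emeasure lborel (?C B) = ennreal (measure lborel (?C B))"
      by (intro emeasure_eq_ennreal_measure) auto
    also have "measure lborel (?C B) = measure lebesgue (?C B)"
      using C[OF that] by (subst measure_completion) auto
    finally show ?thesis .
  qed
  show ?thesis
    unfolding emeasure_sphere_measure[OF TA TA'] emeasure_sphere_measure[OF A]
      fin[OF TA TA'] fin[OF A] eq by (rule refl)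
qed


section \<open>Twice continuously differentiable functions and the Laplace--Beltrami operator\<close>

definition C2_on :: "'a::euclidean_space set \<Rightarrow> ('a \<Rightarrow> real) \<Rightarrow> bool" where
  "C2_on U F \<longleftrightarrow>
     (\<exists>(F' :: 'a \<Rightarrow> 'a \<Rightarrow>\<^sub>L real) (F'' :: 'a \<Rightarrow> 'a \<Rightarrow>\<^sub>L ('a \<Rightarrow>\<^sub>L real)).
        (\<forall>x\<in>U. (F has_derivative blinfun_apply (F' x)) (at x)) \<and>
        (\<forall>x\<in>U. (F' has_derivative blinfun_apply (F'' x)) (at x)) \<and>
        continuous_on U F'')"

definition laplacian :: "('a::euclidean_space \<Rightarrow> real) \<Rightarrow> 'a \<Rightarrow> real" where
  "laplacian F x = (\<Sum>b\<in>Basis. (deriv ^^ 2) (\<lambda>t. F (x + t *\<^sub>R b)) 0)"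

text \<open>
  A function on the unit sphere is represented by a function on the whole space of which only the
  values on the sphere matter.  Smoothness on the sphere and the Laplace--Beltrami operator are
  taken, as usual, through the extension \<open>\<lambda>x. u (sgn x)\<close>, \<open>sgn x = x / norm x\<close>, which is constant
  along rays.
\<close>

definition C2_on_sphere :: "('a::euclidean_space \<Rightarrow> real) \<Rightarrow> bool" where
  "C2_on_sphere u \<longleftrightarrow> C2_on (- {0}) (\<lambda>x. u (sgn x))"

definition laplace_beltrami :: "('a::euclidean_space \<Rightarrow> real) \<Rightarrow> 'a \<Rightarrow> real" where
  "laplace_beltrami u = laplacian (\<lambda>x. u (sgn x))"

text \<open>
  The sign convention: on the unit sphere of an \<open>n + 1\<close>-dimensional space the restriction of a
  harmonic function that is homogeneous of degree \<open>l\<close> has the eigenvalue \<open>- l * (n + l - 1)\<close>.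
\<close>

lemma laplace_beltrami_spherical_harmonic:
  fixes H :: "'a::euclidean_space \<Rightarrow> real"
  assumes H: "C2_on (- {0}) H" and harm: "\<And>x. x \<noteq> 0 \<Longrightarrow> laplacian H x = 0"
    and hom: "\<And>r x. r > 0 \<Longrightarrow> H (r *\<^sub>R x) = r ^ l * H x"
    and n: "DIM('a) = n + 1" and x: "x \<in> sphere 0 1"
  shows "laplace_beltrami H x = - real l * (real n + real l - 1) * H x"
proof -
  obtain H' :: "'a \<Rightarrow> 'a \<Rightarrow>\<^sub>L real" and H'' :: "'a \<Rightarrow> 'a \<Rightarrow>\<^sub>L ('a \<Rightarrow>\<^sub>L real)" where
    H1: "\<And>x. x \<noteq> 0 \<Longrightarrow> (H has_derivative blinfun_apply (H' x)) (at x)" and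
    H2: "\<And>x. x \<noteq> 0 \<Longrightarrow> (H' has_derivative blinfun_apply (H'' x)) (at x)"
    using H unfolding C2_on_def by auto
  have nx: "norm x = 1" and x0: "x \<noteq> 0" and xx: "x \<bullet> x = 1"
    using x by (auto simp: norm_eq_1)
  have near: "eventually (\<lambda>t. x + t *\<^sub>R b \<noteq> 0) (nhds 0)" for b :: 'a
  proof -
    have "((\<lambda>t. x + t *\<^sub>R b) \<longlongrightarrow> x + 0 *\<^sub>R b) (nhds 0)" by (intro tendsto_intros) (auto simp: filterlim_ident)
    then show ?thesis using x0 by (auto dest: tendsto_imp_eventually_ne)
  qed
  have D1: "((\<lambda>t. H (x + t *\<^sub>R b)) has_real_derivative H' (x + t *\<^sub>R b) b) (at t)"
    if "x + t *\<^sub>R b \<noteq> 0" for b t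
  proof -
    have "((\<lambda>t. H (x + t *\<^sub>R b)) has_derivative (\<lambda>s. H' (x + t *\<^sub>R b) (s *\<^sub>R b))) (at t)"
      by (rule has_derivative_compose[where f = "\<lambda>t. x + t *\<^sub>R b", OF _ H1[OF that]]) (auto intro!: derivative_eq_intros)
    then show ?thesis
      by (simp add: has_field_derivative_def blinfun.scaleR_right mult.commute[of _ "H' (x + t *\<^sub>R b) b"])
  qed
  have D2: "((\<lambda>t. H' (x + t *\<^sub>R b) b) has_real_derivative H'' (x + t *\<^sub>R b) b b) (at t)"
    if "x + t *\<^sub>R b \<noteq> 0" for b t
  proof -
    have "((\<lambda>t. H' (x + t *\<^sub>R b)) has_derivative (\<lambda>s. H'' (x + t *\<^sub>R b) (s *\<^sub>R b))) (at t)"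
      by (rule has_derivative_compose[where f = "\<lambda>t. x + t *\<^sub>R b", OF _ H2[OF that]]) (auto intro!: derivative_eq_intros)
    then have "((\<lambda>t. H' (x + t *\<^sub>R b) b) has_derivative (\<lambda>s. H'' (x + t *\<^sub>R b) (s *\<^sub>R b) b)) (at t)"
      by (rule bounded_linear.has_derivative[OF blinfun.bounded_linear_left])
    then show ?thesis
      by (simp add: has_field_derivative_def blinfun.scaleR_right blinfun.scaleR_left
          mult.commute[of _ "H'' (x + t *\<^sub>R b) b b"])
  qed
  have dd: "(deriv ^^ 2) f 0 = c"
    if ev: "eventually (\<lambda>t. (f has_real_derivative g t) (at t)) (nhds 0)"
      and g: "(g has_real_derivative c) (at 0)" for f g :: "real \<Rightarrow> real" and c
  proof -
    have "eventually (\<lambda>t. deriv f t = g t) (nhds 0)"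
      using ev by eventually_elim (rule DERIV_imp_deriv)
    then have "deriv (deriv f) 0 = deriv g 0" by (rule deriv_cong_ev) simp
    then show ?thesis using DERIV_imp_deriv[OF g] by (simp add: numeral_2_eq_2)
  qed
  have lapH: "laplacian H x = (\<Sum>b\<in>Basis. H'' x b b)"
    unfolding laplacian_def
  proof (rule sum.cong[OF refl])
    fix b :: 'a
    show "(deriv ^^ 2) (\<lambda>t. H (x + t *\<^sub>R b)) 0 = H'' x b b"
      using near[of b] D2[of 0 b] x0 by (intro dd) (auto elim!: eventually_mono intro: D1)
  qed
  define m where "m = - real l / 2"
  have Hsgn: "H (sgn y) = (y \<bullet> y) powr m * H y" if "y \<noteq> 0" for y
  proof -
    have "H (sgn y) = (1 / norm y) ^ l * H y"
      using hom[of "1 / norm y" y] that by (simp add: sgn_div_norm divide_inverse)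
    also have "(1 / norm y) ^ l = (y \<bullet> y) powr m"
      using that by (simp add: m_def dot_square_norm powr_powr powr_minus powr_realpow power_one_over
          inverse_eq_divide flip: powr_numeral)
    finally show ?thesis .
  qed
  have summand: "(deriv ^^ 2) (\<lambda>t. H (sgn (x + t *\<^sub>R b))) 0 =
      H'' x b b + 2 * (2 * m * (x \<bullet> b)) * H' x b + (2 * m + 4 * m * (m - 1) * (x \<bullet> b)\<^sup>2) * H x"
    if b: "b \<in> Basis" for b
  proof -
    define Q where "Q = (\<lambda>t. (x + t *\<^sub>R b) \<bullet> (x + t *\<^sub>R b))"
    have DQ: "(Q has_real_derivative 2 * (x \<bullet> b + t)) (at t)" for t
    proof -
      have "Q = (\<lambda>t. 1 + 2 * t * (x \<bullet> b) + t\<^sup>2)"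
        using b xx by (auto simp: Q_def inner_add_left inner_add_right inner_commute power2_eq_square)
      then show ?thesis by (auto intro!: derivative_eq_intros)
    qed
    have Qpos: "Q t > 0" if "x + t *\<^sub>R b \<noteq> 0" for t using that by (simp add: Q_def)
    have DQp: "((\<lambda>t. Q t powr p) has_real_derivative p * Q t powr (p - 1) * (2 * (x \<bullet> b + t))) (at t)"
      if "x + t *\<^sub>R b \<noteq> 0" for t p
      using DERIV_fun_powr[OF DQ Qpos[OF that]] by simp
    define g where "g = (\<lambda>t. Q t powr m * H' (x + t *\<^sub>R b) b
        + m * Q t powr (m - 1) * (2 * (x \<bullet> b + t)) * H (x + t *\<^sub>R b))"
    have *: "((\<lambda>t. H (sgn (x + t *\<^sub>R b))) has_real_derivative g t) (at t)"
      if t: "x + t *\<^sub>R b \<noteq> 0" and evt: "eventually (\<lambda>t. x + t *\<^sub>R b \<noteq> 0) (nhds t)" for t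
    proof -
      have "((\<lambda>t. Q t powr m * H (x + t *\<^sub>R b)) has_real_derivative g t) (at t)"
        unfolding g_def using DERIV_mult'[OF DQp[OF t, of m] D1[OF t]] by simp
      moreover have "eventually (\<lambda>t. H (sgn (x + t *\<^sub>R b)) = Q t powr m * H (x + t *\<^sub>R b)) (nhds t)"
        using evt by eventually_elim (simp add: Hsgn Q_def)
      ultimately show ?thesis by (subst DERIV_cong_ev) auto
    qed
    have ev: "eventually (\<lambda>t. ((\<lambda>t. H (sgn (x + t *\<^sub>R b))) has_real_derivative g t) (at t)) (nhds 0)"
    proof -
      have "eventually (\<lambda>t. eventually (\<lambda>t. x + t *\<^sub>R b \<noteq> 0) (nhds t)) (nhds 0)"
        using near[of b] by (simp only: eventually_eventually)
      then show ?thesis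
        by (rule eventually_mono) (rule *, auto dest: eventually_nhds_x_imp_x)
    qed
    have x00: "x + 0 *\<^sub>R b \<noteq> 0" using x0 by simp
    have Q0: "Q 0 = 1" using xx by (simp add: Q_def)
    have "(g has_real_derivative
       H'' x b b + 2 * (2 * m * (x \<bullet> b)) * H' x b + (2 * m + 4 * m * (m - 1) * (x \<bullet> b)\<^sup>2) * H x) (at 0)"
      unfolding g_def
      by (rule derivative_eq_intros DQp[OF x00] D1[OF x00] D2[OF x00] refl)+
         (simp add: Q0 algebra_simps power2_eq_square)
    then show ?thesis using ev by (rule dd[rotated])
  qed
  have euler: "H' x x = real l * H x"
  proof -
    have "((\<lambda>t. H (t *\<^sub>R x)) has_derivative (\<lambda>s. H' (1 *\<^sub>R x) (s *\<^sub>R x))) (at 1)"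
      by (rule has_derivative_compose[where f = "\<lambda>t. t *\<^sub>R x", OF _ H1]) (auto intro!: derivative_eq_intros simp: x0)
    then have "((\<lambda>t. H (t *\<^sub>R x)) has_real_derivative H' x x) (at 1)"
      by (simp add: has_field_derivative_def blinfun.scaleR_right mult.commute[of _ "H' x x"])
    moreover have "eventually (\<lambda>t. H (t *\<^sub>R x) = t ^ l * H x) (nhds (1::real))"
      by (rule eventually_mono[OF eventually_nhds_in_open[of "{0<..}"]]) (auto simp: hom)
    ultimately have "((\<lambda>t. t ^ l * H x) has_real_derivative H' x x) (at 1)"
      by (subst (asm) DERIV_cong_ev) auto
    moreover have "((\<lambda>t. t ^ l * H x) has_real_derivative real l * H x) (at 1)"
      by (auto intro!: derivative_eq_intros)
    ultimately show ?thesis by (rule DERIV_unique)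
  qed
  have lin: "(\<Sum>b\<in>Basis. (x \<bullet> b) * H' x b) = H' x x"
  proof -
    have "H' x x = H' x (\<Sum>b\<in>Basis. (x \<bullet> b) *\<^sub>R b)" by (simp add: euclidean_representation)
    then show ?thesis by (simp add: blinfun.sum_right blinfun.scaleR_right)
  qed
  have sq: "(\<Sum>b\<in>Basis. (x \<bullet> b)\<^sup>2) = 1"
    using xx by (subst (asm) euclidean_inner) (simp add: power2_eq_square)
  have "laplace_beltrami H x = (\<Sum>b\<in>Basis. H'' x b b) + 4 * m * (\<Sum>b\<in>Basis. (x \<bullet> b) * H' x b)
      + (2 * m * DIM('a) + 4 * m * (m - 1) * (\<Sum>b\<in>Basis. (x \<bullet> b)\<^sup>2)) * H x"
  proof -
    have "laplace_beltrami H x = (\<Sum>b\<in>Basis. H'' x b b + 4 * m * ((x \<bullet> b) * H' x b)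
        + (2 * m * H x + 4 * m * (m - 1) * H x * (x \<bullet> b)\<^sup>2))"
      unfolding laplace_beltrami_def laplacian_def
      by (rule sum.cong[OF refl]) (simp add: summand algebra_simps)
    also have "\<dots> = (\<Sum>b\<in>Basis. H'' x b b) + 4 * m * (\<Sum>b\<in>Basis. (x \<bullet> b) * H' x b)
        + (real DIM('a) * (2 * m * H x) + 4 * m * (m - 1) * H x * (\<Sum>b\<in>Basis. (x \<bullet> b)\<^sup>2))"
      by (simp add: sum.distrib sum_distrib_left)
    finally show ?thesis by (simp only: ring_distribs mult_ac)
  qed
  also have "\<dots> = - real l * (real n + real l - 1) * H x"
    using lapH harm[OF x0] n
    by (simp add: lin sq euler m_def) (simp add: field_simps)
  finally show ?thesis .
qed


section \<open>Gegenbauer expansions of zonal functions and convolution\<close>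

text \<open>
  The coefficient of \<open>r ^ l\<close> in the formal power series \<open>(1 - 2 * t * r + r\<^sup>2) powr (- lam)\<close>, the
  binomial series \<open>fps_binomial (- lam)\<close> being \<open>(1 + X) powr (- lam)\<close>.
\<close>

definition gegenbauer :: "real \<Rightarrow> nat \<Rightarrow> real \<Rightarrow> real" where
  "gegenbauer lam l t =
     fps_nth (fps_binomial (- lam) oo (fps_X\<^sup>2 - fps_const (2 * t) * fps_X)) l"

definition gegenbauer_coeff :: "real \<Rightarrow> (real \<Rightarrow> real) \<Rightarrow> nat \<Rightarrow> real" where
  "gegenbauer_coeff lam g l =
     (LBINT t:{-1..1}. g t * gegenbauer lam l t * (1 - t\<^sup>2) powr (lam - 1 / 2)) /
     (LBINT t:{-1..1}. (gegenbauer lam l t)\<^sup>2 * (1 - t\<^sup>2) powr (lam - 1 / 2))"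

text \<open>
  A zonal function is given by its profile \<open>g\<close>, a function of the first coordinate, whose index is
  the least element of the (finite, well-ordered) index type.  The type argument carries the ambient
  space.
\<close>

definition zonal_L1 :: "(real^'n::{finite,wellorder}) itself \<Rightarrow> (real \<Rightarrow> real) \<Rightarrow> bool" where
  "zonal_L1 _ g \<longleftrightarrow> integrable sphere_measure (\<lambda>x :: real^'n::_. g (x $ (LEAST i. True)))"

text \<open>
  \<open>g\<close> is the zonal integrable function represented by the series \<open>\<Sum>l. c l * gegenbauer lam l\<close>:
  its coefficients are prescribed, convergence of the series is not asked for.
\<close>

definition has_gegenbauer_expansion ::
  "(real^'n::{finite,wellorder}) itself \<Rightarrow> real \<Rightarrow> (real \<Rightarrow> real) \<Rightarrow> (nat \<Rightarrow> real) \<Rightarrow> bool" where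
  "has_gegenbauer_expansion E lam g c \<longleftrightarrow>
     zonal_L1 E g \<and> (\<forall>l. gegenbauer_coeff lam g l = c l)"

definition sphere_conv :: "('a::euclidean_space \<Rightarrow> real) \<Rightarrow> (real \<Rightarrow> real) \<Rightarrow> 'a \<Rightarrow> real" where
  "sphere_conv f g x =
     1 / measure (sphere_measure :: 'a measure) (sphere 0 1) *
     (LINT y|sphere_measure. f y * g (x \<bullet> y))"

end

theory Submission
  imports Defs
begin

text \<open>
  Write \<open>t = x \<bullet> y\<close> and \<open>s = (1 + t) / 2\<close>.  Self-adjointness of the Laplace--Beltrami operator turns
  the integral of \<open>f\<close> against a zonal polynomial \<open>P(t)\<close> into the integral of \<open>u\<close> against
  \<open>L P + a P\<close>, where \<open>L\<close> is the Gegenbauer operator.  The solution of \<open>L G + a G = const\<close> that is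
  regular at \<open>t = - 1\<close> is a power series in \<open>s\<close> whose truncations satisfy the same equation up to
  one term, a multiple of \<open>s ^ m\<close>.  That multiple is governed by the product of the
  \<open>1 - a / (j * (j + n - 1))\<close>, which converges to a nonzero limit when \<open>a\<close> is not an
  eigenvalue, so the error term tends to a point mass at \<open>y = x\<close> and the series, which converges in
  \<open>L\<^sup>1\<close>, is the Green function up to an additive constant.  The same
  computation in the variable \<open>t\<close> alone yields its Gegenbauer coefficients.  Any other function with these
  coefficients agrees with it almost everywhere, since by the Weierstrass theorem a finite measure on
  \<open>[-1, 1]\<close> is determined by its moments.  The push-forward of the surface measure under \<open>y \<mapsto> x \<bullet> y\<close>
  is identified by its moments as well.
\<close>


section \<open>Gegenbauer polynomials and their differential operator\<close>

text \<open>The Green function is singular at \<open>t = 1\<close>, and its Gegenbauer series gives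
  no hold on its values there. Expanding about the antipode avoids this: in the variable
  \<open>s\<close> the operator is hypergeometric, it sends a power to a combination of two
  neighbouring powers, and the coefficients obey a two-term recursion. The truncations are
  polynomials, so \<open>u\<close> is only ever paired with polynomials. No small ball around the
  singularity has to be cut out: the remainder, a multiple of \<open>s ^ m\<close>, plays the role
  of the boundary term, and dividing by the limit of the product normalises its mass. The series
  solves the equation with right-hand side \<open>- 1 / limprod\<close> away from the pole, which
  leaves a multiple of the mean of \<open>u\<close>. The additive constant repairs this: it is
  \<open>1 / (a * limprod)\<close> for \<open>a \<noteq> 0\<close>, while for \<open>a = 0\<close>
  the mean of \<open>u\<close> is zero and the coefficient of degree 0 fixes the constant. As the
  surface measure is the cone measure, integration by parts takes place in a solid shell, for
  extensions constant along rays.\<close>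

fun gegenbauer_poly :: "real \<Rightarrow> nat \<Rightarrow> real poly" where
  "gegenbauer_poly lam 0 = 1"
| "gegenbauer_poly lam (Suc 0) = [:0, 2 * lam:]"
| "gegenbauer_poly lam (Suc (Suc l)) =
     smult (1 / (real l + 2))
       ([:0, 2 * (real l + 1 + lam):] * gegenbauer_poly lam (Suc l)
        - smult (real l + 2 * lam) (gegenbauer_poly lam l))"

lemma poly_eqI_poly: "(\<And>t. poly p t = poly q t) \<Longrightarrow> p = (q :: real poly)"
  by (simp add: poly_eq_poly_eq_iff[symmetric] fun_eq_iff)

lemma gegenbauer_0: "gegenbauer lam 0 t = 1"
  by (simp add: gegenbauer_def fps_compose_nth_0)

text \<open>Logarithmic differentiation of the generating function:
  \<open>(1 + X) * B' = - lam * B\<close> for the binomial series \<open>B\<close>, composed with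
  \<open>v = r^2 - 2 t r\<close> and multiplied by \<open>v' = 2 r - 2 t\<close>. Its coefficients
  give the polynomial of degree 1 and the three-term recurrence.\<close>

lemma gegenbauer_fps_ODE:
  fixes lam t :: real
  defines "v \<equiv> fps_X\<^sup>2 - fps_const (2 * t) * fps_X"
  defines "P \<equiv> fps_binomial (- lam) oo v"
  shows "(1 - fps_const (2 * t) * fps_X + fps_X * fps_X) * fps_deriv P
           = fps_const (2 * lam * t) * P - fps_const (2 * lam) * (fps_X * P)"
proof -
  have v0: "fps_nth v 0 = 0" by (simp add: v_def)
  let ?B = "fps_binomial (- lam)"
  have "(1 + fps_X) * fps_deriv ?B = fps_const (- lam) * ?B"
    by (simp add: fps_binomial_deriv fps_divide_unit inverse_mult_eq_1' mult.left_commute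
             del: fps_const_neg)
  then have "((1 + fps_X) * fps_deriv ?B) oo v = (fps_const (- lam) * ?B) oo v" by simp
  then have 1: "(1 + v) * (fps_deriv ?B oo v) = fps_const (- lam) * P"
    using v0 by (simp add: fps_compose_mult_distrib fps_compose_add_distrib P_def del: fps_const_neg)
  have dv: "fps_deriv v = fps_X + fps_X - fps_const (2 * t)"
    by (simp add: v_def power2_eq_square)
  have "(1 + v) * fps_deriv P = ((1 + v) * (fps_deriv ?B oo v)) * fps_deriv v"
    using v0 by (simp add: P_def fps_compose_deriv mult.assoc)
  also have "\<dots> = fps_const (- lam) * P * (fps_X + fps_X - fps_const (2 * t))"
    by (simp only: 1 dv)
  also have "\<dots> = fps_X * (fps_const (- lam) * P) + fps_X * (fps_const (- lam) * P)
      - fps_const (2 * t) * (fps_const (- lam) * P)"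
    by (simp only: ring_distribs mult_ac)
  also have "\<dots> = fps_const (2 * lam * t) * P - fps_const (2 * lam) * (fps_X * P)"
    by (rule fps_ext) (simp del: fps_const_neg)
  finally show ?thesis by (simp add: v_def power2_eq_square algebra_simps)
qed

lemma gegenbauer_1: "gegenbauer lam (Suc 0) t = 2 * lam * t"
  using arg_cong[OF gegenbauer_fps_ODE[of t lam], of "\<lambda>F. fps_nth F 0"]
  by (simp add: gegenbauer_def fps_compose_nth_0)

lemma gegenbauer_rec:
  "(real l + 2) * gegenbauer lam (Suc (Suc l)) t =
     2 * (real l + 1 + lam) * t * gegenbauer lam (Suc l) t - (real l + 2 * lam) * gegenbauer lam l t"
proof -
  define P where "P = fps_binomial (- lam) oo (fps_X\<^sup>2 - fps_const (2 * t) * fps_X)"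
  have "fps_nth ((1 - fps_const (2 * t) * fps_X + fps_X * fps_X) * fps_deriv P) (Suc l)
        = fps_nth (fps_const (2 * lam * t) * P - fps_const (2 * lam) * (fps_X * P)) (Suc l)"
    unfolding P_def by (subst gegenbauer_fps_ODE) simp
  then have "(real l + 2) * fps_nth P (Suc (Suc l)) - 2 * t * (real l + 1) * fps_nth P (Suc l)
          + real l * fps_nth P l = 2 * lam * t * fps_nth P (Suc l) - 2 * lam * fps_nth P l"
    by (cases l) (simp_all add: ring_distribs mult.assoc add.assoc add.commute)
  then show ?thesis unfolding gegenbauer_def P_def[symmetric] by (simp add: algebra_simps)
qed

lemma poly_gegenbauer_poly: "poly (gegenbauer_poly lam l) t = gegenbauer lam l t"
proof (induction lam l rule: gegenbauer_poly.induct)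
  case (3 lam l)
  then show ?case using gegenbauer_rec[of l lam t] by (simp add: field_simps)
qed (simp_all add: gegenbauer_0 gegenbauer_1)

lemma gegenbauer_poly_rec:
  "smult (real l + 2) (gegenbauer_poly lam (Suc (Suc l))) =
     smult (2 * (real l + 1 + lam)) ([:0, 1:] * gegenbauer_poly lam (Suc l))
     - smult (real l + 2 * lam) (gegenbauer_poly lam l)"
  by simp

text \<open>Two mixed first-order relations between neighbouring degrees, from which the
  differential equation and the values at 1 follow. The induction is simultaneous because the step
  for each of them uses the other.\<close>

lemma gegenbauer_poly_deriv:
  "[:0, 1:] * pderiv (gegenbauer_poly lam (Suc l)) - pderiv (gegenbauer_poly lam l)
     = smult (real l + 1) (gegenbauer_poly lam (Suc l))"
  "pderiv (gegenbauer_poly lam (Suc l)) - [:0, 1:] * pderiv (gegenbauer_poly lam l)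
     = smult (real l + 2 * lam) (gegenbauer_poly lam l)"
proof (induction l)
  case 0
  { case 1 show ?case by (simp add: pderiv_pCons) }
  { case 2 show ?case by (simp add: pderiv_pCons) }
next
  case (Suc l)
  let ?X = "[:0, 1::real:]"
  define C where "C = gegenbauer_poly lam"
  have dX: "pderiv ?X = 1" by (simp add: pderiv_pCons)
  have rec: "smult (real l + 2) (C (Suc (Suc l))) =
      smult (2 * (real l + 1 + lam)) (?X * C (Suc l)) - smult (real l + 2 * lam) (C l)"
    unfolding C_def by (rule gegenbauer_poly_rec)
  have A: "?X * pderiv (C (Suc l)) - pderiv (C l) = smult (real l + 1) (C (Suc l))"
    and B: "pderiv (C (Suc l)) - ?X * pderiv (C l) = smult (real l + 2 * lam) (C l)"
    using Suc unfolding C_def by blast+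
  have drec: "smult (real l + 2) (pderiv (C (Suc (Suc l)))) =
      smult (2 * (real l + 1 + lam)) (C (Suc l) + ?X * pderiv (C (Suc l)))
      - smult (real l + 2 * lam) (pderiv (C l))"
    using arg_cong[OF rec, of pderiv]
    by (simp only: pderiv_smult pderiv_diff pderiv_mult dX mult_1_right mult_1_left add.commute)
  \<comment> \<open>The second relation comes before the first: its step needs only the
    differentiated recurrence and the old first relation, while the step for the first relation
    draws on the new second one.\<close>
  { case 2
    have "poly (pderiv (C (Suc (Suc l))) - ?X * pderiv (C (Suc l))) t =
        poly (smult (real (Suc l) + 2 * lam) (C (Suc l))) t" for t
    proof -
      have a: "poly (pderiv (C l)) t = t * poly (pderiv (C (Suc l))) t - (real l + 1) * poly (C (Suc l)) t"
        using arg_cong[OF A, of "\<lambda>p. poly p t"] by simp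
      have "(real l + 2) * poly (pderiv (C (Suc (Suc l)))) t =
          2 * (real l + 1 + lam) * (poly (C (Suc l)) t + t * poly (pderiv (C (Suc l))) t)
          - (real l + 2 * lam) * poly (pderiv (C l)) t"
        using arg_cong[OF drec, of "\<lambda>p. poly p t"] by simp
      also have "\<dots> = (real l + 2) * (t * poly (pderiv (C (Suc l))) t + (real l + 1 + 2 * lam) * poly (C (Suc l)) t)"
        unfolding a by (simp add: algebra_simps)
      finally have "poly (pderiv (C (Suc (Suc l)))) t =
          t * poly (pderiv (C (Suc l))) t + (real l + 1 + 2 * lam) * poly (C (Suc l)) t"
        by (subst (asm) mult_left_cancel) auto
      then show ?thesis by (simp add: algebra_simps)
    qed
    then show ?case unfolding C_def by (intro poly_eqI_poly) }
  note B' = this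
  { case 1
    have "poly (?X * pderiv (C (Suc (Suc l))) - pderiv (C (Suc l))) t =
        poly (smult (real (Suc l) + 1) (C (Suc (Suc l)))) t" for t
    proof -
      have a: "poly (pderiv (C l)) t = t * poly (pderiv (C (Suc l))) t - (real l + 1) * poly (C (Suc l)) t"
        using arg_cong[OF A, of "\<lambda>p. poly p t"] by simp
      have b: "poly (pderiv (C (Suc l))) t - t * poly (pderiv (C l)) t = (real l + 2 * lam) * poly (C l) t"
        using arg_cong[OF B, of "\<lambda>p. poly p t"] by simp
      have b': "poly (pderiv (C (Suc (Suc l)))) t - t * poly (pderiv (C (Suc l))) t
          = (real l + 1 + 2 * lam) * poly (C (Suc l)) t"
        using arg_cong[OF B'[folded C_def], of "\<lambda>p. poly p t"] by simp
      have r: "(real l + 2) * poly (C (Suc (Suc l))) t =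
          2 * (real l + 1 + lam) * (t * poly (C (Suc l)) t) - (real l + 2 * lam) * poly (C l) t"
        using arg_cong[OF rec, of "\<lambda>p. poly p t"] by simp
      show ?thesis using a b b' r by simp algebra
    qed
    then show ?case unfolding C_def by (intro poly_eqI_poly) }
qed

text \<open>The Laplace-Beltrami operator of the \<open>d\<close>-sphere acting on functions of
  \<open>t = x \<bullet> y\<close>. Restricting it to polynomials removes all questions of
  regularity.\<close>

definition gegenbauer_op :: "real \<Rightarrow> real poly \<Rightarrow> real poly" where
  "gegenbauer_op d p = [:1, 0, -1:] * pderiv (pderiv p) - smult d ([:0, 1:] * pderiv p)"

lemma poly_gegenbauer_op:
  "poly (gegenbauer_op d p) t = (1 - t\<^sup>2) * poly (pderiv (pderiv p)) t - d * t * poly (pderiv p) t"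
  by (simp add: gegenbauer_op_def power2_eq_square algebra_simps)

lemma gegenbauer_op_0 [simp]: "gegenbauer_op d 0 = 0"
  and gegenbauer_op_1 [simp]: "gegenbauer_op d 1 = 0"
  and gegenbauer_op_add: "gegenbauer_op d (p + q) = gegenbauer_op d p + gegenbauer_op d q"
  and gegenbauer_op_smult: "gegenbauer_op d (smult c p) = smult c (gegenbauer_op d p)"
  by (intro poly_eqI_poly;
      simp add: poly_gegenbauer_op pderiv_add pderiv_diff pderiv_smult algebra_simps)+

text \<open>The derivatives of the two first-order relations eliminate the second derivative of the
  polynomial of lower degree, and the undifferentiated first relation eliminates its first
  derivative.\<close>

lemma gegenbauer_op_gegenbauer_poly:
  "gegenbauer_op (2 * lam + 1) (gegenbauer_poly lam l)
     = smult (- (real l * (real l + 2 * lam))) (gegenbauer_poly lam l)"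
proof (cases l)
  case 0 then show ?thesis by (simp)
next
  case (Suc k)
  have "poly (gegenbauer_op (2 * lam + 1) (gegenbauer_poly lam (Suc k))) t =
      poly (smult (- (real (Suc k) * (real (Suc k) + 2 * lam))) (gegenbauer_poly lam (Suc k))) t" for t
  proof -
    let ?C = "gegenbauer_poly lam"
    have dX: "pderiv [:0, 1::real:] = 1" by (simp add: pderiv_pCons)
    note AB = gegenbauer_poly_deriv[of lam k]
    have a: "t * poly (pderiv (?C (Suc k))) t - poly (pderiv (?C k)) t = (real k + 1) * poly (?C (Suc k)) t"
      using arg_cong[OF AB(1), of "\<lambda>p. poly p t"] by simp
    have a': "poly (pderiv (?C (Suc k))) t + t * poly (pderiv (pderiv (?C (Suc k)))) t - poly (pderiv (pderiv (?C k))) t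
        = (real k + 1) * poly (pderiv (?C (Suc k))) t"
      using arg_cong[OF arg_cong[OF AB(1), of pderiv], of "\<lambda>p. poly p t"]
      by (simp add: pderiv_diff pderiv_mult pderiv_smult dX pderiv_pCons algebra_simps)
    have b': "poly (pderiv (pderiv (?C (Suc k)))) t - poly (pderiv (?C k)) t - t * poly (pderiv (pderiv (?C k))) t
        = (real k + 2 * lam) * poly (pderiv (?C k)) t"
      using arg_cong[OF arg_cong[OF AB(2), of pderiv], of "\<lambda>p. poly p t"]
      by (simp add: pderiv_diff pderiv_mult pderiv_smult dX pderiv_pCons algebra_simps)
    show ?thesis using a a' b' by (simp add: poly_gegenbauer_op) algebra
  qed
  then show ?thesis unfolding Suc by (intro poly_eqI_poly)
qed

lemma degree_gegenbauer_poly: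
  shows "lam > 0 \<Longrightarrow> degree (gegenbauer_poly lam l) \<le> l \<and> coeff (gegenbauer_poly lam l) l > 0"
proof (induction lam l rule: gegenbauer_poly.induct)
  case (3 lam l)
  let ?C = "gegenbauer_poly lam"
  have IH: "degree (?C (Suc l)) \<le> Suc l" "coeff (?C (Suc l)) (Suc l) > 0" "degree (?C l) \<le> l"
    using 3 by auto
  have "coeff (?C (Suc (Suc l))) k = 1 / (real l + 2) *
      (2 * (real l + 1 + lam) * coeff (?C (Suc l)) (k - 1) - (real l + 2 * lam) * coeff (?C l) k)"
    if "k > 0" for k
    using that by (cases k) simp_all
  moreover have "coeff (?C l) k = 0" if "k > l" for k using IH that by (intro coeff_eq_0) auto
  moreover have "coeff (?C (Suc l)) (k - 1) = 0" if "k > Suc (Suc l)" for k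
    using IH that by (intro coeff_eq_0) auto
  ultimately show ?case using IH(2) \<open>lam > 0\<close> by (auto intro!: degree_le simp del: gegenbauer_poly.simps)
qed auto

text \<open>At \<open>t = 1\<close> the left-hand sides of the two relations in
  \<open>gegenbauer_poly_deriv\<close> coincide.\<close>

lemma gegenbauer_poly_at_1:
  "(real l + 1) * poly (gegenbauer_poly lam (Suc l)) 1 = (real l + 2 * lam) * poly (gegenbauer_poly lam l) 1"
  using arg_cong[OF gegenbauer_poly_deriv(1)[of lam l], of "\<lambda>p. poly p 1"]
    arg_cong[OF gegenbauer_poly_deriv(2)[of lam l], of "\<lambda>p. poly p 1"] by simp

lemma gegenbauer_poly_at_1_pos: "lam > 0 \<Longrightarrow> poly (gegenbauer_poly lam l) 1 > 0"
proof (induction l)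
  case (Suc l)
  then have "(real l + 1) * poly (gegenbauer_poly lam (Suc l)) 1 > 0"
    by (subst gegenbauer_poly_at_1) auto
  then show ?case by (simp add: zero_less_mult_iff)
qed simp


section \<open>Integration by parts over a spherical shell\<close>

lemma lborel_integral_translation:
  fixes h :: "'a::euclidean_space \<Rightarrow> real"
  assumes "h \<in> borel_measurable borel"
  shows "(\<integral>y. h (c + y) \<partial>lborel) = (\<integral>y. h y \<partial>lborel)"
    and "integrable lborel h \<Longrightarrow> integrable lborel (\<lambda>y. h (c + y))"
proof -
  have *: "lborel = distr lborel borel ((+) c)" by (rule lborel_distr_plus[symmetric])
  show "(\<integral>y. h (c + y) \<partial>lborel) = (\<integral>y. h y \<partial>lborel)"
    by (subst (2) *, subst integral_distr) (use assms in simp_all)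
  show "integrable lborel h \<Longrightarrow> integrable lborel (\<lambda>y. h (c + y))"
    by (subst (asm) *, subst (asm) integrable_distr_eq) (use assms in simp_all)
qed

text \<open>The divergence theorem in one direction, without boundary terms. Difference quotients of
  \<open>h\<close> have integral zero by translation invariance and converge to \<open>D\<close>
  pointwise; the mean value theorem bounds them by \<open>M\<close>. Steps of length at most 1 move
  a point by at most \<open>norm b\<close>, so all quotients vanish outside the ball of radius
  \<open>R + norm b\<close>, and dominated convergence applies.\<close>

lemma integral_directional_derivative_zero:
  fixes h D :: "'a::euclidean_space \<Rightarrow> real"
  assumes der: "\<And>y. ((\<lambda>t. h (y + t *\<^sub>R b)) has_real_derivative D y) (at 0)"
    and supp: "\<And>y. norm y > R \<Longrightarrow> h y = 0"
    and bound: "\<And>y. \<bar>D y\<bar> \<le> M"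
    and hint: "integrable lborel h" and meas: "D \<in> borel_measurable borel"
  shows "(\<integral>y. D y \<partial>lborel) = 0"
proof -
  have [measurable]: "h \<in> borel_measurable borel" "D \<in> borel_measurable borel"
    using borel_measurable_integrable[OF hint] meas by simp_all
  define e where "e = (\<lambda>k::nat. 1 / (real k + 1))"
  have e: "0 < e k" "e k \<le> 1" for k by (simp_all add: e_def)
  have e0: "filterlim e (at 0) sequentially"
    unfolding e_def by (rule filterlim_atI) (real_asymp, simp add: add_nonneg_eq_0_iff)
  have der': "((\<lambda>t. h (y + t *\<^sub>R b)) has_real_derivative D (y + t *\<^sub>R b)) (at t)" for y t
    using der[of "y + t *\<^sub>R b"] DERIV_shift[of "\<lambda>t. h (y + t *\<^sub>R b)" "D (y + t *\<^sub>R b)" 0 t]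
    by (simp add: algebra_simps)
  define q where "q = (\<lambda>k y. (h (e k *\<^sub>R b + y) - h y) / e k)"
  have q_lim: "(\<lambda>k. q k y) \<longlonglongrightarrow> D y" for y
  proof -
    have "((\<lambda>t. (h (y + t *\<^sub>R b) - h y) / t) \<longlongrightarrow> D y) (at 0)"
      using der[of y] unfolding DERIV_def by simp
    from filterlim_compose[OF this e0] show ?thesis by (simp add: q_def add.commute)
  qed
  have q_bound: "\<bar>q k y\<bar> \<le> M * indicator (cball 0 (R + norm b)) y" for k y
  proof (cases "norm y \<le> R + norm b")
    case True
    obtain z where "h (y + e k *\<^sub>R b) - h (y + 0 *\<^sub>R b) = (e k - 0) * D (y + z *\<^sub>R b)"
      using MVT2[of 0 "e k" "\<lambda>t. h (y + t *\<^sub>R b)" "\<lambda>t. D (y + t *\<^sub>R b)"] e der' by blast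
    then have "q k y = D (y + z *\<^sub>R b)" using e(1)[of k] by (simp add: q_def add.commute)
    then show ?thesis using bound True by simp
  next
    case False
    have "norm y \<le> norm (e k *\<^sub>R b + y) + norm (e k *\<^sub>R b)"
      using norm_triangle_ineq4[of "e k *\<^sub>R b + y" "e k *\<^sub>R b"] by simp
    also have "norm (e k *\<^sub>R b) \<le> norm b" using e[of k] by (simp add: mult_left_le_one_le)
    finally have "norm (e k *\<^sub>R b + y) > R" using False by simp
    moreover have "norm y > R" using False norm_ge_zero[of b] by linarith
    ultimately show ?thesis using False by (simp add: q_def supp)
  qed
  have "(\<lambda>k. \<integral>y. q k y \<partial>lborel) \<longlonglongrightarrow> (\<integral>y. D y \<partial>lborel)"
  proof (rule integral_dominated_convergence)
    show "integrable lborel (\<lambda>y::'a. M * indicator (cball 0 (R + norm b)) y)"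
      using emeasure_bounded_finite[of "cball (0::'a) (R + norm b)"]
      by (intro integrable_mult_right integrable_real_indicator) (auto simp: bounded_cball) 
    show "q k \<in> borel_measurable lborel" for k unfolding q_def by measurable
  qed (use q_lim q_bound in auto)
  moreover have "(\<integral>y. q k y \<partial>lborel) = 0" for k
    unfolding q_def using lborel_integral_translation[of h "e k *\<^sub>R b"] hint by simp
  ultimately show ?thesis by (simp add: LIMSEQ_const_iff)
qed

text \<open>The argument will be the squared norm, so the support is the shell
  \<open>1/2 \<le> norm y \<le> 1\<close>, away from the origin, where extensions constant along
  rays are singular. Squaring the positive part makes it continuously differentiable, which is
  enough for one integration by parts.\<close>

definition shell_cutoff :: "real \<Rightarrow> real" where
  "shell_cutoff r = (max 0 ((r - 1/4) * (1 - r)))\<^sup>2"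

definition shell_cutoff_deriv :: "real \<Rightarrow> real" where
  "shell_cutoff_deriv r = 2 * max 0 ((r - 1/4) * (1 - r)) * (5/4 - 2 * r)"

lemma DERIV_pos_part_square: "((\<lambda>z. (max 0 z)\<^sup>2) has_real_derivative 2 * max 0 z) (at (z::real))"
proof (cases z "0::real" rule: linorder_cases)
  case less
  then have "eventually (\<lambda>z. (max 0 z)\<^sup>2 = (0::real)) (nhds z)"
    using less by (intro eventually_mono[OF eventually_nhds_in_open[of "{..<0}"]]) auto
  then have "((\<lambda>z. (max 0 z)\<^sup>2) has_real_derivative 0) (at z)"
    using DERIV_cong_ev[OF refl _ refl, of "\<lambda>z. (max 0 z)\<^sup>2" "\<lambda>_. 0" z 0] by simp
  then show ?thesis using less by simp
next
  case equal
  have "((\<lambda>h. (max 0 h)\<^sup>2 / h) \<longlongrightarrow> 0) (at (0::real))"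
    by (rule Lim_null_comparison[of _ "\<lambda>h. \<bar>h\<bar>"])
       (auto simp: max_def power2_eq_square intro!: always_eventually tendsto_rabs_zero)
  then show ?thesis by (simp add: DERIV_def equal)
next
  case greater
  then have "eventually (\<lambda>z. (max 0 z)\<^sup>2 = z\<^sup>2) (nhds z)"
    by (intro eventually_mono[OF eventually_nhds_in_open[of "{0<..}"]]) auto
  then show ?thesis using greater by (subst DERIV_cong_ev) (auto intro!: derivative_eq_intros)
qed

lemma DERIV_shell_cutoff: "(shell_cutoff has_real_derivative shell_cutoff_deriv r) (at r)"
proof -
  have "((\<lambda>r. (r - 1/4) * (1 - r)) has_real_derivative (5/4 - 2 * r)) (at r)"
    by (auto intro!: derivative_eq_intros simp: algebra_simps)
  from DERIV_chain2[OF DERIV_pos_part_square this] show ?thesis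
    by (simp add: shell_cutoff_def[abs_def] shell_cutoff_deriv_def)
qed

lemma shell_cutoff_eq_0:
  assumes "r \<le> 1/4 \<or> r \<ge> 1" shows "shell_cutoff r = 0" "shell_cutoff_deriv r = 0"
  using assms by (auto simp: shell_cutoff_def shell_cutoff_deriv_def max_def mult_le_0_iff zero_le_mult_iff)

lemma shell_cutoff_pos: "1/4 < r \<Longrightarrow> r < 1 \<Longrightarrow> shell_cutoff r > 0"
  by (simp add: shell_cutoff_def)

lemma shell_cutoff_nonneg: "shell_cutoff r \<ge> 0"
  by (simp add: shell_cutoff_def)

lemma continuous_on_shell_cutoff [continuous_intros]:
  "continuous_on A f \<Longrightarrow> continuous_on A (\<lambda>x. shell_cutoff (f x))"
  "continuous_on A f \<Longrightarrow> continuous_on A (\<lambda>x. shell_cutoff_deriv (f x))"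
  unfolding shell_cutoff_def shell_cutoff_deriv_def by (intro continuous_intros; simp)+

text \<open>The last clause is Euler's relation: the radial derivative vanishes, as for a function constant along rays.
  Only the derivatives along the coordinate axes enter.\<close>
definition ray_C2 ::
  "('a::euclidean_space \<Rightarrow> real) \<Rightarrow> ('a \<Rightarrow> 'a \<Rightarrow> real) \<Rightarrow> ('a \<Rightarrow> 'a \<Rightarrow> real) \<Rightarrow> bool" where
  "ray_C2 v v1 v2 \<longleftrightarrow> continuous_on (- {0}) v \<and>
     (\<forall>b\<in>Basis. continuous_on (- {0}) (v1 b) \<and> continuous_on (- {0}) (v2 b)) \<and>
     (\<forall>y b. y \<noteq> 0 \<longrightarrow> b \<in> Basis \<longrightarrow>
        ((\<lambda>t. v (y + t *\<^sub>R b)) has_real_derivative v1 b y) (at 0) \<and>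
        ((\<lambda>t. v1 b (y + t *\<^sub>R b)) has_real_derivative v2 b y) (at 0)) \<and>
     (\<forall>y. y \<noteq> 0 \<longrightarrow> (\<Sum>b\<in>Basis. (y \<bullet> b) * v1 b y) = 0)"

lemma integrable_shell:
  fixes f :: "'a::euclidean_space \<Rightarrow> real"
  assumes "continuous_on (- {0}) f" and 0: "\<And>y. norm y \<le> 1/2 \<or> norm y \<ge> 1 \<Longrightarrow> f y = 0"
  shows "integrable lborel f" "\<exists>M. \<forall>y. \<bar>f y\<bar> \<le> M"
proof -
  let ?K = "cball 0 1 - ball (0::'a) (1/2)"
  have K: "compact ?K" by (intro compact_diff) auto
  have c: "continuous_on ?K f" by (rule continuous_on_subset[OF assms(1)]) auto
  have "integrable lborel (\<lambda>x. indicator ?K x *\<^sub>R f x)" by (rule borel_integrable_compact[OF K c])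
  also have "(\<lambda>x. indicator ?K x *\<^sub>R f x) = f"
  proof
    show "indicator ?K x *\<^sub>R f x = f x" for x
      using 0[of x] by (cases "x \<in> ?K") (auto simp: not_le)
  qed
  finally show "integrable lborel f" .
  obtain M where M: "\<And>y. y \<in> ?K \<Longrightarrow> norm (f y) \<le> M"
    using compact_imp_bounded[OF compact_continuous_image[OF c K]] by (metis bounded_iff imageI)
  have "\<bar>f y\<bar> \<le> max M 0" for y
    using M[of y] 0[of y] by (cases "y \<in> ?K") (auto simp: not_le le_max_iff_disj)
  then show "\<exists>M. \<forall>y. \<bar>f y\<bar> \<le> M" by blast
qed

text \<open>The vector field with components \<open>h b\<close>, a cutoff times
  \<open>u1 b * v - u * v1 b\<close>, has integral zero of its divergence. Differentiating the
  cutoff produces only the radial derivatives of \<open>u\<close> and \<open>v\<close>, which vanish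
  by Euler's relation; what is left is the cutoff times the difference of the Laplacians.\<close>

lemma ray_C2_green:
  fixes u v :: "'a::euclidean_space \<Rightarrow> real"
  assumes u: "ray_C2 u u1 u2" and v: "ray_C2 v v1 v2"
  shows "(\<integral>y. shell_cutoff (y \<bullet> y) *
      ((\<Sum>b\<in>Basis. u2 b y) * v y - u y * (\<Sum>b\<in>Basis. v2 b y)) \<partial>lborel) = 0"
proof -
  define h where "h = (\<lambda>b y. shell_cutoff (y \<bullet> y) * (u1 b y * v y - u y * v1 b y))"
  define D where "D = (\<lambda>b y. shell_cutoff_deriv (y \<bullet> y) * (2 * (y \<bullet> b)) * (u1 b y * v y - u y * v1 b y)
      + shell_cutoff (y \<bullet> y) * (u2 b y * v y - u y * v2 b y))"
  have small: "y \<bullet> y \<le> 1/4 \<or> y \<bullet> y \<ge> 1" if "norm y \<le> 1/2 \<or> norm y \<ge> 1" for y :: 'a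
    using that power_mono[of "norm y" "1/2" 2] power_mono[of 1 "norm y" 2]
    by (auto simp: dot_square_norm power2_eq_square)
  have h0: "h b y = 0" and D0: "D b y = 0" if "norm y \<le> 1/2 \<or> norm y \<ge> 1" for b y
    using shell_cutoff_eq_0[OF small[OF that]] by (simp_all add: h_def D_def)
  have cont: "continuous_on (- {0}) (h b)" "continuous_on (- {0}) (D b)" if "b \<in> Basis" for b
    using u v that unfolding h_def D_def ray_C2_def by (auto intro!: continuous_intros)
  have der: "((\<lambda>t. h b (y + t *\<^sub>R b)) has_real_derivative D b y) (at 0)" if b: "b \<in> Basis" for b y
  proof (cases "y = 0")
    case True
    \<comment> \<open>Nothing is assumed about \<open>u\<close> and \<open>v\<close> at the origin,
      but the cutoff makes \<open>h b\<close> vanish in a neighbourhood of it.\<close>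
    have "eventually (\<lambda>t. h b (y + t *\<^sub>R b) = 0) (nhds 0)"
      by (rule eventually_mono[OF eventually_nhds_in_open[of "{-1/2<..<1/2}"]])
         (use b in \<open>auto simp: True intro!: h0\<close>)
    moreover have "D b y = 0" by (rule D0) (simp add: True)
    ultimately show ?thesis by (subst DERIV_cong_ev) auto
  next
    case False
    have "((\<lambda>t. (y + t *\<^sub>R b) \<bullet> (y + t *\<^sub>R b)) has_real_derivative 2 * (y \<bullet> b)) (at 0)"
      by (auto intro!: derivative_eq_intros simp: has_field_derivative_def fun_eq_iff
          inner_add_left inner_add_right inner_commute)
    then have "((\<lambda>t. shell_cutoff ((y + t *\<^sub>R b) \<bullet> (y + t *\<^sub>R b))) has_real_derivative
        shell_cutoff_deriv (y \<bullet> y) * (2 * (y \<bullet> b))) (at 0)"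
      using DERIV_chain2[OF DERIV_shell_cutoff] by fastforce
    moreover have "((\<lambda>t. u (y + t *\<^sub>R b)) has_real_derivative u1 b y) (at 0)"
       "((\<lambda>t. u1 b (y + t *\<^sub>R b)) has_real_derivative u2 b y) (at 0)"
       "((\<lambda>t. v (y + t *\<^sub>R b)) has_real_derivative v1 b y) (at 0)"
       "((\<lambda>t. v1 b (y + t *\<^sub>R b)) has_real_derivative v2 b y) (at 0)"
      using u v False b unfolding ray_C2_def by blast+
    ultimately show ?thesis
      unfolding h_def D_def by (auto intro!: derivative_eq_intros simp: algebra_simps)
  qed
  have int: "integrable lborel (D b)" if "b \<in> Basis" for b
    by (rule integrable_shell(1)[OF cont(2)[OF that] D0])
  have "(\<integral>y. D b y \<partial>lborel) = 0" if b: "b \<in> Basis" for b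
  proof -
    obtain M where "\<And>y. \<bar>D b y\<bar> \<le> M" using integrable_shell(2)[OF cont(2)[OF b] D0] by auto
    then show ?thesis
      using der[OF b] h0 integrable_shell(1)[OF cont(1)[OF b] h0] borel_measurable_integrable[OF int[OF b]]
      by (intro integral_directional_derivative_zero[of "h b" b "D b" 1 M]) auto
  qed
  then have "(\<integral>y. (\<Sum>b\<in>Basis. D b y) \<partial>lborel) = 0"
    by (subst Bochner_Integration.integral_sum) (auto intro: int)
  also have "(\<lambda>y. \<Sum>b\<in>Basis. D b y) = (\<lambda>y. shell_cutoff (y \<bullet> y) *
      ((\<Sum>b\<in>Basis. u2 b y) * v y - u y * (\<Sum>b\<in>Basis. v2 b y)))"
  proof
    fix y :: 'a
    show "(\<Sum>b\<in>Basis. D b y) = shell_cutoff (y \<bullet> y) *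
      ((\<Sum>b\<in>Basis. u2 b y) * v y - u y * (\<Sum>b\<in>Basis. v2 b y))"
    proof (cases "y = 0")
      case True then show ?thesis by (simp add: D_def shell_cutoff_eq_0)
    next
      case False
      have "(\<Sum>b\<in>Basis. D b y) =
          2 * shell_cutoff_deriv (y \<bullet> y) * (v y * (\<Sum>b\<in>Basis. (y \<bullet> b) * u1 b y) - u y * (\<Sum>b\<in>Basis. (y \<bullet> b) * v1 b y))
          + shell_cutoff (y \<bullet> y) * ((\<Sum>b\<in>Basis. u2 b y) * v y - u y * (\<Sum>b\<in>Basis. v2 b y))"
        by (simp add: D_def sum.distrib sum_subtractf sum_distrib_left sum_distrib_right algebra_simps)
      then show ?thesis using u v False unfolding ray_C2_def by simp
    qed
  qed
  finally show ?thesis .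
qed

section \<open>Polar coordinates for the cone measure\<close>

definition cone_over :: "'a::euclidean_space set \<Rightarrow> 'a set" where
  "cone_over A = {y \<in> cball 0 1 - {0}. sgn y \<in> A}"

lemma measurable_sgn_borel [measurable]: "sgn \<in> borel_measurable (borel :: 'a::euclidean_space measure)"
proof -
  have "(\<lambda>x::'a. x /\<^sub>R norm x) \<in> borel_measurable borel" by measurable
  then show ?thesis by (simp add: sgn_div_norm[abs_def])
qed

lemma cone_sets [measurable]:
  assumes "A \<in> sets (borel :: 'a::euclidean_space measure)" shows "cone_over A \<in> sets borel"
proof -
  have "sgn -` A \<inter> space borel \<in> sets (borel :: 'a measure)"
    by (rule measurable_sets[OF measurable_sgn_borel assms])
  moreover have "cball 0 1 - {0::'a} \<in> sets borel" by simp
  moreover have "cone_over A = (sgn -` A \<inter> space borel) \<inter> (cball 0 1 - {0})" by (auto simp: cone_over_def)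
  ultimately show ?thesis by (simp only: sets.Int)
qed

lemma emeasure_cone_finite: "emeasure lborel (cone_over (A :: 'a::euclidean_space set)) < \<infinity>"
proof -
  have "emeasure lborel (cone_over A) \<le> emeasure lborel (cball (0::'a) 1)"
    by (rule emeasure_mono) (auto simp: cone_over_def)
  also have "\<dots> < \<infinity>" by (simp add: emeasure_cball)
  finally show ?thesis .
qed

text \<open>Scaling by \<open>r\<close> carries the cone onto its part of norm at most
  \<open>r\<close>, so that part has the fraction \<open>r ^ DIM('a)\<close> of the volume. The case
  \<open>r = 0\<close> stands apart because scaling by 0 is not invertible. The factor is the same
  for every \<open>A\<close>, which is what separates the radial from the angular variable.\<close>

lemma emeasure_cone_outer:
  assumes [measurable]: "A \<in> sets (borel :: 'a::euclidean_space measure)"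
  shows "emeasure lborel {y \<in> cone_over A. r < norm y} = 
    (if r < 0 then 1 else if r < 1 then ennreal (1 - r ^ DIM('a)) else 0) * emeasure lborel (cone_over A)"
proof -
  consider "r < 0" | "r = 0" | "0 < r" "r < 1" | "r \<ge> 1" by linarith
  then show ?thesis
  proof cases
    case 1
    then have "{y \<in> cone_over A. r < norm y} = cone_over A" by (auto intro: less_le_trans[OF _ norm_ge_zero])
    then show ?thesis using 1 by simp
  next
    case 2
    then have "{y \<in> cone_over A. r < norm y} = cone_over A" by (auto simp: cone_over_def)
    then show ?thesis using 2 by (simp add: zero_power)
  next
    case 3
    have "emeasure lborel {y \<in> cone_over A. norm y \<le> r} =
        emeasure (density (distr lborel borel (\<lambda>x. 0 + r *\<^sub>R x)) (\<lambda>_. \<bar>r\<bar> ^ DIM('a))) {y \<in> cone_over A. norm y \<le> r}"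
      using 3 by (subst lborel_affine[of r 0]) auto
    also have "\<dots> = ennreal r ^ DIM('a) * emeasure (distr lborel borel (\<lambda>x. 0 + r *\<^sub>R x)) {y \<in> cone_over A. norm y \<le> r}"
      using 3 by (subst emeasure_density_const) (auto simp: ennreal_power)
    also have "emeasure (distr lborel borel (\<lambda>x. 0 + r *\<^sub>R x)) {y \<in> cone_over A. norm y \<le> r}
        = emeasure lborel (cone_over A)"
    proof (subst emeasure_distr)
      have "(\<lambda>x. 0 + r *\<^sub>R x) -` {y \<in> cone_over A. norm y \<le> r} \<inter> space lborel = cone_over A"
        using 3 by (auto simp: cone_over_def sgn_scaleR mult_le_one)
      then show "emeasure lborel ((\<lambda>x. 0 + r *\<^sub>R x) -` {y \<in> cone_over A. norm y \<le> r} \<inter> space lborel) = emeasure lborel (cone_over A)"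
        by simp
    qed measurable
    finally have *: "emeasure lborel {y \<in> cone_over A. norm y \<le> r} = ennreal r ^ DIM('a) * emeasure lborel (cone_over A)" .
    have "{y \<in> cone_over A. r < norm y} = cone_over A - {y \<in> cone_over A. norm y \<le> r}" by auto
    moreover have "emeasure lborel {y \<in> cone_over A. norm y \<le> r} \<le> emeasure lborel (cone_over A)"
      by (intro emeasure_mono) auto
    then have "emeasure lborel {y \<in> cone_over A. norm y \<le> r} \<noteq> \<infinity>"
      using emeasure_cone_finite[of A] by (auto simp: top_unique)
    then have "emeasure lborel (cone_over A - {y \<in> cone_over A. norm y \<le> r})
        = emeasure lborel (cone_over A) - emeasure lborel {y \<in> cone_over A. norm y \<le> r}"
      by (intro emeasure_Diff) auto
    ultimately have "emeasure lborel {y \<in> cone_over A. r < norm y}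
        = emeasure lborel (cone_over A) - ennreal r ^ DIM('a) * emeasure lborel (cone_over A)"
      by (simp only: *)
    also have "\<dots> = ennreal (1 - r ^ DIM('a)) * emeasure lborel (cone_over A)"
    proof -
      obtain m where m: "emeasure lborel (cone_over A) = ennreal m" "m \<ge> 0"
        using emeasure_cone_finite[of A] by (cases "emeasure lborel (cone_over A)") auto
      moreover have "1 - r ^ DIM('a) \<ge> 0" using 3 by (simp add: power_le_one)
      ultimately show ?thesis using 3
        by (simp add: ennreal_power ennreal_mult'[symmetric] ennreal_minus left_diff_distrib)
    qed
    finally show ?thesis using 3 by simp
  next
    case 4
    then have *: "{y \<in> cone_over A. r < norm y} = {}" by (auto simp: cone_over_def)
    show ?thesis unfolding * using 4 by simp
  qed
qed

text \<open>Under \<open>norm\<close>, the volume on the cone over \<open>A\<close> and the volume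
  on the cone over the sphere have proportional images, as they agree on all half-lines up to the
  volumes of the cones. The cross-multiplied form avoids division in \<open>ennreal\<close>.\<close>

lemma sphere_measure_radial:
  fixes A :: "'a::euclidean_space set" and h :: "real \<Rightarrow> ennreal"
  assumes [measurable]: "A \<in> sets borel" "h \<in> borel_measurable borel"
  shows "emeasure lborel (cone_over (sphere 0 1) :: 'a set) * (\<integral>\<^sup>+y\<in>cone_over A. h (norm y) \<partial>lborel)
    = emeasure lborel (cone_over A) * (\<integral>\<^sup>+y\<in>cone_over (sphere 0 1 :: 'a set). h (norm y) \<partial>lborel)"
proof -
  define N where "N = (\<lambda>A :: 'a set. distr (density lborel (indicator (cone_over A))) borel norm)"
  have sets_N [simp]: "sets (N A) = sets borel" for A by (simp add: N_def)
  have em: "emeasure (N A) {r<..} = emeasure lborel {y \<in> cone_over A. r < norm y}"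
    if [measurable]: "A \<in> sets borel" for A r
  proof -
    have "emeasure (N A) {r<..} = (\<integral>\<^sup>+y. indicator (cone_over A) y * indicator {y. r < norm y} y \<partial>lborel)"
      unfolding N_def by (subst emeasure_distr) (auto simp: emeasure_density vimage_def)
    also have "\<dots> = (\<integral>\<^sup>+y. indicator {y \<in> cone_over A. r < norm y} y \<partial>lborel)"
      by (intro nn_integral_cong) (auto simp: indicator_def)
    also have "\<dots> = emeasure lborel {y \<in> cone_over A. r < norm y}" by simp
    finally show ?thesis .
  qed
  have nn: "(\<integral>\<^sup>+r. h r \<partial>N A) = (\<integral>\<^sup>+y\<in>cone_over A. h (norm y) \<partial>lborel)"
    if [measurable]: "A \<in> sets borel" for A
    unfolding N_def by (simp add: nn_integral_distr nn_integral_density mult.commute)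
  let ?m = "\<lambda>A :: 'a set. emeasure lborel (cone_over A)"
  have "scale_measure (?m (sphere 0 1)) (N A) = scale_measure (?m A) (N (sphere 0 1))"
  proof (rule measure_eqI_lessThan)
    fix r :: real
    show "emeasure (scale_measure (?m (sphere 0 1)) (N A)) {r<..} = emeasure (scale_measure (?m A) (N (sphere 0 1))) {r<..}"
      by (simp add: em emeasure_cone_outer mult_ac)
    have "emeasure lborel {y \<in> cone_over A. r < norm y} \<le> ?m A"
      by (intro emeasure_mono) auto
    then show "emeasure (scale_measure (?m (sphere 0 1)) (N A)) {r<..} < \<infinity>"
      using emeasure_cone_finite[of A] emeasure_cone_finite[of "sphere 0 1 :: 'a set"]
      by (simp add: em ennreal_mult_less_top le_less_trans)
  qed simp_all
  then have "(\<integral>\<^sup>+r. h r \<partial>scale_measure (?m (sphere 0 1)) (N A)) = (\<integral>\<^sup>+r. h r \<partial>scale_measure (?m A) (N (sphere 0 1)))"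
    by simp
  then show ?thesis
    by (simp add: nn_integral_scale_measure measurable_cong_sets[OF sets_N refl] nn)
qed

text \<open>Polar coordinates with an unnormalised radial weight: the image \<open>nu\<close> under
  \<open>sgn\<close> of Lebesgue measure with density \<open>h (norm y)\<close> is a multiple of the
  surface measure. Evaluation on the whole sphere dictates the factor \<open>H / s\<close>, the
  radial integral over the total mass. The vanishing of \<open>h\<close> at 0 and from 1 on confines
  everything to the punctured ball that underlies the cone measure.\<close>

lemma sphere_measure_radial_integral:
  fixes g :: "'a::euclidean_space \<Rightarrow> real" and h :: "real \<Rightarrow> real"
  assumes g: "g \<in> borel_measurable (restrict_space borel (sphere 0 1))"
    and h: "h \<in> borel_measurable borel" "\<And>r. h r \<ge> 0" "\<And>r. r \<ge> 1 \<Longrightarrow> h r = 0" "h 0 = 0"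
    and int: "integrable lborel (\<lambda>y::'a. h (norm y))"
  shows "(\<integral>y. h (norm (y::'a)) \<partial>lborel) * (\<integral>y. g y \<partial>sphere_measure)
    = measure sphere_measure (sphere 0 1 :: 'a set) * (\<integral>y. h (norm y) * g (sgn y) \<partial>lborel)"
proof -
  note [measurable] = h(1) g
  let ?S = "sphere 0 1 :: 'a set" and ?B = "cball 0 1 - {0} :: 'a set"
  let ?lb = "restrict_space lborel ?B"
  have [measurable]: "sgn \<in> measurable ?lb (restrict_space borel ?S)"
    by (rule sgn_measurable_punctured_cball)
  have [measurable]: "(\<lambda>y. h (norm y)) \<in> borel_measurable ?lb"
    by (rule measurable_restrict_space1) measurable
  define H where "H = (\<integral>y. h (norm (y::'a)) \<partial>lborel)"
  have H0: "H \<ge> 0" unfolding H_def using h by simp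
  define s where "s = measure sphere_measure ?S"
  have s: "emeasure sphere_measure ?S = ennreal s" "s > 0"
    by (simp_all add: s_def measure_sphere_measure_total emeasure_sphere_measure_total Gamma_real_pos)
  define nu where "nu = distr (density ?lb (\<lambda>y. ennreal (h (norm y)))) (restrict_space borel ?S) sgn"
  have coneS: "cone_over ?S = ?B" by (auto simp: cone_over_def norm_sgn)
  have nnH: "(\<integral>\<^sup>+y\<in>?B. ennreal (h (norm y)) \<partial>lborel) = ennreal H"
  proof -
    have "(\<integral>\<^sup>+y\<in>?B. ennreal (h (norm y)) \<partial>lborel) = (\<integral>\<^sup>+y. ennreal (h (norm (y::'a))) \<partial>lborel)"
      using h by (intro nn_integral_cong) (auto simp: indicator_def not_le)
    also have "\<dots> = ennreal H" unfolding H_def using h by (intro nn_integral_eq_integral int) auto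
    finally show ?thesis .
  qed
  have "density sphere_measure (\<lambda>_::'a. ennreal (H / s)) = nu"
  proof (rule measure_eqI)
    fix A assume "A \<in> sets (density sphere_measure (\<lambda>_::'a. ennreal (H / s)))"
    then have A: "A \<in> sets (restrict_space borel ?S)" by simp
    then have [measurable]: "A \<in> sets borel" and AS: "A \<subseteq> ?S" by (auto simp: sets_restrict_space_iff)
    let ?I = "\<integral>\<^sup>+y\<in>cone_over A. ennreal (h (norm y)) \<partial>lborel"
    have "emeasure nu A = (\<integral>\<^sup>+y. ennreal (h (norm y)) * indicator (sgn -` A \<inter> ?B) y \<partial>?lb)"
      unfolding nu_def using A measurable_sets[OF sgn_measurable_punctured_cball A]
      by (subst emeasure_distr) (simp_all add: emeasure_density space_restrict_space)
    also have "\<dots> = ?I"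
      by (subst nn_integral_restrict_space) (auto intro!: nn_integral_cong simp: cone_over_def indicator_def)
    finally have 1: "emeasure nu A = ?I" .
    have 2: "emeasure lborel ?B * ?I = emeasure lborel (cone_over A) * ennreal H"
      using sphere_measure_radial[of A "\<lambda>r. ennreal (h r)"] by (simp add: coneS nnH)
    have "ennreal s * ?I = ennreal H * emeasure sphere_measure A"
    proof -
      have "ennreal s = of_nat DIM('a) * emeasure lborel ?B"
        unfolding s(1)[symmetric] using coneS by (subst emeasure_sphere_measure) (simp_all add: cone_over_def)
      moreover have "emeasure sphere_measure A = of_nat DIM('a) * emeasure lborel (cone_over A)"
        using AS by (subst emeasure_sphere_measure) (simp_all add: cone_over_def)
      ultimately show ?thesis using 2 by (simp add: mult_ac)
    qed
    then have "ennreal (1 / s) * (ennreal s * ?I) = ennreal (1 / s) * (ennreal H * emeasure sphere_measure A)" by simp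
    then have "?I = ennreal (H / s) * emeasure sphere_measure A"
      using s(2) H0 by (simp add: mult.assoc[symmetric] ennreal_mult'[symmetric])
    then show "emeasure (density sphere_measure (\<lambda>_::'a. ennreal (H / s))) A = emeasure nu A"
      using A by (simp add: 1 emeasure_density_const)
  qed (simp add: nu_def)
  then have "(\<integral>y. g y \<partial>density sphere_measure (\<lambda>_::'a. ennreal (H / s))) = (\<integral>y. g y \<partial>nu)" by simp
  moreover have "(\<integral>y. g y \<partial>density sphere_measure (\<lambda>_::'a. ennreal (H / s))) = H / s * (\<integral>y. g y \<partial>sphere_measure)"
    using s(2) H0 by (subst integral_density) auto
  moreover have "(\<integral>y. g y \<partial>nu) = (\<integral>y. h (norm y) * g (sgn y) \<partial>?lb)"
    unfolding nu_def using h by (subst integral_distr, simp_all, subst integral_density) auto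
  moreover have "(\<integral>y. h (norm y) * g (sgn y) \<partial>?lb) = (\<integral>y. h (norm y) * g (sgn y) \<partial>lborel)"
  proof -
    have "h (norm y) = 0" if "y \<notin> ?B" for y :: 'a
      using h that by (cases "y = 0") (auto simp: not_le)
    then have *: "indicator ?B y *\<^sub>R (h (norm y) * g (sgn y)) = h (norm y) * g (sgn y)" for y
      by (cases "y \<in> ?B") auto
    have "?B \<inter> space lborel \<in> sets lborel" by simp
    then show ?thesis by (simp only: integral_restrict_space *)
  qed
  ultimately show ?thesis using s(2) by (simp add: H_def[symmetric] s_def[symmetric] field_simps)
qed

section \<open>Functions constant along rays and their second derivatives\<close>

lemma C2_on_sphere_ray_C2:
  fixes u :: "'a::euclidean_space \<Rightarrow> real"
  assumes "C2_on_sphere u"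
  obtains u1 u2 where "ray_C2 (\<lambda>y. u (sgn y)) u1 u2"
proof -
  obtain F' :: "'a \<Rightarrow> 'a \<Rightarrow>\<^sub>L real" and F'' :: "'a \<Rightarrow> 'a \<Rightarrow>\<^sub>L ('a \<Rightarrow>\<^sub>L real)" where
    F1: "\<And>x. x \<noteq> 0 \<Longrightarrow> ((\<lambda>y. u (sgn y)) has_derivative blinfun_apply (F' x)) (at x)" and
    F2: "\<And>x. x \<noteq> 0 \<Longrightarrow> (F' has_derivative blinfun_apply (F'' x)) (at x)" and
    F3: "continuous_on (- {0}) F''"
    using assms unfolding C2_on_sphere_def C2_on_def by auto
  have c0: "continuous_on (- {0}) (\<lambda>y. u (sgn y))"
    by (rule has_derivative_continuous_on[of _ _ "\<lambda>x. blinfun_apply (F' x)"])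
       (auto intro: has_derivative_at_withinI F1)
  have c1: "continuous_on (- {0}) F'"
    by (rule has_derivative_continuous_on[of _ _ "\<lambda>x. blinfun_apply (F'' x)"])
       (auto intro: has_derivative_at_withinI F2)
  have line: "((\<lambda>t. y + t *\<^sub>R b) has_derivative (\<lambda>t. t *\<^sub>R b)) (at 0)" for y b :: 'a
    by (auto intro!: derivative_eq_intros)
  have d1: "((\<lambda>t. u (sgn (y + t *\<^sub>R b))) has_real_derivative F' y b) (at 0)" if "y \<noteq> 0" for y b
  proof -
    have "((\<lambda>t. u (sgn (y + t *\<^sub>R b))) has_derivative (\<lambda>t. F' y (t *\<^sub>R b))) (at 0)"
      using has_derivative_compose[OF line[of y b], of "\<lambda>y. u (sgn y)"] F1[OF that] by simp
    then show ?thesis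
      by (simp add: has_field_derivative_def blinfun.scaleR_right mult.commute[of _ "F' y b"])
  qed
  have d2: "((\<lambda>t. F' (y + t *\<^sub>R b) b) has_real_derivative F'' y b b) (at 0)" if "y \<noteq> 0" for y b
  proof -
    have "((\<lambda>t. F' (y + t *\<^sub>R b)) has_derivative (\<lambda>t. F'' y (t *\<^sub>R b))) (at 0)"
      using has_derivative_compose[OF line[of y b], of F'] F2[OF that] by simp
    then have "((\<lambda>t. F' (y + t *\<^sub>R b) b) has_derivative (\<lambda>t. F'' y (t *\<^sub>R b) b)) (at 0)"
      by (rule bounded_linear.has_derivative[OF blinfun.bounded_linear_left])
    then show ?thesis
      by (simp add: has_field_derivative_def blinfun.scaleR_right blinfun.scaleR_left mult.commute[of _ "F'' y b b"])
  qed
  have euler: "(\<Sum>b\<in>Basis. (y \<bullet> b) * F' y b) = 0" if y: "y \<noteq> 0" for y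
  proof -
    have "eventually (\<lambda>t. u (sgn (y + t *\<^sub>R y)) = u (sgn y)) (nhds (0::real))"
    proof (rule eventually_mono[OF eventually_nhds_in_open[of "{-1<..}"]])
      fix t :: real assume "t \<in> {-1<..}"
      then have "sgn (y + t *\<^sub>R y) = sgn y"
        using sgn_scaleR[of "1 + t" y] by (simp add: algebra_simps)
      then show "u (sgn (y + t *\<^sub>R y)) = u (sgn y)" by simp
    qed auto
    then have "((\<lambda>t. u (sgn (y + t *\<^sub>R y))) has_real_derivative 0) (at 0)"
      using DERIV_cong_ev[OF refl _ refl, of "\<lambda>t. u (sgn (y + t *\<^sub>R y))" "\<lambda>_. u (sgn y)" 0 0] by simp
    then have "F' y y = 0" using d1[OF y, of y] by (rule DERIV_unique[symmetric])
    also have "F' y y = F' y (\<Sum>b\<in>Basis. (y \<bullet> b) *\<^sub>R b)" by (simp add: euclidean_representation)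
    finally show ?thesis by (simp add: blinfun.sum_right blinfun.scaleR_right)
  qed
  have "ray_C2 (\<lambda>y. u (sgn y)) (\<lambda>b y. F' y b) (\<lambda>b y. F'' y b b)"
    unfolding ray_C2_def using c0 c1 F3 d1 d2 euler by (auto intro!: continuous_intros)
  then show ?thesis by (rule that)
qed

lemma ray_C2_laplacian:
  fixes v :: "'a::euclidean_space \<Rightarrow> real"
  assumes v: "ray_C2 v v1 v2" and y: "y \<noteq> 0"
  shows "laplacian v y = (\<Sum>b\<in>Basis. v2 b y)"
  unfolding laplacian_def
proof (rule sum.cong[OF refl])
  fix b :: 'a assume b: "b \<in> Basis"
  have "((\<lambda>t. y + t *\<^sub>R b) \<longlongrightarrow> y + 0 *\<^sub>R b) (nhds 0)"
    by (intro tendsto_intros) (auto simp: filterlim_ident)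
  then have "eventually (\<lambda>t. y + t *\<^sub>R b \<noteq> 0) (nhds 0)"
    using y by (auto dest: tendsto_imp_eventually_ne)
  then have "eventually (\<lambda>t. deriv (\<lambda>t. v (y + t *\<^sub>R b)) t = v1 b (y + t *\<^sub>R b)) (nhds 0)"
  proof eventually_elim
    case (elim t)
    then have "((\<lambda>s. v (y + t *\<^sub>R b + s *\<^sub>R b)) has_real_derivative v1 b (y + t *\<^sub>R b)) (at 0)"
      using v b unfolding ray_C2_def by blast
    then show ?case
      using DERIV_shift[of "\<lambda>t. v (y + t *\<^sub>R b)" "v1 b (y + t *\<^sub>R b)" 0 t]
      by (intro DERIV_imp_deriv) (simp add: algebra_simps)
  qed
  then have "deriv (deriv (\<lambda>t. v (y + t *\<^sub>R b))) 0 = deriv (\<lambda>t. v1 b (y + t *\<^sub>R b)) 0"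
    by (rule deriv_cong_ev) simp
  also have "\<dots> = v2 b y" using v y b unfolding ray_C2_def by (intro DERIV_imp_deriv) blast
  finally show "(deriv ^^ 2) (\<lambda>t. v (y + t *\<^sub>R b)) 0 = v2 b y" by (simp add: numeral_2_eq_2)
qed

text \<open>Each differentiation of a function that is homogeneous of degree 0 lowers the degree by
  one; two applications of the chain rule along a coordinate line, compared by uniqueness of
  derivatives, give degree -2. This makes the Laplacian on the shell a radial factor times its value
  on the sphere.\<close>

lemma ray_C2_homogeneous:
  fixes v :: "'a::euclidean_space \<Rightarrow> real"
  assumes v: "ray_C2 v v1 v2" and hom: "\<And>c y. c > 0 \<Longrightarrow> v (c *\<^sub>R y) = v y"
    and y: "y \<noteq> 0" and b: "b \<in> Basis" and c: "c > 0"
  shows "v2 b (c *\<^sub>R y) = v2 b y / c\<^sup>2"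
proof -
  have eq: "c *\<^sub>R y + t *\<^sub>R b = c *\<^sub>R (y + (t / c) *\<^sub>R b)" for t y
    using c by (simp add: scaleR_add_right)
  have div: "((\<lambda>t. t / c) has_real_derivative 1 / c) (at 0)"
    using c by (auto intro!: derivative_eq_intros)
  have 1: "v1 b (c *\<^sub>R y) = v1 b y / c" if "y \<noteq> 0" for y
  proof -
    have "((\<lambda>t. v (c *\<^sub>R y + t *\<^sub>R b)) has_real_derivative v1 b (c *\<^sub>R y)) (at 0)"
      using v b that c unfolding ray_C2_def by simp
    moreover have "((\<lambda>t. v (y + t *\<^sub>R b)) has_real_derivative v1 b y) (at (0 / c))"
      using v b that unfolding ray_C2_def by simp
    from DERIV_chain2[OF this div]
    have "((\<lambda>t. v (c *\<^sub>R y + t *\<^sub>R b)) has_real_derivative v1 b y * (1 / c)) (at 0)"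
      using c by (simp only: eq hom)
    ultimately show ?thesis by (auto dest: DERIV_unique)
  qed
  have D: "((\<lambda>t. v1 b (c *\<^sub>R y + t *\<^sub>R b)) has_real_derivative v2 b (c *\<^sub>R y)) (at 0)"
    using v b y c unfolding ray_C2_def by simp
  have "((\<lambda>t. y + (t / c) *\<^sub>R b) \<longlongrightarrow> y + (0 / c) *\<^sub>R b) (nhds 0)"
    using c by (intro tendsto_intros) (auto simp: filterlim_ident)
  then have "eventually (\<lambda>t. y + (t / c) *\<^sub>R b \<noteq> 0) (nhds 0)"
    using y by (auto dest: tendsto_imp_eventually_ne)
  then have "eventually (\<lambda>t. v1 b (c *\<^sub>R y + t *\<^sub>R b) = v1 b (y + (t / c) *\<^sub>R b) / c) (nhds 0)"
  proof eventually_elim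
    case (elim t)
    show ?case by (simp only: eq 1[OF elim])
  qed
  then have "((\<lambda>t. v1 b (y + (t / c) *\<^sub>R b) / c) has_real_derivative v2 b (c *\<^sub>R y)) (at 0)"
    using D by (subst (asm) DERIV_cong_ev[OF refl _ refl]) auto
  moreover have "((\<lambda>t. v1 b (y + t *\<^sub>R b)) has_real_derivative v2 b y) (at (0 / c))"
    using v b y unfolding ray_C2_def by simp
  from DERIV_cdivide[OF DERIV_chain2[OF this div], of c]
  have "((\<lambda>t. v1 b (y + (t / c) *\<^sub>R b) / c) has_real_derivative v2 b y * (1 / c) / c) (at 0)" .
  ultimately show ?thesis using c by (auto dest: DERIV_unique simp: power2_eq_square)
qed

lemma sgn_scaleR_pos: "c > 0 \<Longrightarrow> sgn (c *\<^sub>R y) = sgn (y :: 'a::euclidean_space)"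
  by (simp add: sgn_scaleR)

text \<open>Off the origin the function is
  \<open>(x \<bullet> y) ^ k * (y \<bullet> y) powr m\<close>, with \<open>m = - k / 2\<close>
  because \<open>y \<bullet> y\<close> is the squared norm. The truncated exponents
  \<open>k - 1\<close> and \<open>k - 2\<close> are harmless, since the factors
  \<open>real k\<close> and \<open>real (k - 1)\<close> vanish whenever the subtraction is cut off.
  On the unit sphere the sum of the second derivatives is the Gegenbauer operator applied to
  \<open>t ^ k\<close>.\<close>

lemma ray_C2_zonal_power:
  fixes x :: "'a::euclidean_space" and k :: nat
  defines "m \<equiv> - real k / 2"
  defines "v1 \<equiv> \<lambda>b y. real k * (x \<bullet> y) ^ (k - 1) * (x \<bullet> b) * (y \<bullet> y) powr m
      + (x \<bullet> y) ^ k * (m * (y \<bullet> y) powr (m - 1) * (2 * (y \<bullet> b)))"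
  defines "v2 \<equiv> \<lambda>b y. real k * real (k - 1) * (x \<bullet> y) ^ (k - 2) * (x \<bullet> b)\<^sup>2 * (y \<bullet> y) powr m
      + 2 * (real k * (x \<bullet> y) ^ (k - 1) * (x \<bullet> b) * (m * (y \<bullet> y) powr (m - 1) * (2 * (y \<bullet> b))))
      + (x \<bullet> y) ^ k * (m * (m - 1) * (y \<bullet> y) powr (m - 2) * (2 * (y \<bullet> b))\<^sup>2 + 2 * m * (y \<bullet> y) powr (m - 1))"
  shows "ray_C2 (\<lambda>y. (x \<bullet> sgn y) ^ k) v1 v2"
    and "norm x = 1 \<Longrightarrow> norm y = 1 \<Longrightarrow> (\<Sum>b\<in>Basis. v2 b y) =
       real k * real (k - 1) * (x \<bullet> y) ^ (k - 2) - real k * (real k + real DIM('a) - 2) * (x \<bullet> y) ^ k"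
proof -
  have v_eq: "(x \<bullet> sgn y) ^ k = (x \<bullet> y) ^ k * (y \<bullet> y) powr m" if "y \<noteq> 0" for y
  proof -
    have "(1 / norm y) ^ k = (y \<bullet> y) powr m"
      using that by (simp add: m_def dot_square_norm powr_powr powr_minus powr_realpow power_one_over
          inverse_eq_divide flip: powr_numeral)
    then show ?thesis by (simp add: sgn_div_norm power_mult_distrib divide_inverse mult.commute flip: power_inverse)
  qed
  have sq: "(\<Sum>b\<in>Basis. (z \<bullet> b) * (w \<bullet> b)) = z \<bullet> w" for z w :: 'a
    by (simp add: euclidean_inner[of z w])
  have pos: "y \<bullet> y > 0" if "y \<noteq> 0" for y :: 'a using that by simp
  have near: "eventually (\<lambda>t. y + t *\<^sub>R b \<noteq> 0) (nhds 0)" if "y \<noteq> 0" for y b :: 'a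
  proof -
    have "((\<lambda>t. y + t *\<^sub>R b) \<longlongrightarrow> y + 0 *\<^sub>R b) (nhds 0)" by (intro tendsto_intros) (auto simp: filterlim_ident)
    then show ?thesis using that by (auto dest: tendsto_imp_eventually_ne)
  qed
  have Dx: "((\<lambda>t. x \<bullet> (y + t *\<^sub>R b)) has_real_derivative x \<bullet> b) (at 0)" for y b
    by (auto intro!: derivative_eq_intros simp: inner_add_right)
  have Db: "((\<lambda>t. (y + t *\<^sub>R b) \<bullet> b) has_real_derivative 1) (at 0)" if "b \<in> Basis" for y b :: 'a
    using that by (auto intro!: derivative_eq_intros simp: inner_add_left)
  have DQ: "((\<lambda>t. (y + t *\<^sub>R b) \<bullet> (y + t *\<^sub>R b)) has_real_derivative 2 * (y \<bullet> b)) (at 0)" for y b :: 'a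
    by (auto intro!: derivative_eq_intros simp: has_field_derivative_def fun_eq_iff
        inner_add_left inner_add_right inner_commute)
  have DP: "((\<lambda>t. ((y + t *\<^sub>R b) \<bullet> (y + t *\<^sub>R b)) powr p) has_real_derivative
      p * (y \<bullet> y) powr (p - 1) * (2 * (y \<bullet> b))) (at 0)" if "y \<noteq> 0" for y b :: 'a and p
    using DERIV_fun_powr[OF DQ, of y b p] that by simp
  have Dk: "((\<lambda>t. (x \<bullet> (y + t *\<^sub>R b)) ^ j) has_real_derivative real j * (x \<bullet> y) ^ (j - 1) * (x \<bullet> b)) (at 0)" for y b j
    using DERIV_power[OF Dx[of y b], of j] by (simp add: mult_ac)
  show "ray_C2 (\<lambda>y. (x \<bullet> sgn y) ^ k) v1 v2"
    unfolding ray_C2_def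
  proof (intro conjI ballI allI impI)
    show "continuous_on (- {0}) (\<lambda>y. (x \<bullet> sgn y) ^ k)"
      by (auto intro!: continuous_intros simp: sgn_div_norm)
    fix b :: 'a
    show "continuous_on (- {0}) (v1 b)" "continuous_on (- {0}) (v2 b)"
      unfolding v1_def v2_def by (auto intro!: continuous_intros)
  next
    fix y b :: 'a assume y: "y \<noteq> 0" and b: "b \<in> Basis"
    have "((\<lambda>t. (x \<bullet> (y + t *\<^sub>R b)) ^ k * ((y + t *\<^sub>R b) \<bullet> (y + t *\<^sub>R b)) powr m) has_real_derivative v1 b y) (at 0)"
      using DERIV_mult'[OF Dk[of y b k] DP[OF y, of b m]] by (simp add: v1_def algebra_simps)
    moreover have "eventually (\<lambda>t. (x \<bullet> sgn (y + t *\<^sub>R b)) ^ k =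
        (x \<bullet> (y + t *\<^sub>R b)) ^ k * ((y + t *\<^sub>R b) \<bullet> (y + t *\<^sub>R b)) powr m) (nhds 0)"
      using near[OF y] by eventually_elim (rule v_eq)
    ultimately show "((\<lambda>t. (x \<bullet> sgn (y + t *\<^sub>R b)) ^ k) has_real_derivative v1 b y) (at 0)"
      by (subst DERIV_cong_ev[OF refl _ refl]) auto
    show "((\<lambda>t. v1 b (y + t *\<^sub>R b)) has_real_derivative v2 b y) (at 0)"
      unfolding v1_def
      by (rule derivative_eq_intros Dk DP[OF y] Db[OF b] refl)+
        (simp add: v2_def algebra_simps power2_eq_square numeral_2_eq_2)
  next
    fix y :: 'a assume y: "y \<noteq> 0"
    have "(\<Sum>b\<in>Basis. (y \<bullet> b) * v1 b y) =
        real k * (x \<bullet> y) ^ (k - 1) * (y \<bullet> y) powr m * (\<Sum>b\<in>Basis. (x \<bullet> b) * (y \<bullet> b))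
        + (x \<bullet> y) ^ k * (m * (y \<bullet> y) powr (m - 1) * 2) * (\<Sum>b\<in>Basis. (y \<bullet> b) * (y \<bullet> b))"
      by (simp add: v1_def sum.distrib sum_distrib_left algebra_simps)
    also have "\<dots> = real k * ((x \<bullet> y) ^ (k - 1) * (x \<bullet> y)) * (y \<bullet> y) powr m
        + (x \<bullet> y) ^ k * (2 * m) * ((y \<bullet> y) * (y \<bullet> y) powr (m - 1))"
      by (simp only: sq) (simp add: algebra_simps)
    also have "(y \<bullet> y) * (y \<bullet> y) powr (m - 1) = (y \<bullet> y) powr m"
      using pos[OF y] by (subst powr_mult_base) auto
    also have "real k * ((x \<bullet> y) ^ (k - 1) * (x \<bullet> y)) = real k * (x \<bullet> y) ^ k"
      by (cases k) auto
    also have "real k * (x \<bullet> y) ^ k * (y \<bullet> y) powr m + (x \<bullet> y) ^ k * (2 * m) * (y \<bullet> y) powr m = 0"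
      by (simp add: m_def algebra_simps)
    finally show "(\<Sum>b\<in>Basis. (y \<bullet> b) * v1 b y) = 0" .
  qed
  show "(\<Sum>b\<in>Basis. v2 b y) =
       real k * real (k - 1) * (x \<bullet> y) ^ (k - 2) - real k * (real k + real DIM('a) - 2) * (x \<bullet> y) ^ k"
    if "norm x = 1" "norm y = 1"
  proof -
    have xx: "x \<bullet> x = 1" and yy: "y \<bullet> y = 1" using that by (simp_all add: norm_eq_1)
    have "v2 b y = (real k * real (k - 1) * (x \<bullet> y) ^ (k - 2)) * ((x \<bullet> b) * (x \<bullet> b))
        + (4 * m * real k * (x \<bullet> y) ^ (k - 1)) * ((x \<bullet> b) * (y \<bullet> b))
        + ((x \<bullet> y) ^ k * (4 * m * (m - 1))) * ((y \<bullet> b) * (y \<bullet> b)) + (x \<bullet> y) ^ k * (2 * m)" for b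
      by (simp add: v2_def yy power2_eq_square algebra_simps)
    note v2_eq = this
    have "(\<Sum>b\<in>Basis. v2 b y) = real k * real (k - 1) * (x \<bullet> y) ^ (k - 2)
        + 4 * m * real k * (x \<bullet> y) ^ (k - 1) * (x \<bullet> y)
        + (x \<bullet> y) ^ k * (4 * m * (m - 1)) + real DIM('a) * ((x \<bullet> y) ^ k * (2 * m))"
      unfolding v2_eq sum.distrib sum_distrib_left[symmetric] sq xx yy sum_constant mult_1_right
      by (simp add: mult_ac)
    also have "\<dots> = real k * real (k - 1) * (x \<bullet> y) ^ (k - 2)
        + 4 * m * (real k * ((x \<bullet> y) ^ (k - 1) * (x \<bullet> y)))
        + (x \<bullet> y) ^ k * (4 * m * (m - 1) + 2 * m * real DIM('a))"
      by (simp add: algebra_simps)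
    also have "real k * ((x \<bullet> y) ^ (k - 1) * (x \<bullet> y)) = real k * (x \<bullet> y) ^ k"
      by (cases k) auto
    finally show ?thesis by (simp add: m_def field_simps)
  qed
qed


section \<open>The zonal measure\<close>

text \<open>Up to a constant, the image of the surface measure of the \<open>d\<close>-sphere under
  \<open>y \<mapsto> x \<bullet> y\<close>. With \<open>d = 2 * lam + 1\<close> the exponent
  \<open>d / 2 - 1\<close> is the exponent \<open>lam - 1 / 2\<close> of the Gegenbauer
  weight.\<close>

definition zonal_measure :: "real \<Rightarrow> real measure" where
  "zonal_measure d = density lborel (\<lambda>t. ennreal (indicator {-1..1} t * (1 - t\<^sup>2) powr (d / 2 - 1)))"

lemma space_zonal_measure [simp]: "space (zonal_measure d) = UNIV"
  and sets_zonal_measure [simp, measurable_cong]: "sets (zonal_measure d) = sets borel"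
  by (simp_all add: zonal_measure_def)

lemma one_minus_square_nonneg: "t \<in> {-1..1} \<Longrightarrow> 0 \<le> 1 - (t::real)\<^sup>2"
  by (simp add: abs_square_le_1 abs_le_iff)

lemma zonal_weight_bounds:
  fixes d :: real
  assumes "d \<ge> 2"
  shows "0 \<le> indicator {-1..1} t * (1 - t\<^sup>2) powr (d / 2 - 1)"
    and "indicator {-1..1} t * (1 - t\<^sup>2) powr (d / 2 - 1) \<le> indicator {-1..1} t"
proof -
  have "(1 - t\<^sup>2) powr (d / 2 - 1) \<le> 1" if "t \<in> {-1..1}"
    using one_minus_square_nonneg[OF that] assms powr_mono2[of "d / 2 - 1" "1 - t\<^sup>2" 1] by simp
  then show "indicator {-1..1} t * (1 - t\<^sup>2) powr (d / 2 - 1) \<le> indicator {-1..1} t"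
    by (auto simp: indicator_def)
qed (simp add: indicator_def)

lemma finite_measure_zonal_measure:
  assumes "d \<ge> 2" shows "finite_measure (zonal_measure d)"
proof (rule finite_measureI)
  have "emeasure (zonal_measure d) UNIV =
      (\<integral>\<^sup>+t. ennreal (indicator {-1..1} t * (1 - t\<^sup>2) powr (d / 2 - 1)) \<partial>lborel)"
    by (simp add: zonal_measure_def emeasure_density)
  also have "\<dots> \<le> (\<integral>\<^sup>+t. indicator {-1..1::real} t \<partial>lborel)"
    using zonal_weight_bounds(2)[OF assms]
    by (intro nn_integral_mono) (metis ennreal_indicator ennreal_leI)
  also have "\<dots> < \<infinity>" by simp
  finally show "emeasure (zonal_measure d) (space (zonal_measure d)) \<noteq> \<infinity>" by simp
qed

lemma AE_zonal_measure: "AE t in zonal_measure d. \<bar>t\<bar> < 1"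
proof -
  have "AE t in lborel. t \<notin> {-1, 1::real}"
    by (rule AE_not_in) (simp add: countable_imp_null_set_lborel)
  then have "AE t in lborel. 0 < ennreal (indicator {-1..1} t * (1 - t\<^sup>2) powr (d / 2 - 1)) \<longrightarrow> \<bar>t\<bar> < 1"
    by eventually_elim (auto simp: indicator_def abs_less_iff less_le)
  then show ?thesis
    unfolding zonal_measure_def by (subst AE_density) auto
qed

lemma integral_zonal_measure:
  assumes [measurable]: "g \<in> borel_measurable borel" and "d \<ge> 2"
  shows "(\<integral>t. g t \<partial>zonal_measure d) = (LBINT t:{-1..1}. g t * (1 - t\<^sup>2) powr (d / 2 - 1))"
  unfolding zonal_measure_def set_lebesgue_integral_def
  by (subst integral_density) (auto intro!: Bochner_Integration.integral_cong simp: indicator_def)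

lemma integrable_zonal_measure_continuous:
  assumes "continuous_on UNIV g" "d \<ge> 2"
  shows "integrable (zonal_measure d) (g :: real \<Rightarrow> real)"
proof -
  interpret finite_measure "zonal_measure d" by (rule finite_measure_zonal_measure) fact
  have [measurable]: "g \<in> borel_measurable borel" using assms by (intro borel_measurable_continuous_onI)
  have "compact (g ` {-1..1})"
    by (rule compact_continuous_image[OF continuous_on_subset[OF assms(1)]]) auto
  then obtain B where B: "\<And>t. t \<in> {-1..1} \<Longrightarrow> norm (g t) \<le> B"
    by (metis bounded_iff compact_imp_bounded imageI)
  have "AE t in zonal_measure d. norm (g t) \<le> B"
    using AE_zonal_measure by eventually_elim (auto intro!: B[unfolded real_norm_def])
  then show ?thesis by (intro integrable_const_bound[of _ B]) auto
qed

lemma integrable_zonal_measure_poly [simp]: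
  "d \<ge> 2 \<Longrightarrow> integrable (zonal_measure d) (poly p)"
  by (intro integrable_zonal_measure_continuous continuous_intros)

text \<open>Multiplied by the weight, the integrand is the derivative of
  \<open>(1 - t^2) powr (d / 2) * poly r t\<close>, which vanishes at both endpoints. The choice
  \<open>r = pderiv p\<close> gives the Gegenbauer operator. Differentiability is used in the open
  interval only.\<close>

lemma integral_zonal_divergence:
  assumes d: "d \<ge> 2"
  shows "(\<integral>t. (1 - t\<^sup>2) * poly (pderiv r) t - d * t * poly r t \<partial>zonal_measure d) = 0"
proof -
  define F where "F = (\<lambda>t::real. (1 - t\<^sup>2) powr (d / 2) * poly r t)"
  define h where "h = (\<lambda>t::real. ((1 - t\<^sup>2) * poly (pderiv r) t - d * t * poly r t) * (1 - t\<^sup>2) powr (d / 2 - 1))"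
  have "(h has_integral F 1 - F (-1)) {-1..1}"
  proof (rule fundamental_theorem_of_calculus_interior)
    show "continuous_on {-1..1} F"
      unfolding F_def using d
      by (intro continuous_on_mult continuous_on_powr' continuous_intros)
         (auto dest: one_minus_square_nonneg)
    fix t :: real assume "t \<in> {-1<..<1}"
    then have pos: "1 - t\<^sup>2 > 0" by (simp add: abs_square_less_1 abs_less_iff)
    then have *: "(1 - t\<^sup>2) powr (d / 2) = (1 - t\<^sup>2) * (1 - t\<^sup>2) powr (d / 2 - 1)"
      by (simp add: powr_mult_base)
    have "(F has_real_derivative h t) (at t)"
      unfolding F_def h_def using pos
      by (auto intro!: derivative_eq_intros) (simp add: * algebra_simps)
    then show "(F has_vector_derivative h t) (at t)" by (simp add: has_real_derivative_iff_has_vector_derivative)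
  qed simp
  moreover have "F 1 = 0" "F (-1) = 0" using d by (simp_all add: F_def)
  ultimately have 1: "(h has_integral 0) {-1..1}" by simp
  define g where "g = (\<lambda>t::real. (1 - t\<^sup>2) * poly (pderiv r) t - d * t * poly r t)"
  have [measurable]: "g \<in> borel_measurable borel"
    unfolding g_def by (intro borel_measurable_continuous_onI continuous_intros)
  have "integrable (zonal_measure d) g"
    unfolding g_def using d by (intro integrable_zonal_measure_continuous continuous_intros)
  then have "integrable lborel (\<lambda>t. (indicator {-1..1} t * (1 - t\<^sup>2) powr (d / 2 - 1)) *\<^sub>R g t)"
    unfolding zonal_measure_def by (subst (asm) integrable_density) (simp_all add: indicator_def)
  then have "set_integrable lborel {-1..1} h"
    by (simp add: set_integrable_def h_def g_def mult_ac)
  then have "(LBINT t:{-1..1}. h t) = integral {-1..1} h"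
    by (rule set_borel_integral_eq_integral)
  also have "\<dots> = 0" using 1 by (rule integral_unique)
  finally have "(LBINT t:{-1..1}. g t * (1 - t\<^sup>2) powr (d / 2 - 1)) = 0"
    by (simp add: h_def g_def)
  then show ?thesis using d by (fold g_def, subst integral_zonal_measure) simp_all
qed

lemma integral_gegenbauer_op:
  assumes "d \<ge> 2"
  shows "(\<integral>t. poly (gegenbauer_op d p) t \<partial>zonal_measure d) = 0"
  using integral_zonal_divergence[OF assms, of "pderiv p"] by (simp add: poly_gegenbauer_op mult.assoc)

text \<open>The difference of the two integrands is the divergence belonging to the Wronskian
  \<open>pderiv p * q - p * pderiv q\<close>.\<close>

lemma gegenbauer_op_self_adjoint:
  assumes "d \<ge> 2"
  shows "(\<integral>t. poly (gegenbauer_op d p) t * poly q t \<partial>zonal_measure d) =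
    (\<integral>t. poly p t * poly (gegenbauer_op d q) t \<partial>zonal_measure d)"
proof -
  have "(\<integral>t. poly (gegenbauer_op d p * q) t - poly (p * gegenbauer_op d q) t \<partial>zonal_measure d) = 0"
    using integral_zonal_divergence[OF assms, of "pderiv p * q - p * pderiv q"]
    by (simp add: poly_gegenbauer_op pderiv_diff pderiv_mult algebra_simps)
  then have "(\<integral>t. poly (gegenbauer_op d p * q) t \<partial>zonal_measure d) = (\<integral>t. poly (p * gegenbauer_op d q) t \<partial>zonal_measure d)"
    using assms by (subst (asm) Bochner_Integration.integral_diff) (simp_all del: poly_mult)
  moreover have "poly (r * s) = (\<lambda>t. poly r t * poly s t)" for r s :: "real poly" by (rule ext) simp
  ultimately show ?thesis by (simp only:)
qed

lemma integral_zonal_monom_rec: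
  assumes "d \<ge> 2"
  shows "(real k + 1 + d) * (\<integral>t. t ^ (k + 2) \<partial>zonal_measure d) = (real k + 1) * (\<integral>t. t ^ k \<partial>zonal_measure d)"
    and "(\<integral>t. t \<partial>zonal_measure d) = 0"
proof -
  have i: "integrable (zonal_measure d) (\<lambda>t. t ^ j)" for j
    using assms by (intro integrable_zonal_measure_continuous continuous_intros)
  have "(\<integral>t. (real k + 1) * t ^ k - (real k + 1 + d) * t ^ (k + 2) \<partial>zonal_measure d) = 0"
    using integral_zonal_divergence[OF assms, of "monom 1 (Suc k)"]
    by (simp add: pderiv_monom poly_monom algebra_simps power2_eq_square)
  then show "(real k + 1 + d) * (\<integral>t. t ^ (k + 2) \<partial>zonal_measure d) = (real k + 1) * (\<integral>t. t ^ k \<partial>zonal_measure d)"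
    by (subst (asm) Bochner_Integration.integral_diff) (auto intro: i simp del: power_Suc)
  show "(\<integral>t. t \<partial>zonal_measure d) = 0"
    using integral_zonal_divergence[OF assms, of 1] assms by simp
qed

text \<open>Uniform approximation by polynomials on \<open>[-1, 1]\<close> gives equal integrals for
  all continuous functions. Continuous ramps converge boundedly to the indicators of open
  half-lines, and half-lines determine a measure.\<close>

lemma finite_measure_eqI_moments:
  fixes M N :: "real measure"
  assumes fin: "finite_measure M" "finite_measure N"
    and sets [measurable_cong]: "sets M = sets borel" "sets N = sets borel"
    and AE: "AE t in M. \<bar>t\<bar> \<le> 1" "AE t in N. \<bar>t\<bar> \<le> 1"
    and mom: "\<And>k::nat. (\<integral>t. t ^ k \<partial>M) = (\<integral>t. t ^ k \<partial>N)"
  shows "M = N"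
proof -
  interpret M: finite_measure M by fact
  interpret N: finite_measure N by fact
  have space: "space M = UNIV" "space N = UNIV" using sets by (auto dest: sets_eq_imp_space_eq)
  have int: "integrable K g" if "continuous_on UNIV g" "K = M \<or> K = N" for g :: "real \<Rightarrow> real" and K
  proof -
    interpret finite_measure K using fin that by auto
    have [measurable]: "g \<in> borel_measurable K"
      using borel_measurable_continuous_onI[OF that(1)] sets that(2) by (metis measurable_cong_sets)
    have "compact (g ` {-1..1})"
      by (rule compact_continuous_image[OF continuous_on_subset[OF that(1)]]) auto
    then obtain B where B: "\<And>t. t \<in> {-1..1} \<Longrightarrow> norm (g t) \<le> B"
      by (metis bounded_iff compact_imp_bounded imageI)
    have "AE t in K. \<bar>t\<bar> \<le> 1" using AE that(2) by blast
    then have "AE t in K. norm (g t) \<le> B"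
      by eventually_elim (rule B, simp add: abs_le_iff)
    then show ?thesis by (intro integrable_const_bound[of _ B]) auto
  qed
  have cont: "(\<integral>t. g t \<partial>M) = (\<integral>t. g t \<partial>N)" if g: "continuous_on UNIV g" for g :: "real \<Rightarrow> real"
  proof -
    have "\<bar>(\<integral>t. g t \<partial>M) - (\<integral>t. g t \<partial>N)\<bar> \<le> e * (measure M UNIV + measure N UNIV)" if e: "e > 0" for e
    proof -
      obtain p where p: "real_polynomial_function p" "\<And>t. t \<in> {-1..1} \<Longrightarrow> \<bar>g t - p t\<bar> < e"
        using Stone_Weierstrass_real_polynomial_function[of "{-1..1}" g e] g e
        by (auto intro: continuous_on_subset)
      obtain a n where p_eq: "p = (\<lambda>t. \<Sum>i\<le>n. a i * t ^ i)"
        using p(1) unfolding real_polynomial_function_iff_sum by blast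
      have cp: "continuous_on UNIV p" unfolding p_eq by (intro continuous_intros)
      have "(\<integral>t. p t \<partial>M) = (\<integral>t. p t \<partial>N)"
        unfolding p_eq
        by (subst (1 2) Bochner_Integration.integral_sum) (auto intro!: int continuous_intros simp: mom)
      moreover have "\<bar>(\<integral>t. g t \<partial>K) - (\<integral>t. p t \<partial>K)\<bar> \<le> e * measure K UNIV" if K: "K = M \<or> K = N" for K
      proof -
        interpret finite_measure K using fin K by auto
        have sp: "space K = UNIV" using K space by auto
        have "\<bar>(\<integral>t. g t \<partial>K) - (\<integral>t. p t \<partial>K)\<bar> = \<bar>\<integral>t. g t - p t \<partial>K\<bar>"
          using int[OF g K] int[OF cp K] by simp
        also have "\<dots> \<le> (\<integral>t. \<bar>g t - p t\<bar> \<partial>K)" by (rule integral_abs_bound)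
        also have "\<dots> \<le> (\<integral>t. e \<partial>K)"
        proof (rule integral_mono_AE)
          show "integrable K (\<lambda>t. \<bar>g t - p t\<bar>)" using int[OF g K] int[OF cp K] by simp
          have "AE t in K. \<bar>t\<bar> \<le> 1" using AE K by blast
          then show "AE t in K. \<bar>g t - p t\<bar> \<le> e"
            by eventually_elim (rule less_imp_le[OF p(2)], simp add: abs_le_iff)
        qed simp
        also have "\<dots> = e * measure K UNIV" by (simp add: sp)
        finally show ?thesis .
      qed
      note this[of M] this[of N]
      ultimately show ?thesis by (simp add: ring_distribs)
    qed
    note b = this
    \<comment> \<open>The added 1 keeps the divisor positive even when both measures vanish.\<close>
    define m where "m = measure M UNIV + measure N UNIV + 1"
    have m: "m > 0" by (simp add: m_def add_nonneg_pos)
    have "\<bar>(\<integral>t. g t \<partial>M) - (\<integral>t. g t \<partial>N)\<bar> \<le> 0 + e" if "e > 0" for e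
    proof -
      have "\<bar>(\<integral>t. g t \<partial>M) - (\<integral>t. g t \<partial>N)\<bar> \<le> e / m * (measure M UNIV + measure N UNIV)"
        using b[of "e / m"] m that by simp
      also have "\<dots> \<le> e / m * m" using m that by (intro mult_left_mono) (auto simp: m_def)
      finally show ?thesis using m by simp
    qed
    then have "\<bar>(\<integral>t. g t \<partial>M) - (\<integral>t. g t \<partial>N)\<bar> \<le> 0" by (rule field_le_epsilon)
    then show ?thesis by simp
  qed
  show ?thesis
  proof (rule measure_eqI_lessThan[OF sets])
    fix x :: real
    show "emeasure M {x<..} < \<infinity>" by (simp add: M.emeasure_finite less_top[symmetric])
    \<comment> \<open>A ramp from 0 at \<open>x\<close> to 1 at \<open>x + 1 / j\<close>; its limit
      is 0 at \<open>x\<close> itself, matching the open half-line.\<close>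
    define g where "g = (\<lambda>(j::nat) t. max 0 (min 1 (real j * (t - x))))"
    have lim: "(\<lambda>j. g j t) \<longlonglongrightarrow> indicator {x<..} t" for t
    proof (cases "t > x")
      case True
      have "eventually (\<lambda>j. real j > 1 / (t - x)) sequentially"
        using filterlim_real_sequentially unfolding filterlim_at_top_dense by blast
      then have "eventually (\<lambda>j. g j t = 1) sequentially"
        by eventually_elim (use True in \<open>auto simp: g_def field_simps max_def min_def\<close>)
      then show ?thesis using True by (auto intro: tendsto_eventually)
    next
      case False
      then have "real j * (t - x) \<le> 0" for j by (intro mult_nonneg_nonpos) auto
      then have "g j t = 0" for j unfolding g_def by (intro max_absorb1 min.coboundedI2)
      then show ?thesis using False by simp
    qed
    have K: "(\<lambda>j. \<integral>t. g j t \<partial>K) \<longlonglongrightarrow> measure K {x<..}" if K: "K = M \<or> K = N" for K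
    proof -
      interpret finite_measure K using fin K by auto
      have [measurable_cong]: "sets K = sets borel" using K sets by auto
      have "(\<lambda>j. \<integral>t. g j t \<partial>K) \<longlonglongrightarrow> (\<integral>t. indicator {x<..} t \<partial>K)"
      proof (rule integral_dominated_convergence[where w = "\<lambda>_. 1"])
        show "g j \<in> borel_measurable K" for j unfolding g_def by measurable
        show "AE t in K. norm (g j t) \<le> 1" for j by (auto simp: g_def)
      qed (use lim in auto)
      then show ?thesis using K space by auto
    qed
    have "continuous_on UNIV (g j)" for j unfolding g_def by (intro continuous_intros)
    then have "(\<integral>t. g j t \<partial>M) = (\<integral>t. g j t \<partial>N)" for j by (rule cont)
    then have "measure M {x<..} = measure N {x<..}"
      using LIMSEQ_unique[of _ "measure M {x<..}"] K[of M] K[of N] by simp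
    then show "emeasure M {x<..} = emeasure N {x<..}"
      by (simp add: M.emeasure_eq_measure N.emeasure_eq_measure)
  qed
qed

text \<open>The positive and the negative part of \<open>D\<close> are densities of two finite
  measures with the same moments, so the measures and hence the densities agree. Both parts cannot
  be positive at the same point, so agreement means that both are zero.\<close>

lemma zonal_measure_moments_zero:
  assumes d: "d \<ge> 2" and D: "integrable (zonal_measure d) D"
    and mom: "\<And>k::nat. (\<integral>t. D t * t ^ k \<partial>zonal_measure d) = 0"
  shows "AE t in zonal_measure d. D t = 0"
proof -
  let ?\<mu> = "zonal_measure d"
  have [measurable]: "D \<in> borel_measurable borel" using D by (auto dest: borel_measurable_integrable)
  define P where "P = (\<lambda>t. max 0 (D t))"
  define N where "N = (\<lambda>t. max 0 (- D t))"
  have [measurable]: "P \<in> borel_measurable borel" "N \<in> borel_measurable borel"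
    unfolding P_def N_def by measurable
  have P_nonneg: "P t \<ge> 0" and N_nonneg: "N t \<ge> 0" for t by (simp_all add: P_def N_def)
  have iP: "integrable ?\<mu> P" and iN: "integrable ?\<mu> N" unfolding P_def N_def using D by auto
  have ik: "integrable ?\<mu> (\<lambda>t. Q t * t ^ k)" if "integrable ?\<mu> Q" for Q and k :: nat
  proof (rule Bochner_Integration.integrable_bound[OF that])
    have [measurable]: "Q \<in> borel_measurable borel" using that by (auto dest: borel_measurable_integrable)
    show "(\<lambda>t. Q t * t ^ k) \<in> borel_measurable ?\<mu>" by measurable
    show "AE t in ?\<mu>. norm (Q t * t ^ k) \<le> norm (Q t)"
      using AE_zonal_measure
    proof eventually_elim
      case (elim t)
      then have "\<bar>t\<bar> ^ k \<le> 1" by (intro power_le_one) auto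
      then show ?case by (simp add: abs_mult power_abs mult_left_le)
    qed
  qed
  have fin: "finite_measure (density ?\<mu> (\<lambda>t. ennreal (Q t)))"
    and ae: "AE t in density ?\<mu> (\<lambda>t. ennreal (Q t)). \<bar>t\<bar> \<le> 1"
    if Q: "integrable ?\<mu> Q" "\<And>t. Q t \<ge> 0" for Q
  proof -
    have [measurable]: "Q \<in> borel_measurable borel" using Q by (auto dest: borel_measurable_integrable)
    show "finite_measure (density ?\<mu> (\<lambda>t. ennreal (Q t)))"
      using nn_integral_eq_integral[OF Q(1)] Q(2)
      by (intro finite_measureI) (simp add: emeasure_density)
    show "AE t in density ?\<mu> (\<lambda>t. ennreal (Q t)). \<bar>t\<bar> \<le> 1"
      using AE_zonal_measure[of d] by (subst AE_density) (auto elim!: eventually_mono)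
  qed
  have "density ?\<mu> (\<lambda>t. ennreal (P t)) = density ?\<mu> (\<lambda>t. ennreal (N t))"
  proof (rule finite_measure_eqI_moments)
    fix k :: nat
    have "(\<integral>t. P t * t ^ k - N t * t ^ k \<partial>?\<mu>) = (\<integral>t. D t * t ^ k \<partial>?\<mu>)"
      by (intro Bochner_Integration.integral_cong) (auto simp: P_def N_def max_def)
    also note mom
    finally have "(\<integral>t. P t * t ^ k \<partial>?\<mu>) = (\<integral>t. N t * t ^ k \<partial>?\<mu>)"
      using ik[OF iP] ik[OF iN] by simp
    then show "(\<integral>t. t ^ k \<partial>density ?\<mu> (\<lambda>t. ennreal (P t))) = (\<integral>t. t ^ k \<partial>density ?\<mu> (\<lambda>t. ennreal (N t)))"
      by (subst (1 2) integral_density) (simp_all add: P_nonneg N_nonneg)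
  qed (simp_all add: fin[OF iP] fin[OF iN] ae[OF iP] ae[OF iN] P_nonneg N_nonneg)
  moreover have "(\<integral>\<^sup>+t. ennreal (P t) \<partial>?\<mu>) \<noteq> \<infinity>"
    using nn_integral_eq_integral[OF iP] by (simp add: P_nonneg)
  ultimately have "AE t in ?\<mu>. ennreal (P t) = ennreal (N t)"
    by (subst (asm) finite_density_unique) simp_all
  then show ?thesis
  proof eventually_elim
    case (elim t)
    then have "P t = N t" using P_nonneg N_nonneg by (metis ennreal_inj)
    then show ?case by (simp add: P_def N_def max_def split: if_splits)
  qed
qed


section \<open>Green's formula on the sphere against zonal polynomials\<close>

lemma finite_measure_sphere_measure: "finite_measure (sphere_measure :: 'a::euclidean_space measure)"
  by (rule finite_measureI) (simp add: emeasure_sphere_measure_total)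

lemma measurable_sphere_measure:
  fixes f :: "'a::euclidean_space \<Rightarrow> real"
  shows "f \<in> borel_measurable sphere_measure \<longleftrightarrow>
     f \<in> borel_measurable (restrict_space borel (sphere 0 1))"
  using measurable_cong_sets[of "sphere_measure :: 'a measure" "restrict_space borel (sphere 0 1)"
      "borel :: real measure" borel]
  by simp

lemma integrable_sphere_continuous:
  fixes f :: "'a::euclidean_space \<Rightarrow> real"
  assumes "continuous_on (sphere 0 1) f"
  shows "integrable sphere_measure f"
proof -
  interpret finite_measure "sphere_measure :: 'a measure" by (rule finite_measure_sphere_measure)
  obtain B where B: "\<And>y. y \<in> sphere 0 1 \<Longrightarrow> norm (f y) \<le> B"
    using compact_imp_bounded[OF compact_continuous_image[OF assms compact_sphere]]
    by (metis bounded_iff imageI)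
  show ?thesis
    using borel_measurable_continuous_on_restrict[OF assms] B
    by (intro integrable_const_bound[of _ B] AE_I2) (auto simp: measurable_sphere_measure)
qed

lemma laplace_beltrami_continuous:
  assumes "C2_on_sphere (u :: 'a::euclidean_space \<Rightarrow> real)"
  shows "continuous_on (sphere 0 1) u" "continuous_on (sphere 0 1) (laplace_beltrami u)"
proof -
  obtain u1 u2 where u: "ray_C2 (\<lambda>y. u (sgn y)) u1 u2" using C2_on_sphere_ray_C2[OF assms] .
  have sub: "sphere 0 1 \<subseteq> - {0::'a}" by auto
  have "continuous_on (sphere 0 1) (\<lambda>y. u (sgn y))"
    using u sub unfolding ray_C2_def by (blast intro: continuous_on_subset)
  then show "continuous_on (sphere 0 1) u"
    by (rule continuous_on_eq) (simp add: sgn_div_norm)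
  have "continuous_on (sphere 0 1) (\<lambda>y. \<Sum>b\<in>Basis. u2 b y)"
    using u sub unfolding ray_C2_def by (intro continuous_on_sum) (blast intro: continuous_on_subset)
  then show "continuous_on (sphere 0 1) (laplace_beltrami u)"
  proof (rule continuous_on_eq)
    fix y :: 'a assume "y \<in> sphere 0 1"
    then have "y \<noteq> 0" by auto
    then show "(\<Sum>b\<in>Basis. u2 b y) = laplace_beltrami u y"
      by (simp add: laplace_beltrami_def ray_C2_laplacian[OF u])
  qed
qed

text \<open>The radial weight for the passage from the shell to the sphere. The factor
  \<open>1 / (norm y)^2\<close> reflects that the Laplacian of a function constant along rays is
  homogeneous of degree -2; positivity allows the radial integral to be cancelled. The witness is a
  ball of radius 1/4 about a point of norm 3/4, which lies in the open shell.\<close>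

lemma shell_integral_pos:
  "integrable lborel (\<lambda>y::'a::euclidean_space. shell_cutoff ((norm y)\<^sup>2) / (norm y)\<^sup>2)" (is "integrable _ ?f")
  "(\<integral>y. shell_cutoff ((norm (y::'a))\<^sup>2) / (norm y)\<^sup>2 \<partial>lborel) > 0"
proof -
  show int: "integrable lborel ?f"
  proof (rule integrable_shell)
    show "continuous_on (- {0}) ?f" by (auto intro!: continuous_intros)
    fix y :: 'a assume "norm y \<le> 1/2 \<or> norm y \<ge> 1"
    then have "(norm y)\<^sup>2 \<le> 1/4 \<or> (norm y)\<^sup>2 \<ge> 1"
      using power_mono[of "norm y" "1/2" 2] power_mono[of 1 "norm y" 2] by (auto simp: power2_eq_square)
    then show "?f y = 0" by (simp add: shell_cutoff_eq_0)
  qed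
  have nn: "?f y \<ge> 0" for y by (simp add: shell_cutoff_nonneg)
  obtain z :: 'a where z: "norm z = 3/4" by (rule vector_choose_size[of "3/4"]) auto
  have "(\<integral>y. ?f y \<partial>lborel) \<noteq> 0"
  proof
    assume "(\<integral>y. ?f y \<partial>lborel) = 0"
    then have "AE y in lborel. ?f y = 0"
      using integral_nonneg_eq_0_iff_AE[OF int] nn by simp
    then have "AE y in lborel. y \<notin> ball z (1/4)"
    proof eventually_elim
      case (elim y)
      show ?case
      proof
        assume "y \<in> ball z (1/4)"
        then have "1/2 < norm y" "norm y < 1"
          using z norm_triangle_ineq2[of y z] norm_triangle_ineq2[of z y] by (auto simp: dist_norm norm_minus_commute)
        then have "1/4 < (norm y)\<^sup>2" "(norm y)\<^sup>2 < 1"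
          using power_strict_mono[of "1/2" "norm y" 2] power_strict_mono[of "norm y" 1 2] by (auto simp: power2_eq_square)
        then show False using shell_cutoff_pos[of "(norm y)\<^sup>2"] elim by auto
      qed
    qed
    then have "ball z (1/4) \<in> null_sets lborel" by (subst AE_iff_null_sets) auto
    then have "measure lborel (ball z (1/4)) = 0" by (simp add: measure_def null_sets_def)
    then show False using content_ball_pos[of "1/4" z] by simp
  qed
  moreover have "(\<integral>y. ?f y \<partial>lborel) \<ge> 0" by (intro Bochner_Integration.integral_nonneg nn)
  ultimately show "(\<integral>y. ?f y \<partial>lborel) > 0" by linarith
qed

text \<open>Green's identity on the solid shell, for the extensions of \<open>u\<close> and of
  \<open>(x \<bullet> y) ^ k\<close>, has an integrand that is a radial weight times a function
  \<open>g\<close> of \<open>sgn y\<close>. In polar coordinates it is a positive multiple of the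
  integral of \<open>g\<close> over the sphere, which must therefore vanish.\<close>

lemma sphere_green_power:
  fixes u :: "'a::euclidean_space \<Rightarrow> real" and x :: 'a
  assumes "C2_on_sphere u" and x: "norm x = 1"
  shows "(\<integral>y. laplace_beltrami u y * (x \<bullet> y) ^ k \<partial>sphere_measure) =
    (\<integral>y. u y * (real k * real (k - 1) * (x \<bullet> y) ^ (k - 2)
       - real k * (real k + real DIM('a) - 2) * (x \<bullet> y) ^ k) \<partial>sphere_measure)"
proof -
  define U where "U = (\<lambda>y. u (sgn y))"
  define V where "V = (\<lambda>y. (x \<bullet> sgn y) ^ k)"
  obtain u1 u2 where u: "ray_C2 U u1 u2" using C2_on_sphere_ray_C2[OF assms(1)] unfolding U_def .
  obtain v1 v2 where v: "ray_C2 V v1 v2" and v2: "\<And>y. norm y = 1 \<Longrightarrow> (\<Sum>b\<in>Basis. v2 b y) =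
       real k * real (k - 1) * (x \<bullet> y) ^ (k - 2) - real k * (real k + real DIM('a) - 2) * (x \<bullet> y) ^ k"
    using ray_C2_zonal_power[where x = x and k = k] x unfolding V_def by blast
  define LU where "LU = (\<lambda>y. \<Sum>b\<in>Basis. u2 b y)"
  define LV where "LV = (\<lambda>y. \<Sum>b\<in>Basis. v2 b y)"
  have hom: "LU y = LU (sgn y) / (norm y)\<^sup>2" "LV y = LV (sgn y) / (norm y)\<^sup>2" if "y \<noteq> 0" for y
  proof -
    have y: "y = norm y *\<^sub>R sgn y" using that by (simp add: sgn_div_norm)
    have s: "sgn y \<noteq> 0" "norm y > 0" using that by (simp_all add: sgn_zero_iff)
    have "u2 b y = u2 b (sgn y) / (norm y)\<^sup>2" "v2 b y = v2 b (sgn y) / (norm y)\<^sup>2" if b: "b \<in> Basis" for b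
      using ray_C2_homogeneous[OF u _ s(1) b s(2)] ray_C2_homogeneous[OF v _ s(1) b s(2)] y
      by (simp_all add: U_def V_def sgn_scaleR_pos)
    then show "LU y = LU (sgn y) / (norm y)\<^sup>2" "LV y = LV (sgn y) / (norm y)\<^sup>2"
      by (simp_all add: LU_def LV_def sum_divide_distrib)
  qed
  define g where "g = (\<lambda>z. LU z * V z - U z * LV z)"
  have sub: "sphere 0 1 \<subseteq> - {0::'a}" by auto
  have cont: "continuous_on (sphere 0 1) LU" "continuous_on (sphere 0 1) LV"
    "continuous_on (sphere 0 1) U" "continuous_on (sphere 0 1) V"
    using u v sub unfolding ray_C2_def LU_def LV_def
    by (auto intro!: continuous_on_sum intro: continuous_on_subset)
  have cg: "continuous_on (sphere 0 1) g" unfolding g_def by (intro continuous_intros cont)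
  let ?h = "\<lambda>r::real. shell_cutoff (r\<^sup>2) / r\<^sup>2"
  have "(\<integral>y. ?h (norm (y::'a)) \<partial>lborel) * (\<integral>y. g y \<partial>sphere_measure)
    = measure sphere_measure (sphere 0 1 :: 'a set) * (\<integral>y. ?h (norm y) * g (sgn y) \<partial>lborel)"
  proof (rule sphere_measure_radial_integral)
    show "g \<in> borel_measurable (restrict_space borel (sphere 0 1))"
      by (rule borel_measurable_continuous_on_restrict[OF cg])
    show "?h \<in> borel_measurable borel" unfolding shell_cutoff_def by measurable
    show "?h r = 0" if "r \<ge> 1" for r
      using that by (subst shell_cutoff_eq_0) (auto simp: one_le_power)
  qed (auto simp: shell_cutoff_nonneg shell_integral_pos(1))
  also have "(\<lambda>y. ?h (norm y) * g (sgn y)) = (\<lambda>y. shell_cutoff (y \<bullet> y) * (LU y * V y - U y * LV y))"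
  proof
    fix y :: 'a
    show "?h (norm y) * g (sgn y) = shell_cutoff (y \<bullet> y) * (LU y * V y - U y * LV y)"
    proof (cases "y = 0")
      case False
      have "sgn (sgn y) = sgn y" using False by (simp add: sgn_div_norm[of "sgn y"] norm_sgn)
      then have "U (sgn y) = U y" "V (sgn y) = V y" by (simp_all add: U_def V_def)
      moreover have "LU (sgn y) = (norm y)\<^sup>2 * LU y" "LV (sgn y) = (norm y)\<^sup>2 * LV y"
        using hom[OF False] False by (simp_all add: field_simps)
      ultimately have "g (sgn y) = (norm y)\<^sup>2 * (LU y * V y - U y * LV y)"
        by (simp add: g_def algebra_simps)
      then show ?thesis using False by (simp add: dot_square_norm)
    qed (simp add: shell_cutoff_eq_0)
  qed
  also have "(\<integral>y. shell_cutoff (y \<bullet> y) * (LU y * V y - U y * LV y) \<partial>lborel) = 0"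
    unfolding LU_def LV_def by (rule ray_C2_green[OF u v])
  finally have "(\<integral>y. g y \<partial>sphere_measure) = 0"
    using shell_integral_pos(2)[where 'a='a] by simp
  then have "(\<integral>y. LU y * V y \<partial>sphere_measure) = (\<integral>y. U y * LV y \<partial>sphere_measure)"
    unfolding g_def
    by (subst (asm) Bochner_Integration.integral_diff)
       (auto intro!: integrable_sphere_continuous continuous_intros cont)
  also have "(\<integral>y. LU y * V y \<partial>sphere_measure) = (\<integral>y. laplace_beltrami u y * (x \<bullet> y) ^ k \<partial>sphere_measure)"
  proof (rule Bochner_Integration.integral_cong[OF refl])
    fix y :: 'a assume "y \<in> space sphere_measure"
    then have "norm y = 1" "y \<noteq> 0" by auto
    then show "LU y * V y = laplace_beltrami u y * (x \<bullet> y) ^ k"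
      using ray_C2_laplacian[OF u] by (simp add: LU_def V_def U_def laplace_beltrami_def sgn_div_norm[of y])
  qed
  also have "(\<integral>y. U y * LV y \<partial>sphere_measure) = (\<integral>y. u y * (real k * real (k - 1) * (x \<bullet> y) ^ (k - 2)
       - real k * (real k + real DIM('a) - 2) * (x \<bullet> y) ^ k) \<partial>sphere_measure)"
    by (intro Bochner_Integration.integral_cong) (auto simp: LV_def U_def v2 sgn_div_norm)
  finally show ?thesis .
qed

lemma poly_induct_monom [case_names monom add]:
  assumes "\<And>c k. P (monom c k)" "\<And>p q. P p \<Longrightarrow> P q \<Longrightarrow> P (p + q)"
  shows "P (p :: 'a::comm_monoid_add poly)"
proof -
  have "P (\<Sum>i\<in>I. monom (coeff p i) i)" if "finite I" for I
    using that
  proof (induction I rule: finite_induct)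
    case empty show ?case using assms(1)[of 0 0] by simp
  qed (simp add: assms)
  from this[of "{..degree p}"] show ?thesis by (simp add: poly_as_sum_of_monoms)
qed

lemma poly_gegenbauer_op_monom:
  "poly (gegenbauer_op d (monom c k)) t =
     c * (real k * real (k - 1) * t ^ (k - 2) - real k * (real k + d - 1) * t ^ k)"
proof -
  consider "k = 0" | "k = 1" | j where "k = Suc (Suc j)" by (metis One_nat_def not0_implies_Suc)
  then show ?thesis
    by cases (simp_all add: poly_gegenbauer_op pderiv_monom poly_monom power2_eq_square algebra_simps)
qed

lemma sphere_green_poly:
  fixes u :: "'a::euclidean_space \<Rightarrow> real" and x :: 'a
  assumes u: "C2_on_sphere u" and x: "norm x = 1"
  shows "(\<integral>y. laplace_beltrami u y * poly p (x \<bullet> y) \<partial>sphere_measure) =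
    (\<integral>y. u y * poly (gegenbauer_op (real DIM('a) - 1) p) (x \<bullet> y) \<partial>sphere_measure)"
proof (induction p rule: poly_induct_monom)
  case (monom c k)
  have "(\<integral>y. laplace_beltrami u y * poly (monom c k) (x \<bullet> y) \<partial>sphere_measure) =
      c * (\<integral>y. laplace_beltrami u y * (x \<bullet> y) ^ k \<partial>sphere_measure)"
    by (subst integral_mult_right_zero[symmetric]) (simp add: poly_monom mult_ac)
  also have "\<dots> = (\<integral>y. c * (u y * (real k * real (k - 1) * (x \<bullet> y) ^ (k - 2)
       - real k * (real k + real DIM('a) - 2) * (x \<bullet> y) ^ k)) \<partial>sphere_measure)"
    unfolding sphere_green_power[OF u x] by simp
  also have "\<dots> = (\<integral>y. u y * poly (gegenbauer_op (real DIM('a) - 1) (monom c k)) (x \<bullet> y) \<partial>sphere_measure)"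
    by (intro Bochner_Integration.integral_cong) (simp_all add: poly_gegenbauer_op_monom)
  finally show ?case .
next
  case (add p q)
  have "integrable sphere_measure (\<lambda>y. laplace_beltrami u y * poly r (x \<bullet> y))"
    "integrable sphere_measure (\<lambda>y. u y * poly r (x \<bullet> y))" for r
    by (intro integrable_sphere_continuous continuous_intros laplace_beltrami_continuous u)+
  then show ?case using add by (simp add: gegenbauer_op_add ring_distribs)
qed

lemma C2_on_sphere_const: "C2_on_sphere (\<lambda>_::'a::euclidean_space. c)"
  unfolding C2_on_sphere_def C2_on_def
  by (rule exI[of _ "\<lambda>_. 0"], rule exI[of _ "\<lambda>_. 0"]) (auto simp: zero_blinfun.rep_eq)

lemma laplace_beltrami_const [simp]: "laplace_beltrami (\<lambda>_. c) y = 0"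
  by (simp add: laplace_beltrami_def laplacian_def numeral_2_eq_2)

lemma zonal_measure_pos: "d \<ge> 2 \<Longrightarrow> measure (zonal_measure d) UNIV > 0"
proof -
  assume d: "d \<ge> 2"
  interpret finite_measure "zonal_measure d" by (rule finite_measure_zonal_measure[OF d])
  have "emeasure (zonal_measure d) UNIV \<noteq> 0"
  proof
    assume "emeasure (zonal_measure d) UNIV = 0"
    then have "AE t in lborel. ennreal (indicator {-1..1} t * (1 - t\<^sup>2) powr (d / 2 - 1)) = 0"
      by (simp add: zonal_measure_def emeasure_density nn_integral_0_iff_AE)
    then have "AE t in lborel. t \<notin> {-1<..<1::real}"
    proof eventually_elim
      case (elim t)
      show ?case
      proof
        assume t: "t \<in> {-1<..<1}"
        then have "1 - t\<^sup>2 > 0" by (simp add: abs_square_less_1 abs_less_iff)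
        then have "(1 - t\<^sup>2) powr (d / 2 - 1) > 0" by simp
        with elim t show False by (simp add: indicator_def ennreal_eq_0_iff)
      qed
    qed
    then have "{-1<..<1::real} \<in> null_sets lborel" by (subst AE_iff_null_sets) auto
    then show False by (simp add: null_sets_def)
  qed
  then show ?thesis by (simp add: emeasure_eq_measure zero_less_measure_iff)
qed

text \<open>Both measures live on \<open>[-1, 1]\<close>, and their moments satisfy the same
  recurrence in steps of two. The first moments vanish, and the density constant is the quotient of
  the total masses, so that the moments of order 0 agree.\<close>

lemma distr_sphere_measure_inner:
  fixes x :: "'a::euclidean_space"
  assumes x: "norm x = 1" and d: "d = real DIM('a) - 1" "d \<ge> 2"
  shows "distr sphere_measure borel (\<lambda>y. x \<bullet> y) =
     density (zonal_measure d) (\<lambda>_. ennreal (measure sphere_measure (sphere 0 1 :: 'a set) / measure (zonal_measure d) UNIV))"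
    (is "?L = density _ (\<lambda>_. ennreal ?c)")
proof -
  interpret S: finite_measure "sphere_measure :: 'a measure" by (rule finite_measure_sphere_measure)
  interpret Z: finite_measure "zonal_measure d" by (rule finite_measure_zonal_measure[OF d(2)])
  have [measurable]: "(\<lambda>y. x \<bullet> y) \<in> borel_measurable sphere_measure"
    by (intro borel_measurable_integrable integrable_sphere_continuous continuous_intros)
  have int: "integrable sphere_measure (\<lambda>y. (x \<bullet> y) ^ k)" for k
    by (intro integrable_sphere_continuous continuous_intros)
  define m where "m = (\<lambda>k::nat. \<integral>y. (x \<bullet> y) ^ k \<partial>sphere_measure)"
  define z where "z = (\<lambda>k::nat. \<integral>t. t ^ k \<partial>zonal_measure d)"
  have z0: "z 0 = measure (zonal_measure d) UNIV" and m0: "m 0 = measure sphere_measure (sphere 0 1 :: 'a set)"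
    by (simp_all add: z_def m_def)
  have zpos: "z 0 > 0" using zonal_measure_pos[OF d(2)] z0 by simp
  \<comment> \<open>Green's formula for the constant function 1, on which the Laplace-Beltrami
    operator gives 0.\<close>
  have mrec: "real k * (real k + d - 1) * m k = real k * real (k - 1) * m (k - 2)" for k
  proof -
    have "(\<integral>y. real k * real (k - 1) * (x \<bullet> y) ^ (k - 2)
       - real k * (real k + real DIM('a) - 2) * (x \<bullet> y) ^ k \<partial>sphere_measure) = 0"
      using sphere_green_power[OF C2_on_sphere_const[of 1] x, of k]
      by (simp only: laplace_beltrami_const mult_1_left mult_zero_left Bochner_Integration.integral_zero)
    then show ?thesis
      by (subst (asm) Bochner_Integration.integral_diff) (auto simp: int m_def d(1) algebra_simps)
  qed
  have c: "?c \<ge> 0" by simp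
  have "m k = ?c * z k" for k
  proof (induction k rule: induct_nat_012)
    case 0 show ?case using zpos by (simp add: z0[symmetric] m0[symmetric])
  next
    case 1
    have "m 1 = 0" using mrec[of 1] d by simp
    moreover have "z 1 = 0" using integral_zonal_monom_rec(2)[OF d(2)] by (simp add: z_def)
    ultimately show ?case by simp
  next
    case (ge2 k)
    have "(real k + 2) * ((real k + 1 + d) * m (Suc (Suc k))) = (real k + 2) * ((real k + 1) * m k)"
      using mrec[of "Suc (Suc k)"] by (simp add: algebra_simps)
    then have "(real k + 1 + d) * m (Suc (Suc k)) = (real k + 1) * m k" by simp
    also have "\<dots> = ?c * ((real k + 1) * z k)" using ge2(1) by simp
    also have "\<dots> = (real k + 1 + d) * (?c * z (Suc (Suc k)))"
      using integral_zonal_monom_rec(1)[OF d(2), of k] by (simp add: z_def)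
    finally show ?case using d by (subst (asm) mult_left_cancel) auto
  qed
  note mz = this
  show ?thesis
  proof (rule finite_measure_eqI_moments)
    show "finite_measure ?L" by (rule S.finite_measure_distr) measurable
    show "finite_measure (density (zonal_measure d) (\<lambda>_. ennreal ?c))"
      by (rule finite_measureI) (simp add: emeasure_density_const Z.emeasure_eq_measure ennreal_mult_less_top ennreal_mult_eq_top_iff)
    have "\<bar>x \<bullet> y\<bar> \<le> 1" if "norm y = 1" for y
      using Cauchy_Schwarz_ineq2[of x y] x that by simp
    then show "AE t in ?L. \<bar>t\<bar> \<le> 1"
      by (subst AE_distr_iff) (auto intro!: AE_I2)
    show "AE t in density (zonal_measure d) (\<lambda>_. ennreal ?c). \<bar>t\<bar> \<le> 1"
      using AE_zonal_measure[of d] by (subst AE_density) (auto elim!: eventually_mono)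
    fix k :: nat
    have "(\<integral>t. t ^ k \<partial>?L) = m k" by (subst integral_distr) (auto simp: m_def)
    moreover have "(\<integral>t. t ^ k \<partial>density (zonal_measure d) (\<lambda>_. ennreal ?c)) = ?c * z k"
      using c by (subst integral_density) (auto simp: z_def)
    ultimately show "(\<integral>t. t ^ k \<partial>?L) = (\<integral>t. t ^ k \<partial>density (zonal_measure d) (\<lambda>_. ennreal ?c))"
      using mz by simp
  qed simp_all
qed


section \<open>The Green function\<close>

lemma AE_summable_norm:
  fixes f :: "nat \<Rightarrow> 'a \<Rightarrow> real"
  assumes int: "\<And>k. integrable M (f k)" and sum: "summable (\<lambda>k. \<integral>x. norm (f k x) \<partial>M)"
  shows "AE x in M. summable (\<lambda>k. norm (f k x))"
proof -
  have [measurable]: "f k \<in> borel_measurable M" for k using int by (rule borel_measurable_integrable)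
  have "(\<integral>\<^sup>+x. (\<Sum>k. ennreal (norm (f k x))) \<partial>M) = (\<Sum>k. \<integral>\<^sup>+x. ennreal (norm (f k x)) \<partial>M)"
    by (rule nn_integral_suminf) measurable
  also have "\<dots> = (\<Sum>k. ennreal (\<integral>x. norm (f k x) \<partial>M))"
    by (intro suminf_cong nn_integral_eq_integral) (use int in auto)
  also have "\<dots> = ennreal (\<Sum>k. \<integral>x. norm (f k x) \<partial>M)"
    by (intro suminf_ennreal2 sum) auto
  finally have "AE x in M. (\<Sum>k. ennreal (norm (f k x))) \<noteq> \<infinity>"
    by (intro nn_integral_PInf_AE) auto
  then show ?thesis
    by eventually_elim (intro summable_suminf_not_top, auto)
qed

abbreviation half_shift :: "real poly" where
  "half_shift \<equiv> [:1/2, 1/2:]"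

lemma poly_half_shift: "poly half_shift t = (1 + t) / 2"
  by (simp add: field_simps)

lemma summable_inverse_Suc_square: "summable (\<lambda>k. 1 / (real (Suc k))\<^sup>2)"
  using inverse_power_summable[of 2, where 'a = real]
    summable_Suc_iff[of "\<lambda>n. inverse ((of_nat n :: real)\<^sup>2)"]
  by (simp add: inverse_eq_divide)

text \<open>In the variable \<open>s = (1 + t) / 2\<close> the operator becomes the hypergeometric
  one, \<open>s (1 - s) p'' + (d / 2) (1 - 2 s) p'\<close>. Only two neighbouring powers occur,
  which is why the Green function is expanded in \<open>s\<close>.\<close>

lemma gegenbauer_op_half_shift_power:
  "gegenbauer_op d (half_shift ^ Suc k) =
     smult ((real k + 1) * (real k + d / 2)) (half_shift ^ k)
     - smult ((real k + 1) * (real k + d)) (half_shift ^ Suc k)"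
proof (rule poly_eqI_poly)
  fix t :: real
  define s where "s = (1 + t) / 2"
  have s: "poly half_shift t = s" and t: "t = 2 * s - 1" by (simp_all add: s_def field_simps)
  have d1: "pderiv (half_shift ^ Suc j) = smult ((real j + 1) / 2) (half_shift ^ j)" for j
  proof (rule poly_eqI_poly)
    show "poly (pderiv (half_shift ^ Suc j)) u = poly (smult ((real j + 1) / 2) (half_shift ^ j)) u" for u
      by (simp only: pderiv_power_Suc) (simp add: pderiv_pCons algebra_simps)
  qed
  show "poly (gegenbauer_op d (half_shift ^ Suc k)) t = poly (smult ((real k + 1) * (real k + d / 2)) (half_shift ^ k)
     - smult ((real k + 1) * (real k + d)) (half_shift ^ Suc k)) t"
  proof (cases k)
    case 0
    then show ?thesis
      by (simp only: poly_gegenbauer_op d1 poly_smult poly_diff poly_power s) (simp add: t field_simps)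
  next
    case (Suc j)
    have "pderiv (pderiv (half_shift ^ Suc k)) = smult ((real k + 1) / 2 * (real k / 2)) (half_shift ^ j)"
      unfolding Suc d1 pderiv_smult by (simp add: add.commute)
    then have "poly (gegenbauer_op d (half_shift ^ Suc k)) t =
        (1 - t\<^sup>2) * ((real k + 1) / 2 * (real k / 2) * s ^ j) - d * t * ((real k + 1) / 2 * (s ^ j * s))"
      by (simp only: poly_gegenbauer_op d1 poly_smult poly_power s) (simp add: Suc)
    also have "\<dots> = (real k + 1) * (real k + d / 2) * (s ^ j * s) - (real k + 1) * (real k + d) * (s ^ j * s * s)"
      unfolding t by (simp add: field_simps power2_eq_square)
    finally show ?thesis by (simp only: poly_smult poly_diff poly_power s) (simp add: Suc mult_ac)
  qed
qed

text \<open>Resonance is excluded from degree 1 on only, so that the locale also covers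
  \<open>a = 0\<close>, the eigenvalue of the constants. Degree 0 is dealt with at the end by an
  additive constant.\<close>

locale zonal_kernel =
  fixes d a :: real
  assumes d: "d \<ge> 2" and nonres: "\<And>k::nat. k \<ge> 1 \<Longrightarrow> a \<noteq> real k * (real k + d - 1)"
begin

definition "mom k = (\<integral>t. ((1 + t) / 2) ^ k \<partial>zonal_measure d)"

text \<open>The index \<open>j\<close> belongs to the degree \<open>j + 1\<close>, whose eigenvalue
  is \<open>(j + 1) * (j + d)\<close> up to sign. Nonresonance is precisely what keeps every factor
  different from zero.\<close>

definition "factor j = 1 - a / ((real j + 1) * (real j + d))"

definition "limprod = prodinf factor"

text \<open>Chosen so that the truncations \<open>green_poly m\<close> satisfy the equation up to a constant and the
  term \<open>(m + d / 2) * coef m * ((1 + t) / 2) ^ m\<close>, which tends to a point mass at \<open>t = 1\<close>.\<close>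
definition "coef m = - (mom 0 * (\<Prod>j<m. factor j)) / (limprod * (real m + d / 2) * mom m)"

definition "green_poly m = (\<Sum>k<m. smult (coef k / (real k + 1)) (half_shift ^ Suc k))"

text \<open>A pointwise \<open>suminf\<close>, whose convergence is established almost everywhere
  only; hence the function is always used under an integral.\<close>

definition "green_fun t = (\<Sum>k. coef k / (real k + 1) * ((1 + t) / 2) ^ Suc k)"

lemma mom_integrable: "integrable (zonal_measure d) (\<lambda>t. ((1 + t) / 2) ^ k)"
  by (intro integrable_zonal_measure_continuous continuous_intros d) auto

text \<open>The image of \<open>s ^ (k + 1)\<close> under the Gegenbauer operator has integral
  zero.\<close>

lemma mom_rec: "(real k + d) * mom (Suc k) = (real k + d / 2) * mom k"
proof -
  have "(\<integral>t. (real k + 1) * (real k + d / 2) * ((1 + t) / 2) ^ k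
      - (real k + 1) * (real k + d) * ((1 + t) / 2) ^ Suc k \<partial>zonal_measure d) = 0"
    using integral_gegenbauer_op[OF d, of "half_shift ^ Suc k"]
    unfolding gegenbauer_op_half_shift_power by (simp only: poly_diff poly_smult poly_power poly_half_shift)
  then have "(real k + 1) * (real k + d / 2) * mom k - (real k + 1) * (real k + d) * mom (Suc k) = 0"
    by (subst (asm) Bochner_Integration.integral_diff)
       (auto simp: mom_def simp del: power_Suc intro!: mom_integrable integrable_mult_right)
  then have "(real k + 1) * ((real k + d / 2) * mom k) = (real k + 1) * ((real k + d) * mom (Suc k))"
    by (simp add: mult_ac)
  then show ?thesis by simp
qed

lemma mom_0: "mom 0 = measure (zonal_measure d) UNIV"
  by (simp add: mom_def)

lemma mom_pos: "mom k > 0"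
proof (induction k)
  case 0 show ?case using zonal_measure_pos[OF d] by (simp add: mom_0)
next
  case (Suc k)
  then have "(real k + d) * mom (Suc k) > 0" using d by (simp add: mom_rec)
  then show ?case using d by (simp add: zero_less_mult_iff)
qed

lemma factor_nz: "factor j \<noteq> 0"
proof -
  have "(real j + 1) * (real j + d) > 0" using d by simp
  moreover have "a \<noteq> (real j + 1) * (real j + d)" using nonres[of "Suc j"] by (simp add: algebra_simps)
  ultimately show ?thesis by (auto simp: factor_def field_simps)
qed

lemma convergent_factor: "convergent_prod factor"
proof (rule abs_convergent_prod_imp_convergent_prod[OF summable_imp_abs_convergent_prod])
  have "summable (\<lambda>j. \<bar>a\<bar> * (1 / (real (Suc j))\<^sup>2))"
    by (intro summable_mult summable_inverse_Suc_square)
  then show "summable (\<lambda>j. norm (factor j - 1))"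
  proof (rule summable_comparison_test')
    fix j :: nat
    have "(real j + 1) * (real j + 1) \<le> (real j + 1) * (real j + d)"
      using d by (intro mult_left_mono) auto
    then have "\<bar>a\<bar> / ((real j + 1) * (real j + d)) \<le> \<bar>a\<bar> / ((real j + 1) * (real j + 1))"
      using d by (intro divide_left_mono mult_pos_pos) auto
    then show "norm (norm (factor j - 1)) \<le> \<bar>a\<bar> * (1 / (real (Suc j))\<^sup>2)"
      using d by (simp add: factor_def abs_mult power2_eq_square add.commute)
  qed
qed

lemma limprod_nz: "limprod \<noteq> 0"
  unfolding limprod_def by (rule prodinf_nonzero[OF convergent_factor factor_nz])

lemma prod_factor_lim: "(\<lambda>m. \<Prod>j<m. factor j) \<longlonglongrightarrow> limprod"
  using convergent_prod_LIMSEQ[OF convergent_factor] unfolding limprod_def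
  by (subst LIMSEQ_lessThan_iff_atMost)

text \<open>Up to sign, the mass of the remainder term under \<open>zonal_measure d\<close>. It
  tends to \<open>mom 0\<close>, so in the limit the remainder acts as \<open>mom 0\<close> times
  the unit point mass at \<open>t = 1\<close>; the division by \<open>limprod\<close> in
  \<open>coef\<close> serves this normalisation.\<close>

lemma coef_mom: "(real m + d / 2) * coef m * mom m = - mom 0 * (\<Prod>j<m. factor j) / limprod"
proof -
  have "real m + d / 2 \<noteq> 0" using d by simp
  then show ?thesis using mom_pos[of m] limprod_nz by (simp add: coef_def)
qed

text \<open>The condition for the power \<open>m + 1\<close> of \<open>s\<close> to cancel when the
  operator plus \<open>a\<close> is applied to the series. Once \<open>mom_rec\<close> has removed
  the moments, passing to the next coefficient costs exactly \<open>factor m\<close>.\<close>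

lemma coef_rec: "(real m + 1 + d / 2) * coef (Suc m) = coef m * ((real m + d) - a / (real m + 1))"
proof -
  have nz: "real m + 1 + d / 2 \<noteq> 0" "real m + d / 2 \<noteq> 0" "real m + d \<noteq> 0" "real m + 1 \<noteq> 0" using d by auto
  have "mom (Suc m) * ((real m + 1 + d / 2) * coef (Suc m)) = - mom 0 * (\<Prod>j<m. factor j) / limprod * factor m"
    using coef_mom[of "Suc m"] by (simp add: mult_ac add_ac)
  also have "\<dots> = (real m + d / 2) * mom m * coef m * factor m"
    using coef_mom[of m] by (simp add: mult_ac)
  also have "\<dots> = mom (Suc m) * (coef m * ((real m + d) * factor m))"
    by (subst mom_rec[symmetric]) (simp add: mult_ac)
  finally have "(real m + 1 + d / 2) * coef (Suc m) = coef m * ((real m + d) * factor m)"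
    using mom_pos[of "Suc m"] by simp
  also have "(real m + d) * factor m = (real m + d) - a / (real m + 1)"
    using nz by (simp add: factor_def right_diff_distrib)
  finally show ?thesis .
qed

lemma coef_0: "d / 2 * coef 0 = - 1 / limprod"
proof -
  have "mom 0 * (d / 2 * coef 0) = mom 0 * (- 1 / limprod)" using coef_mom[of 0] by (simp add: mult_ac)
  then show ?thesis using mom_pos[of 0] by (subst (asm) mult_left_cancel) auto
qed

text \<open>A telescoping sum: the lower power produced by the new summand cancels the old
  remainder, and the higher power, together with the term from \<open>a\<close>, is the new one by
  \<open>coef_rec\<close>.\<close>

lemma green_poly_equation:
  "gegenbauer_op d (green_poly m) + smult a (green_poly m) =
     [:- 1 / limprod:] - smult ((real m + d / 2) * coef m) (half_shift ^ m)"
proof (induction m)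
  case 0
  have "(real 0 + d / 2) * coef 0 = - 1 / limprod" using coef_0 by simp
  then show ?case by (simp only:) (simp add: green_poly_def one_pCons)
next
  case (Suc m)
  let ?c = "coef m / (real m + 1)"
  have "gegenbauer_op d (green_poly (Suc m)) + smult a (green_poly (Suc m)) =
      (gegenbauer_op d (green_poly m) + smult a (green_poly m)) +
      (smult ?c (gegenbauer_op d (half_shift ^ Suc m)) + smult (?c * a) (half_shift ^ Suc m))"
    by (simp add: green_poly_def gegenbauer_op_add gegenbauer_op_smult smult_add_right algebra_simps del: power_Suc)
  also have "\<dots> = [:- 1 / limprod:] - smult ((real m + d / 2) * coef m) (half_shift ^ m) +
      (smult (?c * ((real m + 1) * (real m + d / 2))) (half_shift ^ m)
       - smult (?c * ((real m + 1) * (real m + d)) - ?c * a) (half_shift ^ Suc m))"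
    unfolding Suc gegenbauer_op_half_shift_power
    by (simp add: smult_diff_right smult_diff_left del: power_Suc)
  also have "?c * ((real m + 1) * (real m + d / 2)) = (real m + d / 2) * coef m" by simp
  also have "?c * ((real m + 1) * (real m + d)) - ?c * a = (real (Suc m) + d / 2) * coef (Suc m)"
  proof -
    have "?c * ((real m + 1) * (real m + d)) = coef m * (real m + d)" by simp
    then have "?c * ((real m + 1) * (real m + d)) - ?c * a = coef m * ((real m + d) - a / (real m + 1))"
      by (simp add: right_diff_distrib)
    also note coef_rec[symmetric]
    finally show ?thesis by (simp add: add.commute add.left_commute)
  qed
  finally show ?case by simp
qed

text \<open>These are the norms in \<open>L\<^sup>1\<close> of the terms of the series. By
  \<open>coef_mom\<close> and boundedness of the partial products,
  \<open>(k + d / 2) * \<bar>coef k\<bar> * mom k\<close> is bounded; as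
  \<open>k + 1 \<le> k + d / 2\<close> and the moments decrease, the terms are O(1 / (k +
  1)^2).\<close>

lemma summable_coef_mom: "summable (\<lambda>k. \<bar>coef k / (real k + 1)\<bar> * mom (Suc k))"
proof -
  obtain B where B: "\<And>m. \<bar>\<Prod>j<m. factor j\<bar> \<le> B"
    using convergent_imp_Bseq[OF convergentI[OF prod_factor_lim]] by (auto simp: Bseq_def)
  have B0: "B \<ge> 0" using B[of 0] by simp
  let ?M = "mom 0 * B / \<bar>limprod\<bar>"
  have M0: "?M \<ge> 0" using B0 mom_pos[of 0] by simp
  have "summable (\<lambda>k. ?M * (1 / (real (Suc k))\<^sup>2))"
    by (intro summable_mult summable_inverse_Suc_square)
  then show ?thesis
  proof (rule summable_comparison_test')
    fix k :: nat
    have p: "real k + d / 2 > 0" "real k + 1 > 0" using d by auto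
    have "(real k + d) * mom (Suc k) \<le> (real k + d) * mom k"
      unfolding mom_rec using d mom_pos[of k] by (intro mult_right_mono) auto
    then have mono: "mom (Suc k) \<le> mom k" using d by simp
    have "(real k + d / 2) * (\<bar>coef k\<bar> * mom k) = \<bar>(real k + d / 2) * coef k * mom k\<bar>"
      using p mom_pos[of k] by (simp add: abs_mult)
    also have "\<dots> = mom 0 * \<bar>\<Prod>j<k. factor j\<bar> / \<bar>limprod\<bar>"
      unfolding coef_mom using mom_pos[of 0] by (simp add: abs_mult)
    also have "\<dots> \<le> ?M" using B[of k] mom_pos[of 0] by (intro divide_right_mono mult_left_mono) auto
    finally have "(real k + d / 2) * (\<bar>coef k\<bar> * mom k) \<le> ?M" .
    moreover have "(real k + 1) * (\<bar>coef k\<bar> * mom (Suc k)) \<le> (real k + d / 2) * (\<bar>coef k\<bar> * mom k)"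
      using d mono p mom_pos[of "Suc k"] by (intro mult_mono) auto
    ultimately have "(real k + 1) * (\<bar>coef k\<bar> * mom (Suc k)) \<le> ?M" by simp
    then have "\<bar>coef k\<bar> * mom (Suc k) \<le> ?M / (real k + 1)"
      by (subst pos_le_divide_eq[OF p(2)], subst mult.commute)
    then have "\<bar>coef k\<bar> * mom (Suc k) / (real k + 1) \<le> ?M / (real k + 1) / (real k + 1)"
      using p by (intro divide_right_mono) auto
    then show "norm (\<bar>coef k / (real k + 1)\<bar> * mom (Suc k)) \<le> ?M * (1 / (real (Suc k))\<^sup>2)"
      using mom_pos[of "Suc k"] p by (simp add: abs_mult power2_eq_square add.commute mult.assoc)
  qed
qed

lemma green_fun_measurable [measurable]: "green_fun \<in> borel_measurable borel"
proof -
  have "green_fun = (\<lambda>t. \<Sum>k. coef k / (real k + 1) * ((1 + t) / 2) ^ Suc k)"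
    by (rule ext) (rule green_fun_def)
  then show ?thesis by (simp only:) measurable
qed

end

text \<open>An abstract space with a zonal variable \<open>tau\<close> whose law is a multiple of
  the zonal measure. Instantiated by the sphere with \<open>tau y = x \<bullet> y\<close> it gives
  the convolution formula; instantiated by the interval with the identity it gives the Gegenbauer
  coefficients.\<close>

locale zonal_pushforward = zonal_kernel d a + finite_measure M
  for d a :: real and M :: "'b measure" +
  fixes tau :: "'b \<Rightarrow> real" and c :: real
  assumes tau_measurable [measurable]: "tau \<in> borel_measurable M"
    and distr_tau: "distr M borel tau = density (zonal_measure d) (\<lambda>_. ennreal c)"
    and c_nonneg: "c \<ge> 0"
begin

definition "s y = (1 + tau y) / 2"

lemma s_measurable [measurable]: "s \<in> borel_measurable M"
  unfolding s_def[abs_def] by measurable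

lemma AE_s: "AE y in M. 0 \<le> s y \<and> s y \<le> 1"
proof -
  have "AE t in distr M borel tau. \<bar>t\<bar> \<le> 1"
    unfolding distr_tau using AE_zonal_measure[of d] by (subst AE_density) (auto elim!: eventually_mono)
  then have "AE y in M. \<bar>tau y\<bar> \<le> 1" by (subst (asm) AE_distr_iff) auto
  then show ?thesis by eventually_elim (auto simp: abs_le_iff s_def)
qed

lemma s_power_integrable: "integrable M (\<lambda>y. s y ^ k)"
proof (rule integrable_const_bound[of _ 1])
  show "AE y in M. norm (s y ^ k) \<le> 1" using AE_s by eventually_elim (simp add: power_le_one)
qed measurable

lemma integral_s_power: "(\<integral>y. s y ^ k \<partial>M) = c * mom k"
proof -
  have "(\<integral>y. s y ^ k \<partial>M) = (\<integral>t. ((1 + t) / 2) ^ k \<partial>distr M borel tau)"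
    unfolding s_def by (subst integral_distr) auto
  also have "\<dots> = c * mom k" unfolding distr_tau using c_nonneg by (subst integral_density) (auto simp: mom_def)
  finally show ?thesis .
qed

text \<open>A bounded factor \<open>F\<close> preserves the summability of the
  \<open>L\<^sup>1\<close> norms, so the series may be integrated term by term.\<close>

lemma green_series:
  assumes [measurable]: "F \<in> borel_measurable M" and F: "AE y in M. \<bar>F y\<bar> \<le> B"
  shows "integrable M (\<lambda>y. F y * green_fun (tau y))"
    and "(\<lambda>m. \<integral>y. F y * poly (green_poly m) (tau y) \<partial>M) \<longlonglongrightarrow> (\<integral>y. F y * green_fun (tau y) \<partial>M)"
proof -
  note s = AE_s and sk = s_power_integrable and int_s = integral_s_power and c = c_nonneg
  \<comment> \<open>\<open>B\<close> itself may be negative when \<open>M\<close> is the zero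
    measure.\<close>
  define B' where "B' = max B 0"
  have F': "AE y in M. \<bar>F y\<bar> \<le> B'" and B': "B' \<ge> 0"
    using F by (auto simp: B'_def elim!: eventually_mono)
  define f where "f = (\<lambda>k y. F y * (coef k / (real k + 1) * s y ^ Suc k))"
  have [measurable]: "f k \<in> borel_measurable M" for k unfolding f_def by measurable
  have f_bound: "AE y in M. norm (f k y) \<le> B' * \<bar>coef k / (real k + 1)\<bar> * s y ^ Suc k" for k
    using F' s
  proof eventually_elim
    case (elim y)
    have "\<bar>F y\<bar> * (\<bar>coef k / (real k + 1)\<bar> * s y ^ Suc k) \<le> B' * (\<bar>coef k / (real k + 1)\<bar> * s y ^ Suc k)"
      using elim by (intro mult_right_mono) auto
    then show ?case using elim by (simp add: f_def abs_mult mult_ac)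
  qed
  have bi: "integrable M (\<lambda>y. B' * \<bar>coef k / (real k + 1)\<bar> * s y ^ Suc k)" for k
    by (intro integrable_mult_right sk)
  have fi: "integrable M (f k)" for k
  proof (rule Bochner_Integration.integrable_bound[OF bi[of k]])
    show "AE y in M. norm (f k y) \<le> norm (B' * \<bar>coef k / (real k + 1)\<bar> * s y ^ Suc k)"
      using f_bound[of k] by eventually_elim (metis order_trans abs_ge_self real_norm_def)
  qed measurable
  have fn: "(\<integral>y. norm (f k y) \<partial>M) \<le> B' * c * (\<bar>coef k / (real k + 1)\<bar> * mom (Suc k))" for k
  proof -
    have "(\<integral>y. norm (f k y) \<partial>M) \<le> (\<integral>y. B' * \<bar>coef k / (real k + 1)\<bar> * s y ^ Suc k \<partial>M)"
      using fi bi f_bound by (intro integral_mono_AE) auto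
    also have "\<dots> = B' * \<bar>coef k / (real k + 1)\<bar> * (c * mom (Suc k))"
      unfolding int_s[symmetric] by (rule integral_mult_right_zero)
    finally show ?thesis by (simp add: mult_ac)
  qed
  have sn: "summable (\<lambda>k. \<integral>y. norm (f k y) \<partial>M)"
    by (rule summable_comparison_test'[OF summable_mult[OF summable_coef_mom, of "B' * c"]])
       (use fn in \<open>auto intro: Bochner_Integration.integral_nonneg\<close>)
  have ae: "AE y in M. summable (\<lambda>k. norm (f k y))" by (rule AE_summable_norm[OF fi sn])
  have k0: "AE y in M. F y * green_fun (tau y) = (\<Sum>k. f k y)"
  proof -
    \<comment> \<open>The series without the factor \<open>F y\<close>: that factor may be zero, so
      convergence of the series of \<open>f k y\<close> would not yield convergence of the series
      that defines \<open>green_fun\<close>.\<close>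
    define g where "g = (\<lambda>k y. coef k / (real k + 1) * s y ^ Suc k)"
    have gi: "integrable M (g k)" for k unfolding g_def by (intro integrable_mult_right sk)
    have "(\<integral>y. norm (g k y) \<partial>M) = c * (\<bar>coef k / (real k + 1)\<bar> * mom (Suc k))" for k
    proof -
      have "(\<integral>y. norm (g k y) \<partial>M) = (\<integral>y. \<bar>coef k / (real k + 1)\<bar> * s y ^ Suc k \<partial>M)"
      proof (rule integral_cong_AE)
        show "AE y in M. norm (g k y) = \<bar>coef k / (real k + 1)\<bar> * s y ^ Suc k"
          using s by eventually_elim (simp add: g_def abs_mult)
      qed (simp_all add: g_def)
      also have "\<dots> = \<bar>coef k / (real k + 1)\<bar> * (c * mom (Suc k))"
        unfolding int_s[symmetric] by (rule integral_mult_right_zero)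
      finally show ?thesis by (simp add: mult_ac)
    qed
    then have "AE y in M. summable (\<lambda>k. norm (g k y))"
      using summable_mult[OF summable_coef_mom, of c] by (intro AE_summable_norm[OF gi]) simp
    then show ?thesis
    proof eventually_elim
      case (elim y)
      then have "summable (\<lambda>k. g k y)" by (rule summable_norm_cancel)
      from suminf_mult[OF this, of "F y"] show ?case
        by (simp add: f_def g_def green_fun_def s_def)
    qed
  qed
  show "integrable M (\<lambda>y. F y * green_fun (tau y))"
    by (subst integrable_cong_AE[OF _ _ k0]) (use integrable_suminf[OF fi ae sn] in auto)
  have "(\<lambda>m. \<Sum>k<m. \<integral>y. f k y \<partial>M) \<longlonglongrightarrow> (\<integral>y. (\<Sum>k. f k y) \<partial>M)"
    using sums_integral[OF fi ae sn] by (simp add: sums_def)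
  also have "(\<integral>y. (\<Sum>k. f k y) \<partial>M) = (\<integral>y. F y * green_fun (tau y) \<partial>M)"
    by (rule integral_cong_AE[symmetric]) (use k0 in auto)
  finally have lim1: "(\<lambda>m. \<Sum>k<m. \<integral>y. f k y \<partial>M) \<longlonglongrightarrow> (\<integral>y. F y * green_fun (tau y) \<partial>M)" .
  have "(\<Sum>k<m. \<integral>y. f k y \<partial>M) = (\<integral>y. F y * poly (green_poly m) (tau y) \<partial>M)" for m
  proof -
    have half: "poly half_shift (tau y) = s y" for y by (simp add: s_def field_simps)
    have "(\<Sum>k<m. \<integral>y. f k y \<partial>M) = (\<integral>y. (\<Sum>k<m. f k y) \<partial>M)"
      by (subst Bochner_Integration.integral_sum) (auto intro: fi)
    also have "\<dots> = (\<integral>y. F y * poly (green_poly m) (tau y) \<partial>M)"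
      by (simp only: f_def green_poly_def poly_sum poly_smult poly_power half sum_distrib_left)
    finally show ?thesis .
  qed
  then show "(\<lambda>m. \<integral>y. F y * poly (green_poly m) (tau y) \<partial>M) \<longlonglongrightarrow> (\<integral>y. F y * green_fun (tau y) \<partial>M)"
    using lim1 by simp
qed

text \<open>Green's formula is applied to \<open>green_poly m\<close>, and \<open>m\<close> tends to
  infinity. What has to be shown is that \<open>s ^ m / mom m\<close> concentrates where
  \<open>tau = 1\<close>. The modulus of continuity in \<open>near\<close> is linear in
  \<open>1 - tau\<close>, that is, in \<open>1 - s\<close>, so the error is controlled by
  consecutive moments alone.\<close>

lemma green_representation:
  assumes F: "F \<in> borel_measurable M" "AE y in M. \<bar>F y\<bar> \<le> B" and U: "integrable M U"
    and near: "\<And>e. e > 0 \<Longrightarrow> \<exists>C\<ge>0. AE y in M. \<bar>U y - u0\<bar> \<le> e + C * (1 - tau y)"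
    and green: "\<And>P. (\<integral>y. F y * poly P (tau y) \<partial>M) =
       (\<integral>y. U y * poly (gegenbauer_op d P + smult a P) (tau y) \<partial>M)"
  shows "(\<integral>y. F y * green_fun (tau y) \<partial>M) = - (1 / limprod) * (\<integral>y. U y \<partial>M) + c * mom 0 * u0"
proof -
  note s = AE_s and sk = s_power_integrable and int_s = integral_s_power and c = c_nonneg
  have Us: "integrable M (\<lambda>y. U y * s y ^ k)" for k
  proof (rule Bochner_Integration.integrable_bound[OF U])
    have [measurable]: "U \<in> borel_measurable M" by (rule borel_measurable_integrable[OF U])
    show "(\<lambda>y. U y * s y ^ k) \<in> borel_measurable M" by measurable
    show "AE y in M. norm (U y * s y ^ k) \<le> norm (U y)"
      using s by eventually_elim (simp add: abs_mult mult_left_le power_le_one)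
  qed
  have partial: "(\<integral>y. F y * poly (green_poly m) (tau y) \<partial>M) = - (1 / limprod) * (\<integral>y. U y \<partial>M)
      - (real m + d / 2) * coef m * (\<integral>y. U y * s y ^ m \<partial>M)" for m
  proof -
    have half: "poly half_shift (tau y) = s y" for y by (simp add: s_def field_simps)
    have "(\<integral>y. F y * poly (green_poly m) (tau y) \<partial>M)
        = (\<integral>y. U y * poly ([:- 1 / limprod:] - smult ((real m + d / 2) * coef m) (half_shift ^ m)) (tau y) \<partial>M)"
      unfolding green green_poly_equation ..
    also have "\<dots> = (\<integral>y. - (1 / limprod) * U y - (real m + d / 2) * coef m * (U y * s y ^ m) \<partial>M)"
      by (intro Bochner_Integration.integral_cong) (simp_all only: poly_diff poly_smult poly_power half, simp_all add: algebra_simps)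
    also have "\<dots> = - (1 / limprod) * (\<integral>y. U y \<partial>M) - (real m + d / 2) * coef m * (\<integral>y. U y * s y ^ m \<partial>M)"
      by (subst Bochner_Integration.integral_diff)
         (auto intro!: integrable_mult_right integrable_minus U Us simp only: integral_mult_right_zero)
    finally show ?thesis .
  qed
  have lim2: "(\<lambda>m. (\<integral>y. U y * s y ^ m \<partial>M) / mom m) \<longlonglongrightarrow> c * u0"
  proof (rule LIMSEQ_I)
    fix r :: real assume r: "r > 0"
    \<comment> \<open>The summand 1 guards against \<open>c = 0\<close>; the choice makes
      \<open>c * e\<close> at most \<open>r / 2\<close>.\<close>
    define e where "e = r / (2 * (c + 1))"
    have e: "e > 0" using r c by (simp add: e_def)
    obtain C where C: "C \<ge> 0" "AE y in M. \<bar>U y - u0\<bar> \<le> e + C * (1 - tau y)" using near[OF e] by auto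
    have bound: "\<bar>(\<integral>y. U y * s y ^ m \<partial>M) / mom m - c * u0\<bar> \<le> c * e + c * C * d / (real m + d)" for m
    proof -
      define q where "q = d / (real m + d)"
      have tau_s: "1 - tau y = 2 * (1 - s y)" for y by (simp add: s_def field_simps)
      have "\<bar>(\<integral>y. U y * s y ^ m \<partial>M) - u0 * (c * mom m)\<bar> = \<bar>\<integral>y. (U y - u0) * s y ^ m \<partial>M\<bar>"
        using Us[of m] sk[of m] by (simp add: left_diff_distrib int_s)
      also have "\<dots> \<le> (\<integral>y. \<bar>(U y - u0) * s y ^ m\<bar> \<partial>M)" by (rule integral_abs_bound)
      also have "\<dots> \<le> (\<integral>y. (e + 2 * C) * s y ^ m - 2 * C * s y ^ Suc m \<partial>M)"
      proof (rule integral_mono_AE)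
        show "integrable M (\<lambda>y. \<bar>(U y - u0) * s y ^ m\<bar>)"
          using Us[of m] sk[of m] by (simp add: left_diff_distrib)
        show "integrable M (\<lambda>y. (e + 2 * C) * s y ^ m - 2 * C * s y ^ Suc m)"
          by (intro Bochner_Integration.integrable_diff integrable_mult_right sk)
        show "AE y in M. \<bar>(U y - u0) * s y ^ m\<bar> \<le> (e + 2 * C) * s y ^ m - 2 * C * s y ^ Suc m"
          using C(2) s
        proof eventually_elim
          case (elim y)
          have "\<bar>(U y - u0) * s y ^ m\<bar> = \<bar>U y - u0\<bar> * s y ^ m"
            using elim by (simp add: abs_mult)
          also have "\<dots> \<le> (e + C * (1 - tau y)) * s y ^ m"
            using elim by (intro mult_right_mono) auto
          also have "\<dots> = (e + 2 * C) * s y ^ m - 2 * C * s y ^ Suc m"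
            by (simp add: tau_s algebra_simps)
          finally show ?case .
        qed
      qed
      also have "\<dots> = (e + 2 * C) * (c * mom m) - 2 * C * (c * mom (Suc m))"
        unfolding int_s[symmetric]
        by (subst Bochner_Integration.integral_diff)
           (auto intro!: integrable_mult_right sk simp del: power_Suc)
      \<comment> \<open>The ratio of consecutive moments is \<open>(m + d / 2) / (m + d)\<close>,
        which tends to 1; its defect \<open>q / 2\<close> makes the term with the possibly large
        constant \<open>C\<close> vanish in the limit.\<close>
      also have "mom (Suc m) = mom m * (1 - q / 2)"
        using mom_rec[of m] d by (simp add: q_def field_simps)
      also have "(e + 2 * C) * (c * mom m) - 2 * C * (c * (mom m * (1 - q / 2))) = mom m * (c * e + c * C * q)"
        by (simp add: algebra_simps)
      finally have "\<bar>(\<integral>y. U y * s y ^ m \<partial>M) - u0 * (c * mom m)\<bar> \<le> mom m * (c * e + c * C * d / (real m + d))"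
        by (simp add: q_def)
      moreover have "(\<integral>y. U y * s y ^ m \<partial>M) / mom m - c * u0 = ((\<integral>y. U y * s y ^ m \<partial>M) - u0 * (c * mom m)) / mom m"
        using mom_pos[of m] by (simp add: field_simps)
      ultimately show ?thesis
        using mom_pos[of m] by (simp add: abs_divide pos_divide_le_eq mult.commute)
    qed
    have ce: "c * e \<le> r / 2" using c r by (simp add: e_def field_simps)
    have "(\<lambda>m. c * C * d / (real m + d)) \<longlonglongrightarrow> 0" by real_asymp
    then have "eventually (\<lambda>m. c * C * d / (real m + d) < r / 2) sequentially"
      by (rule order_tendstoD(2)) (use r in simp)
    then obtain N where N: "\<And>m. m \<ge> N \<Longrightarrow> c * C * d / (real m + d) < r / 2"
      by (auto simp: eventually_sequentially)
    show "\<exists>N. \<forall>m\<ge>N. norm ((\<integral>y. U y * s y ^ m \<partial>M) / mom m - c * u0) < r"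
    proof (intro exI allI impI)
      fix m assume "m \<ge> N"
      then show "norm ((\<integral>y. U y * s y ^ m \<partial>M) / mom m - c * u0) < r"
        unfolding real_norm_def using bound[of m] N[of m] ce by linarith
    qed
  qed
  have "(\<lambda>m. (- mom 0 * (\<Prod>j<m. factor j) / limprod) * ((\<integral>y. U y * s y ^ m \<partial>M) / mom m)) \<longlonglongrightarrow> (- mom 0 * limprod / limprod) * (c * u0)"
    using limprod_nz by (intro tendsto_intros prod_factor_lim lim2)
  also have "(\<lambda>m. (- mom 0 * (\<Prod>j<m. factor j) / limprod) * ((\<integral>y. U y * s y ^ m \<partial>M) / mom m)) =
      (\<lambda>m. (real m + d / 2) * coef m * (\<integral>y. U y * s y ^ m \<partial>M))"
    unfolding coef_mom[symmetric] using mom_pos by (auto simp: fun_eq_iff less_imp_neq[symmetric])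
  finally have "(\<lambda>m. - (1 / limprod) * (\<integral>y. U y \<partial>M) - (real m + d / 2) * coef m * (\<integral>y. U y * s y ^ m \<partial>M))
      \<longlonglongrightarrow> - (1 / limprod) * (\<integral>y. U y \<partial>M) - (- mom 0 * limprod / limprod) * (c * u0)"
    by (rule tendsto_diff[OF tendsto_const])
  with green_series(2)[OF F] have "(\<integral>y. F y * green_fun (tau y) \<partial>M) = - (1 / limprod) * (\<integral>y. U y \<partial>M) - (- mom 0 * limprod / limprod) * (c * u0)"
    unfolding partial by (rule LIMSEQ_unique)
  then show "(\<integral>y. F y * green_fun (tau y) \<partial>M) = - (1 / limprod) * (\<integral>y. U y \<partial>M) + c * mom 0 * u0"
    using limprod_nz by simp
qed

end


section \<open>Norms of the Gegenbauer polynomials and the Green representation\<close>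

lemma integrable_zonal_measure_poly_mult:
  "d \<ge> 2 \<Longrightarrow> integrable (zonal_measure d) (\<lambda>t. poly p t * poly q t)"
  by (intro integrable_zonal_measure_continuous continuous_intros)

text \<open>Pairing the three-term recurrence with suitable neighbours and using orthogonality gives
  a recursion for the squared norms. Up to the factor \<open>l + lam\<close> it is the recursion
  satisfied by the values at 1, so the norms are expressed through these values and no Gamma
  functions appear.\<close>

lemma gegenbauer_norm:
  fixes d lam :: real
  assumes d: "d \<ge> 2" "d = 2 * lam + 1"
  shows "(real l + lam) * (\<integral>t. (poly (gegenbauer_poly lam l) t)\<^sup>2 \<partial>zonal_measure d) =
    lam * measure (zonal_measure d) UNIV * poly (gegenbauer_poly lam l) 1"
proof -
  define ip where "ip = (\<lambda>p q. \<integral>t. poly p t * poly q t \<partial>zonal_measure d)"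
  define C where "C = gegenbauer_poly lam"
  have lam: "lam > 0" using d by simp
  have int: "integrable (zonal_measure d) (\<lambda>t. poly p t * poly q t)" for p q
    by (rule integrable_zonal_measure_poly_mult[OF d(1)])
  have diff: "ip (p - q) r = ip p r - ip q r"
    and smult: "ip (smult c p) r = c * ip p r" and comm: "ip p r = ip r p" for p q r c
    by (simp_all add: ip_def ring_distribs int mult.assoc mult.commute[of "poly p _"])
  have orth: "ip (C j) (C k) = 0" if "j \<noteq> k" for j k
  proof -
    have "ip (gegenbauer_op d (C j)) (C k) = ip (C j) (gegenbauer_op d (C k))"
      unfolding ip_def using gegenbauer_op_self_adjoint[OF d(1)] by simp
    moreover have "gegenbauer_op d (C i) = smult (- (real i * (real i + 2 * lam))) (C i)" for i
      unfolding C_def d(2) by (rule gegenbauer_op_gegenbauer_poly)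
    ultimately have "- (real j * (real j + 2 * lam)) * ip (C j) (C k) = - (real k * (real k + 2 * lam)) * ip (C j) (C k)"
      by (simp only: smult comm[of "C j"])
    moreover have "real j * (real j + 2 * lam) \<noteq> real k * (real k + 2 * lam)"
    proof
      assume "real j * (real j + 2 * lam) = real k * (real k + 2 * lam)"
      then have "(real j - real k) * (real j + real k + 2 * lam) = 0" by (simp add: algebra_simps)
      then show False using that lam by (auto simp: add_nonneg_eq_0_iff)
    qed
    ultimately show ?thesis by simp
  qed
  let ?X = "[:0, 1::real:]"
  have shift: "ip (?X * p) q = ip p (?X * q)" for p q by (simp add: ip_def mult_ac)
  have rec: "(real j + 2) * ip (C (Suc (Suc j))) r =
      2 * (real j + 1 + lam) * ip (?X * C (Suc j)) r - (real j + 2 * lam) * ip (C j) r" for j r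
    using arg_cong[OF gegenbauer_poly_rec[of j lam], of "\<lambda>p. ip p r"]
    by (simp only: smult diff C_def)
  define h where "h = (\<lambda>j. ip (C j) (C j))"
  have step: "(real j + 1 + lam) * h (Suc j) * (real j + 1) = (real j + lam) * h j * (real j + 2 * lam)" for j
  proof -
    have A: "2 * (real j + 1 + lam) * ip (?X * C (Suc j)) (C j) = (real j + 2 * lam) * h j"
      using rec[of j "C j"] orth[of "Suc (Suc j)" j] by (simp add: h_def)
    \<comment> \<open>The recurrence produces polynomials of degree 2 or more; for
      \<open>j = 0\<close> the explicit polynomial of degree 1 takes its place.\<close>
    have B: "(real j + 1) * h (Suc j) = 2 * (real j + lam) * ip (?X * C j) (C (Suc j))"
    proof (cases j)
      case 0
      have "C (Suc 0) = smult (2 * lam) (?X * C 0)" by (simp add: C_def)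
      then have "h (Suc 0) = 2 * lam * ip (?X * C 0) (C (Suc 0))" unfolding h_def by (metis smult)
      then show ?thesis using 0 by simp
    next
      case (Suc i)
      then show ?thesis using rec[of i "C (Suc j)"] orth[of i "Suc j"] by (simp add: h_def add.commute)
    qed
    define I where "I = ip (?X * C j) (C (Suc j))"
    have I: "ip (?X * C (Suc j)) (C j) = I" unfolding I_def by (simp only: shift comm[of "C (Suc j)"])
    have "(real j + 1 + lam) * h (Suc j) * (real j + 1) = (real j + 1 + lam) * ((real j + 1) * h (Suc j))"
      by simp
    also have "\<dots> = (real j + 1 + lam) * (2 * (real j + lam) * I)" unfolding B I_def ..
    also have "\<dots> = (real j + lam) * (2 * (real j + 1 + lam) * I)" by (simp add: algebra_simps)
    also have "\<dots> = (real j + lam) * ((real j + 2 * lam) * h j)" using A unfolding I by (simp only:)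
    finally show ?thesis by (simp add: mult_ac)
  qed
  have "(real l + lam) * h l = lam * measure (zonal_measure d) UNIV * poly (C l) 1"
  proof (induction l)
    case 0 show ?case by (simp add: h_def ip_def C_def)
  next
    case (Suc l)
    have "(real l + 1) * ((real l + 1 + lam) * h (Suc l)) =
        (real l + 2 * lam) * ((real l + lam) * h l)"
      using step[of l] by (simp add: mult_ac)
    also have "\<dots> = lam * measure (zonal_measure d) UNIV * ((real l + 2 * lam) * poly (C l) 1)"
      unfolding Suc by (simp add: mult_ac)
    also have "\<dots> = (real l + 1) * (lam * measure (zonal_measure d) UNIV * poly (C (Suc l)) 1)"
      unfolding C_def gegenbauer_poly_at_1[symmetric] by (simp add: mult_ac)
    finally have "(real l + 1 + lam) * h (Suc l) = lam * measure (zonal_measure d) UNIV * poly (C (Suc l)) 1"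
      by simp
    then show ?case by (simp add: add_ac)
  qed
  then show ?thesis by (simp add: h_def ip_def C_def power2_eq_square)
qed

text \<open>The factor \<open>(lam + l) / lam\<close> of the expansions is the total mass times the
  value at 1, divided by the squared norm. Prescribing a coefficient thus becomes a linear condition
  on an integral, in the form in which \<open>green_fun_poly\<close> produces it.\<close>

lemma gegenbauer_coeff_iff:
  assumes d: "d \<ge> 2" "d = 2 * lam + 1" and g: "g \<in> borel_measurable borel"
  shows "gegenbauer_coeff lam g l = c * ((lam + real l) / lam) \<longleftrightarrow>
    (\<integral>t. g t * poly (gegenbauer_poly lam l) t \<partial>zonal_measure d) =
      c * (measure (zonal_measure d) UNIV * poly (gegenbauer_poly lam l) 1)"
proof -
  let ?C = "poly (gegenbauer_poly lam l)"
  let ?h = "\<integral>t. (?C t)\<^sup>2 \<partial>zonal_measure d"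
  have lam: "lam > 0" "d / 2 - 1 = lam - 1 / 2" using d by simp_all
  have [measurable]: "?C \<in> borel_measurable borel" "g \<in> borel_measurable borel"
    using g by (auto intro!: borel_measurable_continuous_onI continuous_intros)
  have h: "(lam + real l) * ?h = lam * (measure (zonal_measure d) UNIV * ?C 1)"
    using gegenbauer_norm[OF d, of l] by (simp add: mult_ac add_ac)
  have "(lam + real l) * ?h > 0"
    unfolding h using lam(1) zonal_measure_pos[OF d(1)] gegenbauer_poly_at_1_pos[of lam l] by simp
  then have hpos: "?h > 0" using lam(1) by (simp add: zero_less_mult_iff)
  have "gegenbauer_coeff lam g l = (\<integral>t. g t * ?C t \<partial>zonal_measure d) / ?h"
    unfolding gegenbauer_coeff_def poly_gegenbauer_poly[symmetric] lam(2)[symmetric]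
    using d(1) by (subst (1 2) integral_zonal_measure) simp_all
  also have "\<dots> = c * ((lam + real l) / lam) \<longleftrightarrow> (\<integral>t. g t * ?C t \<partial>zonal_measure d) = c * ((lam + real l) * ?h / lam)"
    using hpos by (simp add: divide_eq_eq mult.assoc)
  also have "(lam + real l) * ?h / lam = measure (zonal_measure d) UNIV * ?C 1"
    unfolding h using lam(1) by simp
  finally show ?thesis .
qed

lemma gegenbauer_poly_span:
  assumes lam: "lam > 0" and "\<And>l. P (gegenbauer_poly lam l)"
    and "\<And>p q. P p \<Longrightarrow> P q \<Longrightarrow> P (p + q)" "\<And>c p. P p \<Longrightarrow> P (smult c p)"
  shows "P p"
proof -
  \<comment> \<open>The alternative \<open>p = 0\<close> is the start of the induction: the zero
    polynomial has degree 0, which is not below \<open>n = 0\<close>.\<close>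
  have "degree p < n \<or> p = 0 \<Longrightarrow> P p" for n p
  proof (induction n arbitrary: p)
    case 0
    then show ?case using assms(4)[OF assms(2)[of 0], of 0] by simp
  next
    case (Suc n)
    let ?C = "gegenbauer_poly lam n"
    have C: "degree ?C \<le> n" "coeff ?C n > 0" using degree_gegenbauer_poly[OF lam] by auto
    define c where "c = coeff p n / coeff ?C n"
    have "degree (p - smult c ?C) < n \<or> p - smult c ?C = 0"
    proof (cases "n = 0")
      case True
      then have "degree p = 0" "degree ?C = 0" using Suc.prems C by auto
      then have "p - smult c ?C = 0" using C(2) True
        by (auto simp: c_def elim!: degree_eq_zeroE)
      then show ?thesis ..
    next
      case False
      have "degree p \<le> n" using Suc.prems by auto
      then have le: "degree (p - smult c ?C) \<le> n" using C(1)
        by (intro degree_diff_le) (auto intro: order_trans[OF degree_smult_le])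
      moreover have "coeff (p - smult c ?C) n = 0" using C(2) by (simp add: c_def)
      then have "degree (p - smult c ?C) \<noteq> n" using False
        by (metis degree_0 leading_coeff_0_iff)
      ultimately show ?thesis by simp
    qed
    then have "P (p - smult c ?C)" by (rule Suc.IH)
    then have "P ((p - smult c ?C) + smult c ?C)" by (intro assms)
    then show ?case by simp
  qed
  from this[of p "Suc (degree p)"] show ?thesis by simp
qed

text \<open>Close to \<open>x\<close> continuity gives the bound \<open>e\<close>; at distance at
  least \<open>r\<close> the crude bound \<open>2 * B\<close> is absorbed by the quadratic term. The
  square is chosen because on the unit sphere \<open>(dist y x)^2\<close> equals
  \<open>2 * (1 - x \<bullet> y)\<close>, linear in the zonal variable.\<close>

lemma continuous_at_compact_quadratic:
  fixes f :: "'a::metric_space \<Rightarrow> real"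
  assumes K: "compact K" and f: "continuous_on K f" and x: "x \<in> K" and e: "e > 0"
  shows "\<exists>C\<ge>0. \<forall>y\<in>K. \<bar>f y - f x\<bar> \<le> e + C * (dist y x)\<^sup>2"
proof -
  obtain r where r: "r > 0" "\<And>y. y \<in> K \<Longrightarrow> dist y x < r \<Longrightarrow> \<bar>f y - f x\<bar> < e"
    using f x e unfolding continuous_on_iff dist_real_def by metis
  obtain B where B: "\<And>y. y \<in> K \<Longrightarrow> \<bar>f y\<bar> \<le> B"
    using compact_imp_bounded[OF compact_continuous_image[OF f K]] by (auto simp: bounded_iff)
  have B0: "B \<ge> 0" using B[OF x] by simp
  show ?thesis
  proof (intro exI[of _ "2 * B / r\<^sup>2"] conjI ballI)
    show "2 * B / r\<^sup>2 \<ge> 0" using B0 by simp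
    fix y assume y: "y \<in> K"
    show "\<bar>f y - f x\<bar> \<le> e + 2 * B / r\<^sup>2 * (dist y x)\<^sup>2"
    proof (cases "dist y x < r")
      case True
      have "2 * B / r\<^sup>2 * (dist y x)\<^sup>2 \<ge> 0" using B0 by simp
      then show ?thesis using r(2)[OF y True] by linarith
    next
      case False
      then have "r\<^sup>2 \<le> (dist y x)\<^sup>2" using r by (intro power_mono) auto
      then have "2 * B / r\<^sup>2 * r\<^sup>2 \<le> 2 * B / r\<^sup>2 * (dist y x)\<^sup>2" using B0 by (intro mult_left_mono) auto
      then have "2 * B \<le> 2 * B / r\<^sup>2 * (dist y x)\<^sup>2" using r by simp
      moreover have "\<bar>f y - f x\<bar> \<le> 2 * B" using B[OF y] B[OF x] by linarith
      ultimately show ?thesis using e by linarith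
    qed
  qed
qed

section \<open>The two instances: the interval and the sphere\<close>

context zonal_kernel
begin

lemma zonal_pushforward_self: "zonal_pushforward d a (zonal_measure d) (\<lambda>t. t) 1"
proof -
  interpret finite_measure "zonal_measure d" by (rule finite_measure_zonal_measure[OF d])
  show ?thesis
    by unfold_locales (simp_all add: distr_id2 density_1)
qed

lemma AE_zonal_poly_bound: "\<exists>B. AE t in zonal_measure d. \<bar>poly p t\<bar> \<le> B"
proof -
  have "continuous_on {-1..1} (poly p)" by (intro continuous_intros)
  then obtain B where B: "\<And>t. t \<in> {-1..1} \<Longrightarrow> norm (poly p t) \<le> B"
    using compact_imp_bounded[OF compact_continuous_image] compact_Icc by (metis bounded_iff imageI)
  have "AE t in zonal_measure d. \<bar>poly p t\<bar> \<le> B"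
    using AE_zonal_measure by eventually_elim (rule B[unfolded real_norm_def], auto)
  then show ?thesis ..
qed

lemma poly_measurable_zonal: "poly p \<in> borel_measurable (zonal_measure d)"
  by (rule borel_measurable_integrable[OF integrable_zonal_measure_poly[OF d]])

lemma poly_green_fun_integrable: "integrable (zonal_measure d) (\<lambda>t. poly p t * green_fun t)"
proof -
  interpret zonal_pushforward d a "zonal_measure d" "\<lambda>t. t" 1 by (rule zonal_pushforward_self)
  obtain B where "AE t in zonal_measure d. \<bar>poly p t\<bar> \<le> B" using AE_zonal_poly_bound by blast
  then show ?thesis
    by (intro green_series(1) poly_measurable_zonal)
qed

lemma green_fun_integrable: "integrable (zonal_measure d) green_fun"
  using poly_green_fun_integrable[of 1] by simp

text \<open>The representation on the interval with \<open>U\<close> the polynomial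
  \<open>p\<close>, \<open>F\<close> its image under the operator plus \<open>a\<close>, and
  constant 1; self-adjointness takes the place of Green's formula on the sphere. For a Gegenbauer
  polynomial \<open>p\<close> it determines a coefficient of \<open>green_fun\<close>.\<close>

lemma green_fun_poly:
  "(\<integral>t. poly (gegenbauer_op d p + smult a p) t * green_fun t \<partial>zonal_measure d) =
    - (1 / limprod) * (\<integral>t. poly p t \<partial>zonal_measure d) + mom 0 * poly p 1"
proof -
  interpret zonal_pushforward d a "zonal_measure d" "\<lambda>t. t" 1 by (rule zonal_pushforward_self)
  obtain B where B: "AE t in zonal_measure d. \<bar>poly (gegenbauer_op d p + smult a p) t\<bar> \<le> B"
    using AE_zonal_poly_bound by blast
  have near: "\<exists>C\<ge>0. AE t in zonal_measure d. \<bar>poly p t - poly p 1\<bar> \<le> e + C * (1 - t)" if "e > 0" for e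
  proof -
    have "continuous_on {-1..1} (poly p)" by (intro continuous_intros)
    from continuous_at_compact_quadratic[OF compact_Icc this _ that, of 1]
    obtain C where C: "C \<ge> 0" "\<And>t. t \<in> {-1..1} \<Longrightarrow> \<bar>poly p t - poly p 1\<bar> \<le> e + C * (dist t 1)\<^sup>2"
      by (metis atLeastAtMost_iff order_refl zero_le_one neg_le_0_iff_le order_trans)
    have "AE t in zonal_measure d. \<bar>poly p t - poly p 1\<bar> \<le> e + 2 * C * (1 - t)"
      using AE_zonal_measure
    proof eventually_elim
      case (elim t)
      \<comment> \<open>Here \<open>0 \<le> 1 - t \<le> 2\<close>, so the quadratic bound becomes
        linear in \<open>1 - t\<close>.\<close>
      have "(1 - t) * (1 - t) \<le> 2 * (1 - t)" using elim by (intro mult_right_mono) auto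
      then have "(dist t 1)\<^sup>2 \<le> 2 * (1 - t)"
        by (simp add: dist_real_def power2_eq_square algebra_simps)
      then have "C * (dist t 1)\<^sup>2 \<le> C * (2 * (1 - t))" using C(1) by (intro mult_left_mono)
      moreover have "\<bar>poly p t - poly p 1\<bar> \<le> e + C * (dist t 1)\<^sup>2" using elim by (intro C(2)) auto
      ultimately show ?case by (simp add: algebra_simps)
    qed
    then show ?thesis using C(1) by (intro exI[of _ "2 * C"]) auto
  qed
  have green: "(\<integral>t. poly (gegenbauer_op d p + smult a p) t * poly P t \<partial>zonal_measure d) =
     (\<integral>t. poly p t * poly (gegenbauer_op d P + smult a P) t \<partial>zonal_measure d)" for P
  proof -
    have int: "integrable (zonal_measure d) (\<lambda>t. poly q t * poly r t)" for q r
      by (rule integrable_zonal_measure_poly_mult[OF d])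
    show ?thesis
      using gegenbauer_op_self_adjoint[OF d, of p P]
      by (simp add: ring_distribs int mult.assoc mult.left_commute[of _ a])
  qed
  show ?thesis
    using green_representation[OF poly_measurable_zonal B integrable_zonal_measure_poly[OF d] near green]
    by simp
qed

lemma zonal_pushforward_sphere:
  fixes x :: "'a::euclidean_space"
  assumes x: "norm x = 1" and dim: "d = real DIM('a) - 1"
  shows "zonal_pushforward d a sphere_measure (\<lambda>y. x \<bullet> y)
    (measure sphere_measure (sphere 0 1 :: 'a set) / mom 0)"
proof -
  interpret finite_measure "sphere_measure :: 'a measure" by (rule finite_measure_sphere_measure)
  show ?thesis
  proof unfold_locales
    show "(\<lambda>y. x \<bullet> y) \<in> borel_measurable sphere_measure"
      by (intro borel_measurable_integrable integrable_sphere_continuous continuous_intros)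
    show "distr sphere_measure borel (\<lambda>y. x \<bullet> y) = density (zonal_measure d)
        (\<lambda>_. ennreal (measure sphere_measure (sphere 0 1 :: 'a set) / mom 0))"
      unfolding mom_0 by (rule distr_sphere_measure_inner[OF x dim d])
    show "0 \<le> measure sphere_measure (sphere 0 1 :: 'a set) / mom 0"
      using mom_pos[of 0] by simp
  qed
qed

text \<open>The third claim is Green's formula against the polynomial 1; it converts the integral of
  \<open>f\<close>, which an additive constant in the kernel produces, into the integral of
  \<open>u\<close>.\<close>

lemma sphere_green_representation:
  fixes x :: "'a::euclidean_space"
  assumes x: "norm x = 1" and dim: "d = real DIM('a) - 1"
    and u: "C2_on_sphere u" and f: "continuous_on (sphere 0 1) f"
    and eq: "\<And>y. y \<in> sphere 0 1 \<Longrightarrow> laplace_beltrami u y + a * u y = f y"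
  shows "integrable sphere_measure (\<lambda>y. f y * green_fun (x \<bullet> y))"
    and "(\<integral>y. f y * green_fun (x \<bullet> y) \<partial>sphere_measure) =
      - (1 / limprod) * (\<integral>y. u y \<partial>sphere_measure) + measure sphere_measure (sphere 0 1 :: 'a set) * u x"
    and "(\<integral>y. f y \<partial>sphere_measure) = a * (\<integral>y. u y \<partial>sphere_measure)"
proof -
  let ?c = "measure sphere_measure (sphere 0 1 :: 'a set) / mom 0"
  interpret zonal_pushforward d a sphere_measure "\<lambda>y. x \<bullet> y" ?c
    by (rule zonal_pushforward_sphere[OF x dim])
  note cu = laplace_beltrami_continuous[OF u]
  obtain B where "\<forall>z \<in> f ` sphere 0 1. norm z \<le> B"
    using compact_imp_bounded[OF compact_continuous_image[OF f compact_sphere]] unfolding bounded_iff by blast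
  then have B: "AE y in sphere_measure. \<bar>f y\<bar> \<le> B" by (intro AE_I2) auto
  have fm: "f \<in> borel_measurable sphere_measure"
    by (intro borel_measurable_integrable integrable_sphere_continuous f)
  show "integrable sphere_measure (\<lambda>y. f y * green_fun (x \<bullet> y))"
    by (rule green_series(1)[OF fm B])
  have near: "\<exists>C\<ge>0. AE y in sphere_measure. \<bar>u y - u x\<bar> \<le> e + C * (1 - x \<bullet> y)" if "e > 0" for e
  proof -
    have "x \<in> sphere 0 1" using x by simp
    from continuous_at_compact_quadratic[OF compact_sphere cu(1) this that]
    obtain C where C: "C \<ge> 0" "\<And>y. y \<in> sphere 0 1 \<Longrightarrow> \<bar>u y - u x\<bar> \<le> e + C * (dist y x)\<^sup>2"
      by blast
    have "\<bar>u y - u x\<bar> \<le> e + 2 * C * (1 - x \<bullet> y)" if y: "y \<in> sphere 0 1" for y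
    proof -
      have eq: "(dist y x)\<^sup>2 = 2 * (1 - x \<bullet> y)"
        using x y by (simp add: dist_norm power2_norm_eq_inner inner_diff_left inner_diff_right inner_commute norm_eq_1)
      show ?thesis using C(2)[OF y] unfolding eq by (simp add: algebra_simps)
    qed
    then show ?thesis using C(1) by (intro exI[of _ "2 * C"] conjI AE_I2) auto
  qed
  have green: "(\<integral>y. f y * poly P (x \<bullet> y) \<partial>sphere_measure) =
     (\<integral>y. u y * poly (gegenbauer_op d P + smult a P) (x \<bullet> y) \<partial>sphere_measure)" for P
  proof -
    have cp: "continuous_on (sphere 0 1) (\<lambda>y. poly p (x \<bullet> y))" for p by (intro continuous_intros)
    have int: "integrable sphere_measure (\<lambda>y. laplace_beltrami u y * poly p (x \<bullet> y))"
      "integrable sphere_measure (\<lambda>y. u y * poly p (x \<bullet> y))" for p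
      by (intro integrable_sphere_continuous continuous_intros cu cp)+
    have "(\<integral>y. f y * poly P (x \<bullet> y) \<partial>sphere_measure) =
        (\<integral>y. laplace_beltrami u y * poly P (x \<bullet> y) + a * (u y * poly P (x \<bullet> y)) \<partial>sphere_measure)"
      using eq by (intro Bochner_Integration.integral_cong) (auto simp: algebra_simps simp flip: eq)
    also have "\<dots> = (\<integral>y. u y * poly (gegenbauer_op d P) (x \<bullet> y) + a * (u y * poly P (x \<bullet> y)) \<partial>sphere_measure)"
      using sphere_green_poly[OF u x, of P] by (simp add: int dim)
    finally show ?thesis by (simp add: algebra_simps)
  qed
  show "(\<integral>y. f y * green_fun (x \<bullet> y) \<partial>sphere_measure) =
      - (1 / limprod) * (\<integral>y. u y \<partial>sphere_measure) + measure sphere_measure (sphere 0 1 :: 'a set) * u x"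
    using green_representation[OF fm B integrable_sphere_continuous[OF cu(1)] near green] mom_pos[of 0]
    by simp
  show "(\<integral>y. f y \<partial>sphere_measure) = a * (\<integral>y. u y \<partial>sphere_measure)"
    using green[of 1] by (simp add: mult.commute)
qed

end


section \<open>Expansions and the representation theorem\<close>

lemma zonal_pushforward_integrable:
  fixes g :: "real \<Rightarrow> real" and e :: "'a::euclidean_space"
  assumes e: "norm e = 1" and d: "d = real DIM('a) - 1" "d \<ge> 2" and [measurable]: "g \<in> borel_measurable borel"
  shows "integrable sphere_measure (\<lambda>x. g (e \<bullet> x)) \<longleftrightarrow> integrable (zonal_measure d) g"
proof -
  let ?c = "measure sphere_measure (sphere 0 1 :: 'a set) / measure (zonal_measure d) UNIV"
  have c: "?c > 0"
    using zonal_measure_pos[OF d(2)] by (simp add: measure_sphere_measure_total Gamma_real_pos)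
  have [measurable]: "(\<lambda>y. e \<bullet> y) \<in> borel_measurable sphere_measure"
    by (intro borel_measurable_integrable integrable_sphere_continuous continuous_intros)
  have "integrable sphere_measure (\<lambda>x. g (e \<bullet> x)) \<longleftrightarrow> integrable (distr sphere_measure borel (\<lambda>y. e \<bullet> y)) g"
    by (subst integrable_distr_eq) auto
  also have "\<dots> \<longleftrightarrow> integrable (zonal_measure d) (\<lambda>t. ?c *\<^sub>R g t)"
    unfolding distr_sphere_measure_inner[OF e d] using c by (subst integrable_density) auto
  also have "\<dots> \<longleftrightarrow> integrable (zonal_measure d) g"
  proof
    define c where "c = ?c"
    assume "integrable (zonal_measure d) (\<lambda>t. ?c *\<^sub>R g t)"
    then have "integrable (zonal_measure d) (\<lambda>t. (1 / c) *\<^sub>R (c *\<^sub>R g t))"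
      unfolding c_def by (rule integrable_scaleR_right)
    then show "integrable (zonal_measure d) g" using c by (simp add: c_def[symmetric])
  qed (rule integrable_scaleR_right)
  finally show ?thesis .
qed

lemma zonal_L1_inner:
  "zonal_L1 TYPE(real^'n::{finite,wellorder}) g \<longleftrightarrow>
     integrable sphere_measure (\<lambda>x :: real^'n::_. g (axis (LEAST i. True) 1 \<bullet> x))"
  by (simp add: zonal_L1_def inner_axis')

text \<open>Integrability on the sphere only says that \<open>x \<mapsto> g (x $ i)\<close> is
  measurable there. Composing with a continuous half circle \<open>phi\<close> that meets every
  level \<open>t\<close> of the distinguished coordinate recovers measurability of \<open>g\<close>
  on \<open>[-1, 1]\<close>; outside that interval \<open>g\<close> is arbitrary, whence the
  indicator.\<close>

lemma zonal_L1_measurable: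
  fixes g :: "real \<Rightarrow> real"
  assumes g: "zonal_L1 TYPE(real^'n::{finite,wellorder}) g" and card: "CARD('n) \<ge> 2"
  shows "(\<lambda>t. indicator {-1..1} t * g t) \<in> borel_measurable borel"
proof -
  let ?i = "LEAST i :: 'n. True"
  obtain j :: 'n where j: "j \<noteq> ?i"
    using card by (metis (full_types) CARD_1 One_nat_def card_1_singleton_iff numeral_le_one_iff
        semiring_norm(69) UNIV_eq_I singletonI UNIV_I Suc_1)
  define phi :: "real \<Rightarrow> real^'n::_" where "phi = (\<lambda>t. t *\<^sub>R axis ?i 1 + sqrt (1 - t\<^sup>2) *\<^sub>R axis j 1)"
  have phi_i: "phi t $ ?i = t" for t using j by (simp add: phi_def axis_def)
  have phi_sphere: "phi t \<in> sphere 0 1" if "t \<in> {-1..1}" for t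
  proof -
    have "axis ?i (1::real) \<bullet> axis j 1 = 0" using j by (simp add: inner_axis_axis)
    then have "phi t \<bullet> phi t = t\<^sup>2 + (sqrt (1 - t\<^sup>2))\<^sup>2"
      by (simp add: phi_def inner_add_left inner_add_right inner_axis_axis power2_eq_square j j[symmetric])
    also have "\<dots> = 1" using one_minus_square_nonneg[OF that] by simp
    finally show ?thesis by (simp add: norm_eq_1)
  qed
  have "phi \<in> borel_measurable borel"
    unfolding phi_def by (intro borel_measurable_continuous_onI continuous_intros)
  then have "phi \<in> measurable (restrict_space borel {-1..1}) (restrict_space borel (sphere 0 1))"
    using phi_sphere by (intro measurable_restrict_space2 measurable_restrict_space1) (auto simp: space_restrict_space)
  moreover have "(\<lambda>x :: real^'n::_. g (x $ ?i)) \<in> borel_measurable (restrict_space borel (sphere 0 1))"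
    using borel_measurable_integrable[OF g[unfolded zonal_L1_def]] by (simp add: measurable_sphere_measure)
  ultimately have "(\<lambda>t. g (phi t $ ?i)) \<in> borel_measurable (restrict_space borel {-1..1})"
    by (rule measurable_compose)
  then show ?thesis by (simp add: phi_i borel_measurable_restrict_space_iff)
qed

lemma gegenbauer_coeff_indicator:
  "gegenbauer_coeff lam (\<lambda>t. indicator {-1..1} t * g t) l = gegenbauer_coeff lam g l"
  unfolding gegenbauer_coeff_def set_lebesgue_integral_def
  by (intro arg_cong2[where f = "(/)"] Bochner_Integration.integral_cong) (auto simp: indicator_def)

text \<open>Equal coefficients mean equal integrals against all Gegenbauer polynomials, hence
  against all polynomials. The two profiles then agree almost everywhere for the zonal measure, and
  the law of \<open>x \<bullet> y\<close> carries this over to the sphere for every pole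
  \<open>x\<close>.\<close>

lemma sphere_integral_expansion_cong:
  fixes G g :: "real \<Rightarrow> real" and x :: "real^'n::{finite,wellorder}"
  assumes d: "d = real (CARD('n)) - 1" "d \<ge> 2" "d = 2 * lam + 1"
    and G: "G \<in> borel_measurable borel" "has_gegenbauer_expansion TYPE(real^'n::_) lam G c"
    and g: "has_gegenbauer_expansion TYPE(real^'n::_) lam g c"
    and x: "norm x = 1" and f: "f \<in> borel_measurable sphere_measure"
  shows "(\<integral>y. f y * g (x \<bullet> y) \<partial>sphere_measure) = (\<integral>y. f y * G (x \<bullet> y) \<partial>sphere_measure)"
proof -
  note [measurable] = G(1) f
  have lam: "lam > 0" using d by simp
  have d': "d = real DIM(real^'n::_) - 1" using d(1) by simp
  define g' where "g' = (\<lambda>t. indicator {-1..1} t * g t)"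
  have [measurable]: "g' \<in> borel_measurable borel"
    unfolding g'_def using g d by (intro zonal_L1_measurable) (auto simp: has_gegenbauer_expansion_def)
  have xm [measurable]: "(\<lambda>y. z \<bullet> y) \<in> borel_measurable sphere_measure" for z :: "real^'n::_"
    by (intro borel_measurable_integrable integrable_sphere_continuous continuous_intros)
  have in1: "\<bar>z \<bullet> y\<bar> \<le> 1" if "norm z = 1" "norm y = 1" for z y :: "real^'n::_"
    using Cauchy_Schwarz_ineq2[of z y] that by simp
  have g'_eq: "g' (z \<bullet> y) = g (z \<bullet> y)" if "norm z = 1" "norm y = 1" for z y :: "real^'n::_"
    using in1[OF that] by (simp add: g'_def abs_le_iff)
  let ?e = "axis (LEAST i :: 'n. True) (1::real)"
  have e: "norm ?e = 1" by simp
  have iG: "integrable (zonal_measure d) G"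
    using G(2) zonal_pushforward_integrable[OF e d' d(2) G(1)]
    by (simp add: has_gegenbauer_expansion_def zonal_L1_inner)
  have "integrable sphere_measure (\<lambda>y. g' (?e \<bullet> y))"
    using g unfolding has_gegenbauer_expansion_def zonal_L1_inner
    by (subst Bochner_Integration.integrable_cong[OF refl, of _ _ "\<lambda>y. g (?e \<bullet> y)"]) (auto simp: g'_eq)
  then have ig: "integrable (zonal_measure d) g'"
    by (subst (asm) zonal_pushforward_integrable[OF e d' d(2)]) auto
  have mult: "integrable (zonal_measure d) (\<lambda>t. q t * poly p t)" if q: "integrable (zonal_measure d) q" for p q
  proof -
    have [measurable]: "q \<in> borel_measurable borel" using q by (auto dest: borel_measurable_integrable)
    have pm [measurable]: "poly p \<in> borel_measurable borel"
      by (intro borel_measurable_continuous_onI continuous_intros)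
    have "continuous_on {-1..1} (poly p)" by (intro continuous_intros)
    then obtain B where B: "\<And>t. t \<in> {-1..1} \<Longrightarrow> norm (poly p t) \<le> B"
      using compact_imp_bounded[OF compact_continuous_image] compact_Icc by (metis bounded_iff imageI)
    show ?thesis
    proof (rule Bochner_Integration.integrable_bound)
      show "integrable (zonal_measure d) (\<lambda>t. q t * B)" using q by simp
      show "AE t in zonal_measure d. norm (q t * poly p t) \<le> norm (q t * B)"
        using AE_zonal_measure
      proof eventually_elim
        case (elim t)
        then have "t \<in> {-1..1}" by auto
        then have "\<bar>poly p t\<bar> \<le> B" using B[of t] by simp
        then show ?case by (auto simp: abs_mult intro!: mult_left_mono)
      qed
    qed measurable
  qed
  have "(\<integral>t. g' t * poly p t \<partial>zonal_measure d) = (\<integral>t. G t * poly p t \<partial>zonal_measure d)" for p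
  proof (rule gegenbauer_poly_span[OF lam, of "\<lambda>p. (\<integral>t. g' t * poly p t \<partial>zonal_measure d) = (\<integral>t. G t * poly p t \<partial>zonal_measure d)"])
    fix l
    \<comment> \<open>Undoes the factor \<open>(lam + l) / lam\<close>, so that
      \<open>gegenbauer_coeff_iff\<close> applies to arbitrary coefficients.\<close>
    define cl where "cl = c l * lam / (lam + real l)"
    have cl: "c l = cl * ((lam + real l) / lam)" using lam by (simp add: cl_def)
    have "gegenbauer_coeff lam g' l = c l" "gegenbauer_coeff lam G l = c l"
      using g G(2) by (simp_all add: has_gegenbauer_expansion_def g'_def gegenbauer_coeff_indicator)
    note this[unfolded cl]
    then show "(\<integral>t. g' t * poly (gegenbauer_poly lam l) t \<partial>zonal_measure d) = (\<integral>t. G t * poly (gegenbauer_poly lam l) t \<partial>zonal_measure d)"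
      by (subst (asm) (1 2) gegenbauer_coeff_iff[OF d(2,3)]) simp_all
  qed (simp_all add: ring_distribs mult ig iG mult.left_commute[of _ "_ :: real" "poly _ _"])
  note poly_eq = this
  have "(\<integral>t. (g' t - G t) * t ^ k \<partial>zonal_measure d) = 0" for k
    using poly_eq[of "monom 1 k"] mult[OF ig, of "monom 1 k"] mult[OF iG, of "monom 1 k"]
    by (simp add: poly_monom left_diff_distrib)
  then have "AE t in zonal_measure d. g' t - G t = 0"
    by (intro zonal_measure_moments_zero d Bochner_Integration.integrable_diff ig iG)
  then have "AE t in distr sphere_measure borel (\<lambda>y. x \<bullet> y). g' t = G t"
    unfolding distr_sphere_measure_inner[OF x d' d(2)]
    by (subst AE_density) (auto elim!: eventually_mono)
  then have ae: "AE y in sphere_measure. g' (x \<bullet> y) = G (x \<bullet> y)"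
    by (subst (asm) AE_distr_iff) auto
  have "(\<integral>y. f y * g (x \<bullet> y) \<partial>sphere_measure) = (\<integral>y. f y * g' (x \<bullet> y) \<partial>sphere_measure)"
    by (intro Bochner_Integration.integral_cong) (auto simp: g'_eq[OF x])
  also have "\<dots> = (\<integral>y. f y * G (x \<bullet> y) \<partial>sphere_measure)"
    by (rule integral_cong_AE) (use ae in \<open>auto elim!: eventually_mono\<close>)
  finally show ?thesis .
qed

lemma has_gegenbauer_expansionI:
  fixes c :: "nat \<Rightarrow> real"
  assumes d: "d = real (CARD('n::{finite,wellorder})) - 1" "d \<ge> 2" "d = 2 * lam + 1"
    and G: "integrable (zonal_measure d) G"
    and "\<And>l. (\<integral>t. G t * poly (gegenbauer_poly lam l) t \<partial>zonal_measure d) =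
      c l * (measure (zonal_measure d) UNIV * poly (gegenbauer_poly lam l) 1)"
  shows "has_gegenbauer_expansion TYPE(real^'n::_) lam G (\<lambda>l. c l * ((lam + real l) / lam))"
proof -
  have m: "G \<in> borel_measurable borel" using G by (auto dest: borel_measurable_integrable)
  have "zonal_L1 TYPE(real^'n::_) G"
    unfolding zonal_L1_inner using d G by (subst zonal_pushforward_integrable[OF _ _ d(2) m]) auto
  then show ?thesis
    unfolding has_gegenbauer_expansion_def using gegenbauer_coeff_iff[OF d(2,3) m] assms(5) by blast
qed

section \<open>Coefficients and convolution of the kernel with an additive constant\<close>

context zonal_kernel
begin

text \<open>The product form contains the vanishing of the mean for \<open>l \<ge> 1\<close> and is
  trivially true for \<open>l = 0\<close>, so the first part of the theorem can use it without a
  case distinction.\<close>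

lemma integral_gegenbauer_poly:
  assumes "d = 2 * lam + 1"
  shows "real l * (real l + d - 1) * (\<integral>t. poly (gegenbauer_poly lam l) t \<partial>zonal_measure d) = 0"
  using integral_gegenbauer_op[OF d, of "gegenbauer_poly lam l"] gegenbauer_op_gegenbauer_poly[of lam l]
  by (auto simp: assms)

text \<open>Gegenbauer polynomials are eigenfunctions, so \<open>green_fun_poly\<close> reduces to
  one integral. The term with \<open>1 / limprod\<close> survives in degree 0 only; it is the
  discrepancy that the additive constant corrects.\<close>

lemma green_fun_gegenbauer_poly:
  assumes "d = 2 * lam + 1"
  shows "(a - real l * (real l + d - 1)) * (\<integral>t. green_fun t * poly (gegenbauer_poly lam l) t \<partial>zonal_measure d) =
    - (1 / limprod) * (\<integral>t. poly (gegenbauer_poly lam l) t \<partial>zonal_measure d)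
    + mom 0 * poly (gegenbauer_poly lam l) 1"
proof -
  let ?C = "gegenbauer_poly lam l"
  have "gegenbauer_op d ?C + smult a ?C = smult (a - real l * (real l + d - 1)) ?C"
    using gegenbauer_op_gegenbauer_poly[of lam l] by (simp add: assms smult_diff_left)
  then have "(\<integral>t. (a - real l * (real l + d - 1)) * (green_fun t * poly ?C t) \<partial>zonal_measure d) =
     - (1 / limprod) * (\<integral>t. poly ?C t \<partial>zonal_measure d) + mom 0 * poly ?C 1"
    using green_fun_poly[of ?C] by (simp only: poly_smult mult_ac)
  then show ?thesis by (simp only: integral_mult_right_zero)
qed

lemma integral_shifted_green_fun:
  "(\<integral>t. (green_fun t + c) * poly p t \<partial>zonal_measure d) =
     (\<integral>t. green_fun t * poly p t \<partial>zonal_measure d) + c * (\<integral>t. poly p t \<partial>zonal_measure d)"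
  using poly_green_fun_integrable[of p] integrable_zonal_measure_poly[OF d, of p]
  by (simp add: ring_distribs mult.commute)

lemma shifted_green_fun_integrable: "integrable (zonal_measure d) (\<lambda>t. green_fun t + c)"
proof -
  interpret finite_measure "zonal_measure d" by (rule finite_measure_zonal_measure[OF d])
  show ?thesis using green_fun_integrable by simp
qed

text \<open>The hypothesis \<open>shift\<close> covers both parts: either the constant satisfies
  \<open>a * c = 1 / limprod\<close>, or the integral of \<open>u\<close> is zero.\<close>

lemma sphere_conv_shifted_green_fun:
  fixes x :: "'a::euclidean_space"
  assumes x: "norm x = 1" and dim: "d = real DIM('a) - 1"
    and u: "C2_on_sphere u" and f: "continuous_on (sphere 0 1) f"
    and eq: "\<And>y. y \<in> sphere 0 1 \<Longrightarrow> laplace_beltrami u y + a * u y = f y"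
    and shift: "(a * c - 1 / limprod) * (\<integral>y. u y \<partial>sphere_measure) = 0"
  shows "sphere_conv f (\<lambda>t. green_fun t + c) x = u x"
proof -
  have rep1: "integrable sphere_measure (\<lambda>y. f y * green_fun (x \<bullet> y))"
    by (rule sphere_green_representation(1)[OF x dim u f eq])
  have rep2: "(\<integral>y. f y * green_fun (x \<bullet> y) \<partial>sphere_measure) =
      - (1 / limprod) * (\<integral>y. u y \<partial>sphere_measure) + measure sphere_measure (sphere 0 1 :: 'a set) * u x"
    by (rule sphere_green_representation(2)[OF x dim u f eq])
  have rep3: "(\<integral>y. f y \<partial>sphere_measure) = a * (\<integral>y. u y \<partial>sphere_measure)"
    by (rule sphere_green_representation(3)[OF x dim u f eq])
  have "(\<integral>y. f y * (green_fun (x \<bullet> y) + c) \<partial>sphere_measure) =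
      (\<integral>y. f y * green_fun (x \<bullet> y) \<partial>sphere_measure) + c * (\<integral>y. f y \<partial>sphere_measure)"
    using rep1 integrable_sphere_continuous[OF f] by (simp add: ring_distribs mult.commute)
  also have "\<dots> = measure sphere_measure (sphere 0 1 :: 'a set) * u x"
    using shift unfolding rep2 rep3 by (simp add: algebra_simps)
  finally show ?thesis
    by (simp add: sphere_conv_def measure_sphere_measure_total less_imp_neq[OF Gamma_real_pos, symmetric])
qed

end

text \<open>Besides the formula, each part asserts that a function with the prescribed coefficients
  exists; the formula is then claimed for every such function.\<close>

theorem theorem4p1:
  fixes n :: nat and lam :: real
  assumes "n \<ge> 2" and "CARD('n::{finite,wellorder}) = n + 1" and "lam = (real n - 1) / 2"
  shows
    "(\<forall>a. a \<notin> {real l * (real n + real l - 1) | l :: nat. True} \<longrightarrow>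
        (let c = (\<lambda>l::nat. 1 / (a - real l * (real n + real l - 1)) * ((lam + real l) / lam)) in
          (\<exists>G. has_gegenbauer_expansion TYPE(real^'n::_) lam G c) \<and>
          (\<forall>(f :: real^'n::_ \<Rightarrow> real) u G.
             continuous_on (sphere 0 1) f \<and> C2_on_sphere u \<and>
             (\<forall>x\<in>sphere 0 1. laplace_beltrami u x + a * u x = f x) \<and>
             has_gegenbauer_expansion TYPE(real^'n::_) lam G c \<longrightarrow>
             (\<forall>x\<in>sphere 0 1. u x = sphere_conv f G x))))
     \<and>
     (let c = (\<lambda>l::nat. if l = 0 then 0
                 else - 1 / (real l * (real n + real l - 1)) * ((lam + real l) / lam)) in
        (\<exists>G. has_gegenbauer_expansion TYPE(real^'n::_) lam G c) \<and>
        (\<forall>(f :: real^'n::_ \<Rightarrow> real) u G.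
           continuous_on (sphere 0 1) f \<and> C2_on_sphere u \<and>
           (LINT y|sphere_measure. f y) = 0 \<and> (LINT y|sphere_measure. u y) = 0 \<and>
           (\<forall>x\<in>sphere 0 1. laplace_beltrami u x = f x) \<and>
           has_gegenbauer_expansion TYPE(real^'n::_) lam G c \<longrightarrow>
           (\<forall>x\<in>sphere 0 1. u x = sphere_conv f G x)))"
    (is "?part1 \<and> ?part2")
proof
  define d where "d = real n"
  have dd: "d = real CARD('n) - 1" "d \<ge> 2" "d = 2 * lam + 1" using assms by (simp_all add: d_def)
  have dim: "d = real DIM(real^'n::_) - 1" using dd(1) by simp
  have lam: "lam > 0" using dd by simp
  have ev: "real l * (real n + real l - 1) = real l * (real l + d - 1)" for l by (simp add: d_def)
  \<comment> \<open>Reduces the claim for an arbitrary \<open>G\<close> to a single concrete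
    function with the same coefficients.\<close>
  have conv: "sphere_conv f G x = sphere_conv f H x"
    if "has_gegenbauer_expansion TYPE(real^'n::_) lam H c" "H \<in> borel_measurable borel"
       "has_gegenbauer_expansion TYPE(real^'n::_) lam G c" "continuous_on (sphere 0 1) f" "x \<in> sphere 0 1"
    for f :: "real^'n::_ \<Rightarrow> real" and G H c x
  proof -
    have "f \<in> borel_measurable sphere_measure"
      by (intro borel_measurable_integrable integrable_sphere_continuous that)
    then show ?thesis
      using sphere_integral_expansion_cong[OF dd that(2,1,3)] that(5) by (simp add: sphere_conv_def)
  qed
  show ?part1
  proof (intro allI impI)
    fix a :: real assume a: "a \<notin> {real l * (real n + real l - 1) | l :: nat. True}"
    then have a_ne: "a \<noteq> real l * (real l + d - 1)" for l by (auto simp: ev)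
    have a0: "a \<noteq> 0" using a_ne[of 0] by simp
    interpret zonal_kernel d a by unfold_locales (use dd(2) a_ne in auto)
    \<comment> \<open>Chosen so that \<open>a * m\<close> cancels \<open>1 / limprod\<close>, both
      in the coefficients and in the convolution; \<open>a \<noteq> 0\<close> because the eigenvalue
      of degree 0 is excluded.\<close>
    define m where "m = 1 / (a * limprod)"
    define H where "H = (\<lambda>t. green_fun t + m)"
    define c where "c = (\<lambda>l::nat. 1 / (a - real l * (real n + real l - 1)) * ((lam + real l) / lam))"
    have H_meas: "H \<in> borel_measurable borel" unfolding H_def by measurable
    have H: "has_gegenbauer_expansion TYPE(real^'n::_) lam H c"
      unfolding c_def ev
    proof (rule has_gegenbauer_expansionI[OF dd])
      show "integrable (zonal_measure d) H" unfolding H_def by (rule shifted_green_fun_integrable)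
      fix l
      let ?C = "gegenbauer_poly lam l"
      let ?ev = "real l * (real l + d - 1)"
      define I where "I = (\<integral>t. poly ?C t \<partial>zonal_measure d)"
      define J where "J = (\<integral>t. green_fun t * poly ?C t \<partial>zonal_measure d)"
      have "(a - ?ev) * (J + m * I) = (a - ?ev) * J + a * m * I - m * (?ev * I)"
        by (simp add: algebra_simps)
      also have "?ev * I = 0" unfolding I_def by (rule integral_gegenbauer_poly[OF dd(3)])
      also have "(a - ?ev) * J = - (1 / limprod) * I + mom 0 * poly ?C 1"
        unfolding I_def J_def by (rule green_fun_gegenbauer_poly[OF dd(3)])
      also have "a * m = 1 / limprod" using a0 by (simp add: m_def)
      finally have "(a - ?ev) * (J + m * I) = mom 0 * poly ?C 1" by simp
      then have "J + m * I = 1 / (a - ?ev) * (mom 0 * poly ?C 1)" using a_ne[of l] by (simp add: field_simps)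
      then show "(\<integral>t. H t * poly ?C t \<partial>zonal_measure d) =
          1 / (a - ?ev) * (measure (zonal_measure d) UNIV * poly ?C 1)"
        unfolding H_def integral_shifted_green_fun I_def J_def mom_0 .
    qed
    have "u x = sphere_conv f G x"
      if "continuous_on (sphere 0 1) f" "C2_on_sphere u" "\<forall>x\<in>sphere 0 1. laplace_beltrami u x + a * u x = f x"
        "has_gegenbauer_expansion TYPE(real^'n::_) lam G c" "x \<in> sphere 0 1"
      for f :: "real^'n::_ \<Rightarrow> real" and u G x
    proof -
      have "sphere_conv f H x = u x"
        unfolding H_def using that a0 by (intro sphere_conv_shifted_green_fun dim) (auto simp: m_def)
      then show ?thesis using conv[OF H H_meas that(4,1,5)] by simp
    qed
    with H show "let c = (\<lambda>l::nat. 1 / (a - real l * (real n + real l - 1)) * ((lam + real l) / lam)) in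
          (\<exists>G. has_gegenbauer_expansion TYPE(real^'n::_) lam G c) \<and>
          (\<forall>(f :: real^'n::_ \<Rightarrow> real) u G.
             continuous_on (sphere 0 1) f \<and> C2_on_sphere u \<and>
             (\<forall>x\<in>sphere 0 1. laplace_beltrami u x + a * u x = f x) \<and>
             has_gegenbauer_expansion TYPE(real^'n::_) lam G c \<longrightarrow>
             (\<forall>x\<in>sphere 0 1. u x = sphere_conv f G x))"
      unfolding c_def[symmetric] Let_def by blast
  qed
  show ?part2
  proof -
    have ev_pos: "real l * (real l + d - 1) > 0" if "l \<ge> 1" for l using that dd(2) by simp
    interpret zonal_kernel d 0 by unfold_locales (use dd(2) ev_pos in \<open>auto simp: less_imp_neq\<close>)
    \<comment> \<open>The shift that gives the kernel mean zero, that is, a vanishing coefficient of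
      degree 0. It does not affect the higher degrees, whose polynomials have mean zero.\<close>
    define m where "m = - (\<integral>t. green_fun t \<partial>zonal_measure d) / mom 0"
    define H where "H = (\<lambda>t. green_fun t + m)"
    define e where "e = (\<lambda>l::nat. if l = 0 then 0 else - 1 / (real l * (real n + real l - 1)))"
    define c where "c = (\<lambda>l::nat. if l = 0 then 0
                 else - 1 / (real l * (real n + real l - 1)) * ((lam + real l) / lam))"
    have c_eq: "c = (\<lambda>l. e l * ((lam + real l) / lam))" by (auto simp: c_def e_def fun_eq_iff)
    have H_meas: "H \<in> borel_measurable borel" unfolding H_def by measurable
    have H: "has_gegenbauer_expansion TYPE(real^'n::_) lam H c"
      unfolding c_eq
    proof (rule has_gegenbauer_expansionI[OF dd])
      show "integrable (zonal_measure d) H" unfolding H_def by (rule shifted_green_fun_integrable)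
      fix l
      let ?C = "gegenbauer_poly lam l"
      let ?ev = "real l * (real l + d - 1)"
      define I where "I = (\<integral>t. poly ?C t \<partial>zonal_measure d)"
      define J where "J = (\<integral>t. green_fun t * poly ?C t \<partial>zonal_measure d)"
      have "J + m * I = e l * (mom 0 * poly ?C 1)"
      proof (cases "l = 0")
        case True
        then show ?thesis using mom_pos[of 0] by (simp add: I_def J_def e_def m_def mom_0)
      next
        case False
        then have "?ev > 0" by (intro ev_pos) simp
        then have "?ev \<noteq> 0" by linarith
        moreover have "?ev * I = 0" unfolding I_def by (rule integral_gegenbauer_poly[OF dd(3)])
        ultimately have "I = 0" by simp
        moreover have "(0 - ?ev) * J = - (1 / limprod) * I + mom 0 * poly ?C 1"
          unfolding I_def J_def by (rule green_fun_gegenbauer_poly[OF dd(3)])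
        ultimately have "- ?ev * J = mom 0 * poly ?C 1" by simp
        moreover have "J = - 1 / E * X" if "- E * J = X" "E \<noteq> 0" for E X
          using that by (simp add: field_simps)
        ultimately have "J = - 1 / ?ev * (mom 0 * poly ?C 1)" using \<open>?ev \<noteq> 0\<close> by blast
        then show ?thesis using False \<open>I = 0\<close> by (simp add: e_def ev)
      qed
      then show "(\<integral>t. H t * poly ?C t \<partial>zonal_measure d) =
          e l * (measure (zonal_measure d) UNIV * poly ?C 1)"
        unfolding H_def integral_shifted_green_fun I_def J_def mom_0 .
    qed
    have "u x = sphere_conv f G x"
      if "continuous_on (sphere 0 1) f" "C2_on_sphere u" "(LINT y|sphere_measure. u y) = 0"
        "\<forall>x\<in>sphere 0 1. laplace_beltrami u x = f x"
        "has_gegenbauer_expansion TYPE(real^'n::_) lam G c" "x \<in> sphere 0 1"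
      for f :: "real^'n::_ \<Rightarrow> real" and u G x
    proof -
      have "sphere_conv f H x = u x"
        unfolding H_def using that by (intro sphere_conv_shifted_green_fun dim) auto
      then show ?thesis using conv[OF H H_meas that(5,1,6)] by simp
    qed
    with H show ?thesis unfolding c_def[symmetric] Let_def by blast
  qed
qed

end
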